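(* Let $n\geq 15$ with $n\equiv 3\pmod 4$, let $r$ be odd with $7\leq r<(n-1)/2$, and put $L=n-2r$. Let $V$ consist of the $n$ distinct vertices $p_1,p_2,p_3,q_0=p_4,q_1,\dots,q_L,y_3,\dots,y_r,z_3,\dots,z_r$, and write $y_2:=q_L$. Consider the labelled graph on $V$ with edges: $\{p_1,p_2\}$ with label $0$; $\{p_2,p_3\}$ with label $1$; $\{p_3,p_4\}$ with the two labels $0$ and $2$; $\{q_{s-1},q_s\}$ for $1\leq s\leq L$ with label $1$ if $s$ is odd and $0$ if $s$ is even; $\{y_k,y_{k+1}\}$ with label $k$ for $2\leq k\leq r-1$; $\{z_k,z_{k+1}\}$ with label $k$ for $3\leq k\leq r-1$; and $\{y_{r-1},z_{r-1}\}$, $\{y_r,z_r\}$ with label $r-3$. Then $G\cong A_n$ and $(G,(\rho_0,\dots,\rho_{r-1}))$ is a string C-group of rank $r$ with Schläfli type $\{n-2(r-2),12,6,3^{r-7},6,6,3\}$.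
   Context: A string group generated by involutions (sggi) of rank $r$ is a pair $(G,(\rho_0,\dots,\rho_{r-1}))$ where $\rho_0,\dots,\rho_{r-1}$ are involutions generating the group $G$ such that $(\rho_i\rho_j)^2=1$ whenever $|i-j|\geq 2$. It is a string C-group if in addition it satisfies the intersection property: for all $J,K\subseteq\{0,\dots,r-1\}$, $\langle \rho_j : j\in J\rangle\cap\langle\rho_k : k\in K\rangle=\langle \rho_j : j\in J\cap K\rangle$. The Schläfli type is $\{p_1,\dots,p_{r-1}\}$ where $p_i$ is the order of $\rho_{i-1}\rho_i$; $3^k$ denotes $k$ consecutive entries equal to $3$ (omitted if $k=0$). Labelled-graph convention: the vertex set $V$ is finite, and each edge $\{a,b\}$ ($a\neq b$) carries one or more labels from $\{0,\dots,r-1\}$, the edges carrying any given label being pairwise disjoint; $\rho_k$ denotes the permutation of $V$ equal to the product of the transpositions $(a\,b)$ over all edges $\{a,b\}$ carrying label $k$, and $G=\langle\rho_0,\dots,\rho_{r-1}\rangle\leq \mathrm{Sym}(V)$. *)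

theory Defs
  imports "HOL-Algebra.Sym_Groups" "HOL-Algebra.Generated_Groups" "HOL-Algebra.Multiplicative_Group"
begin

definition sym_on :: "'a set \<Rightarrow> ('a \<Rightarrow> 'a) monoid" where
  "sym_on V = \<lparr> carrier = {p. p permutes V}, mult = (\<circ>), one = id \<rparr>"

definition sggi :: "('a, 'b) monoid_scheme \<Rightarrow> nat \<Rightarrow> (nat \<Rightarrow> 'a) \<Rightarrow> bool" where
  "sggi G r rho \<longleftrightarrow> group G
     \<and> (\<forall>i<r. rho i \<in> carrier G \<and> rho i \<noteq> \<one>\<^bsub>G\<^esub> \<and> rho i \<otimes>\<^bsub>G\<^esub> rho i = \<one>\<^bsub>G\<^esub>)
     \<and> generate G (rho ` {..<r}) = carrier G
     \<and> (\<forall>i<r. \<forall>j<r. (i + 2 \<le> j \<or> j + 2 \<le> i) \<longrightarrow>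
            (rho i \<otimes>\<^bsub>G\<^esub> rho j) [^]\<^bsub>G\<^esub> (2::nat) = \<one>\<^bsub>G\<^esub>)"

definition intersection_property :: "('a, 'b) monoid_scheme \<Rightarrow> nat \<Rightarrow> (nat \<Rightarrow> 'a) \<Rightarrow> bool" where
  "intersection_property G r rho \<longleftrightarrow>
     (\<forall>J K. J \<subseteq> {..<r} \<longrightarrow> K \<subseteq> {..<r} \<longrightarrow>
        generate G (rho ` J) \<inter> generate G (rho ` K) = generate G (rho ` (J \<inter> K)))"

definition string_C_group :: "('a, 'b) monoid_scheme \<Rightarrow> nat \<Rightarrow> (nat \<Rightarrow> 'a) \<Rightarrow> bool" where
  "string_C_group G r rho \<longleftrightarrow> sggi G r rho \<and> intersection_property G r rho"

definition schlafli_type :: "('a, 'b) monoid_scheme \<Rightarrow> nat \<Rightarrow> (nat \<Rightarrow> 'a) \<Rightarrow> nat list" where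
  "schlafli_type G r rho = map (\<lambda>i. group.ord G (rho (i - 1) \<otimes>\<^bsub>G\<^esub> rho i)) [1..<r]"

text \<open>A labelled graph is given by a set of (edge, label) pairs, an edge being a
  2-element set {a,b}; an edge with several labels occurs once per label.
  rho_k swaps the endpoints of every edge with label k and fixes all other points
  (labelled edges with the same label being pairwise disjoint, this is the product
  of the corresponding transpositions).\<close>
definition label_perm :: "('a set \<times> nat) set \<Rightarrow> nat \<Rightarrow> 'a \<Rightarrow> 'a" where
  "label_perm E k x =
     (if \<exists>y. ({x, y}, k) \<in> E \<and> y \<noteq> x then (THE y. ({x, y}, k) \<in> E \<and> y \<noteq> x) else x)"

definition graph_group :: "'a set \<Rightarrow> ('a set \<times> nat) set \<Rightarrow> nat \<Rightarrow> ('a \<Rightarrow> 'a) monoid" where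
  "graph_group V E r = subgroup_generated (sym_on V) ((\<lambda>k. label_perm E k) ` {..<r})"

text \<open>Vertices: P 1, P 2, P 3 are p_1,p_2,p_3; Q s is q_s (0 \<le> s \<le> L), with q_0 = p_4;
  Y k is y_k and Z k is z_k (3 \<le> k \<le> r).\<close>
datatype vtx = P nat | Q nat | Y nat | Z nat

definition thm48_L :: "nat \<Rightarrow> nat \<Rightarrow> nat" where
  "thm48_L n r = n - 2 * r"

definition yv :: "nat \<Rightarrow> nat \<Rightarrow> nat \<Rightarrow> vtx" where
  "yv n r k = (if k = 2 then Q (thm48_L n r) else Y k)"

definition thm48_V :: "nat \<Rightarrow> nat \<Rightarrow> vtx set" where
  "thm48_V n r = {P 1, P 2, P 3} \<union> Q ` {0..thm48_L n r} \<union> Y ` {3..r} \<union> Z ` {3..r}"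

definition thm48_E :: "nat \<Rightarrow> nat \<Rightarrow> (vtx set \<times> nat) set" where
  "thm48_E n r =
     {({P 1, P 2}, 0), ({P 2, P 3}, 1), ({P 3, Q 0}, 0), ({P 3, Q 0}, 2)}
   \<union> {({Q (s - 1), Q s}, if odd s then 1 else 0) | s. 1 \<le> s \<and> s \<le> thm48_L n r}
   \<union> {({yv n r k, yv n r (k + 1)}, k) | k. 2 \<le> k \<and> k \<le> r - 1}
   \<union> {({Z k, Z (k + 1)}, k) | k. 3 \<le> k \<and> k \<le> r - 1}
   \<union> {({yv n r (r - 1), Z (r - 1)}, r - 3), ({Y r, Z r}, r - 3)}"

definition thm48_rho :: "nat \<Rightarrow> nat \<Rightarrow> nat \<Rightarrow> vtx \<Rightarrow> vtx" where
  "thm48_rho n r k = label_perm (thm48_E n r) k"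

definition thm48_G :: "nat \<Rightarrow> nat \<Rightarrow> (vtx \<Rightarrow> vtx) monoid" where
  "thm48_G n r = graph_group (thm48_V n r) (thm48_E n r) r"

end

theory Submission
  imports Defs
begin

text \<open>
  Write \<open>H[i..j]\<close> for the group generated by \<open>\<rho>\<^sub>i, \<dots>, \<rho>\<^sub>j\<close>. For a sequence of involutions with the string
  commutation relations, the intersection property for arbitrary index sets reduces to
  \<open>H[i..j-1] \<inter> H[i+1..j] \<subseteq> H[i+1..j-1]\<close> for all \<open>i < j\<close>.

  All \<open>\<rho>\<^sub>k\<close> are even, and the fourth powers of \<open>\<rho>\<^sub>1 \<rho>\<^sub>2\<close> and \<open>\<rho>\<^sub>2 \<rho>\<^sub>3\<close> are 3-cycles. Carrying such a 3-cycle along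
  the graph shows that \<open>H[0..r-1]\<close> contains all 3-cycles, hence is the alternating group, and that
  \<open>H[1..j]\<close> and \<open>H[2..j]\<close> contain all even permutations of \<open>y\<^sub>1, \<dots>, y\<^sub>j\<^sub>+\<^sub>1\<close> and \<open>y\<^sub>2, \<dots>, y\<^sub>j\<^sub>+\<^sub>1\<close> (and of the
  \<open>z\<close>-vertices as well once \<open>j = r - 2\<close>). An element of \<open>H[i..j-1] \<inter> H[i+1..j]\<close> with \<open>i \<le> 1\<close> is therefore
  multiplied by elements of \<open>H[i+1..j-1]\<close> until only an even permutation of such a set is left.
  For \<open>i \<ge> 2\<close> the group \<open>H[i+1..j]\<close> permutes the pairs \<open>{y\<^sub>m, z\<^sub>m}\<close> as signed permutations, and a given
  element is matched on the pairs first; the flips that remain are products of two flips, a flip of all pairs,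
  or excluded by parity. The dihedral group \<open>H[0..1]\<close> meets \<open>H[1..2]\<close> in the stabiliser of \<open>p\<^sub>1\<close>.
\<close>

section \<open>Words in a sequence of permutations\<close>

text \<open>Evenness is what turns a condition on the support into membership: an even permutation
  of a set on which all 3-cycles are available lies in the group without any word being exhibited.
  The congruences on \<open>n\<close> and \<open>r\<close> give L = 1 modulo 4, and this makes
  \<open>rho 0\<close> and \<open>rho 1\<close> products of an even number of transpositions. The
  exponent 4 comes from cycle lengths: apart from one 3-cycle, the two products have only cycles of
  length 1, 2 and 4. From label 3 upwards all generators respect the pairs {y_m, z_m}, so no 3-cycle
  is available and the question becomes which flips a subgroup contains. Both rungs between the
  y-path and the z-path carry the label r-3, which lies in the middle of the path labels; the
  position of an interval relative to r-3 forces the case distinctions. If r-4 and r-3 are present,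
  the last two pairs can be flipped together; if the labels start at r-3, only the last four pairs
  can be flipped, all at once; if they start later, there are no flips.\<close>

inductive_set words :: "(nat \<Rightarrow> 'a \<Rightarrow> 'a) \<Rightarrow> nat set \<Rightarrow> ('a \<Rightarrow> 'a) set"
  for s :: "nat \<Rightarrow> 'a \<Rightarrow> 'a" and J :: "nat set" where
  words_id: "id \<in> words s J"
| words_step: "k \<in> J \<Longrightarrow> g \<in> words s J \<Longrightarrow> s k \<circ> g \<in> words s J"

lemma words_gen: "k \<in> J \<Longrightarrow> s k \<in> words s J"
  using words_step[OF _ words_id] by fastforce

lemma words_comp: "g \<in> words s J \<Longrightarrow> h \<in> words s J \<Longrightarrow> g \<circ> h \<in> words s J"
proof (induction rule: words.induct)
  case words_id
  then show ?case by (metis id_comp)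
next
  case (words_step k g)
  then show ?case by (metis comp_assoc words.words_step)
qed

lemma words_mono: "g \<in> words s J \<Longrightarrow> J \<subseteq> K \<Longrightarrow> g \<in> words s K"
  by (induction rule: words.induct) (auto intro: words.intros)

text \<open>The letters are involutions, so reversing a word inverts it. For this reason
  \<open>words\<close> has no case for inverses and an induction over it has a single step.\<close>

lemma words_inv:
  assumes "g \<in> words s J" and "\<And>k. k \<in> J \<Longrightarrow> s k \<circ> s k = id"
  shows "bij g \<and> inv' g \<in> words s J"
  using assms(1)
proof induction
  case words_id
  then show ?case by (metis bij_id inv_id words.words_id)
next
  case (words_step k g)
  have b: "bij (s k)" using o_bij assms(2) words_step by metis
  moreover have "inv' (s k) = s k" using assms(2) words_step by (metis inv_unique_comp)
  ultimately show ?case using words_step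
    by (metis bij_comp o_inv_distrib words_comp words_gen)
qed

lemma words_fix: "g \<in> words s J \<Longrightarrow> (\<And>k. k \<in> J \<Longrightarrow> s k x = x) \<Longrightarrow> g x = x"
  by (induction rule: words.induct) auto

lemma words_closed:
  "g \<in> words s J \<Longrightarrow> x \<in> S \<Longrightarrow> (\<And>k x. k \<in> J \<Longrightarrow> x \<in> S \<Longrightarrow> s k x \<in> S) \<Longrightarrow> g x \<in> S"
  by (induction rule: words.induct) auto

lemma transpose_in_words:
  assumes "lo \<le> a" "a \<le> b" "b \<le> hi"
  shows "transpose a b \<in> words (\<lambda>k. transpose k (Suc k)) {lo..<hi}"
  using assms(2,3)
proof (induction b rule: dec_induct)
  case base
  have "transpose a a = id" by (simp add: fun_eq_iff)
  then show ?case by (metis words_id)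
next
  case (step b)
  let ?s = "\<lambda>k. transpose k (Suc k)"
  show ?case
  proof (cases "a = b")
    case True
    then show ?thesis using step assms(1) words_gen[of b "{lo..<hi}" ?s] by auto
  next
    case False
    then have "transpose a (Suc b) = ?s b \<circ> (transpose a b \<circ> ?s b)"
      using step by (auto simp: fun_eq_iff transpose_def)
    moreover have "?s b \<in> words ?s {lo..<hi}"
      by (rule words_gen) (use step assms in auto)
    ultimately show ?thesis using step by (metis Suc_leD words_comp)
  qed
qed

lemma permutes_in_words:
  assumes "p permutes {lo..hi::nat}"
  shows "p \<in> words (\<lambda>k. transpose k (Suc k)) {lo..<hi}"
  using assms finite_atLeastAtMost[of lo hi]
proof (induction p rule: permutes_induct)
  case id
  then show ?case by (rule words_id)
next
  case (swap a b p)
  have "transpose a b \<in> words (\<lambda>k. transpose k (Suc k)) {lo..<hi}"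
  proof (cases "a \<le> b")
    case True
    then show ?thesis using swap transpose_in_words by auto
  next
    case False
    then show ?thesis using swap transpose_in_words[of lo b a hi] by (auto simp: transpose_commute)
  qed
  then show ?case using swap by (intro words_comp)
qed

text \<open>The action \<open>act\<close> is application to points or the image of sets: both are needed below.\<close>

lemma words_realise:
  fixes f :: "nat \<Rightarrow> 'b"
  assumes p: "p permutes {lo..hi}"
    and act: "\<And>k m. k \<in> {lo..<hi} \<Longrightarrow> m \<in> {lo..hi} \<Longrightarrow> act (s k) (f m) = f (transpose k (Suc k) m)"
    and act_id: "\<And>x. act id x = x"
    and act_comp: "\<And>g h x. act (g \<circ> h) x = act g (act h x)"
  shows "\<exists>w \<in> words s {lo..<hi}. \<forall>m \<in> {lo..hi}. act w (f m) = f (p m)"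
proof -
  have "\<exists>w \<in> words s {lo..<hi}. \<forall>m \<in> {lo..hi}. q m \<in> {lo..hi} \<and> act w (f m) = f (q m)"
    if "q \<in> words (\<lambda>k. transpose k (Suc k)) {lo..<hi}" for q
    using that
  proof induction
    case words_id
    then show ?case using act_id words.words_id by (metis id_apply)
  next
    case (words_step k q)
    then obtain w where w: "w \<in> words s {lo..<hi}"
      "\<And>m. m \<in> {lo..hi} \<Longrightarrow> q m \<in> {lo..hi} \<and> act w (f m) = f (q m)" by blast
    have t: "transpose k (Suc k) m \<in> {lo..hi}" if "m \<in> {lo..hi}" for m
      using that words_step by (auto simp: transpose_def)
    have "s k \<circ> w \<in> words s {lo..<hi}" using words_step w words.words_step by metis
    moreover have "(transpose k (Suc k) \<circ> q) m \<in> {lo..hi} \<and>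
        act (s k \<circ> w) (f m) = f ((transpose k (Suc k) \<circ> q) m)" if m: "m \<in> {lo..hi}" for m
      unfolding act_comp using w(2)[OF m] t act[OF words_step(1)] by (metis comp_apply)
    ultimately show ?case by blast
  qed
  then show ?thesis using permutes_in_words[OF p] by blast
qed

section \<open>Groups containing three-cycles\<close>

text \<open>The right factor acts first, so for distinct points this is the cycle sending
  \<open>a\<close> to \<open>b\<close>, \<open>b\<close> to \<open>c\<close> and \<open>c\<close> to
  \<open>a\<close>.\<close>

definition cyc3 :: "'a \<Rightarrow> 'a \<Rightarrow> 'a \<Rightarrow> 'a \<Rightarrow> 'a" where
  "cyc3 a b c = transpose a b \<circ> transpose b c"

lemma cyc3_rotate: "a \<noteq> b \<Longrightarrow> b \<noteq> c \<Longrightarrow> a \<noteq> c \<Longrightarrow> cyc3 a b c = cyc3 b c a"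
  by (auto simp: cyc3_def fun_eq_iff transpose_def)

lemma inv_cyc3: "a \<noteq> b \<Longrightarrow> b \<noteq> c \<Longrightarrow> a \<noteq> c \<Longrightarrow> inv' (cyc3 a b c) = cyc3 b a c"
  by (rule inv_unique_comp) (auto simp: cyc3_def fun_eq_iff transpose_def)

lemma conj_transpose: "bij g \<Longrightarrow> g \<circ> transpose a b \<circ> inv' g = transpose (g a) (g b)"
proof
  fix x assume b: "bij g"
  then obtain y where "x = g y" using bij_is_surj by (metis surjD)
  then show "(g \<circ> transpose a b \<circ> inv' g) x = transpose (g a) (g b) x"
    using bij_is_inj[OF b] by (simp add: transpose_def inj_eq)
qed

lemma conj_cyc3:
  assumes "bij g" shows "g \<circ> cyc3 a b c \<circ> inv' g = cyc3 (g a) (g b) (g c)"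
proof -
  have "inv' g \<circ> g = id" using assms by (simp add: bij_is_inj)
  then have "g \<circ> cyc3 a b c \<circ> inv' g
      = (g \<circ> transpose a b \<circ> inv' g) \<circ> (g \<circ> transpose b c \<circ> inv' g)"
    by (simp add: cyc3_def fun_eq_iff)
  then show ?thesis using assms by (simp add: conj_transpose cyc3_def)
qed

lemma cyc3_permutes: "a \<in> B \<Longrightarrow> b \<in> B \<Longrightarrow> c \<in> B \<Longrightarrow> cyc3 a b c permutes B"
  unfolding cyc3_def by (intro permutes_compose permutes_swap_id)

lemma evenperm_cyc3: "a \<noteq> b \<Longrightarrow> b \<noteq> c \<Longrightarrow> evenperm (cyc3 a b c)"
  by (simp add: cyc3_def evenperm_comp evenperm_swap permutation_swap_id)

locale fun_group =
  fixes H :: "('a \<Rightarrow> 'a) set"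
  assumes one: "id \<in> H"
    and comp: "g \<in> H \<Longrightarrow> h \<in> H \<Longrightarrow> g \<circ> h \<in> H"
    and inv_in: "g \<in> H \<Longrightarrow> inv' g \<in> H"
    and bij: "g \<in> H \<Longrightarrow> bij g"
begin

text \<open>Sets of at most two points are vacuously full. They can start an application of
  \<open>full_insert\<close>, but they provide no 3-cycle that could be carried along the
  graph.\<close>

definition full :: "'a set \<Rightarrow> bool" where
  "full B \<longleftrightarrow> (\<forall>a\<in>B. \<forall>b\<in>B. \<forall>c\<in>B. a \<noteq> b \<longrightarrow> b \<noteq> c \<longrightarrow> a \<noteq> c \<longrightarrow> cyc3 a b c \<in> H)"

lemma comp_inv_left: "g \<in> H \<Longrightarrow> g \<circ> h \<in> H \<Longrightarrow> h \<in> H"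
  by (metis bij bij_is_inj comp comp_assoc id_comp inj_iff inv_in)

lemma inv_comp_left: "g \<in> H \<Longrightarrow> inv' g \<circ> h \<in> H \<Longrightarrow> h \<in> H"
  by (metis bij bij_is_surj comp comp_assoc id_comp surj_iff)

text \<open>This is the generation of the alternating group by 3-cycles. A 3-cycle taking
  \<open>x\<close> to \<open>g x\<close> is divided out, after which \<open>x\<close> is fixed. This
  needs a third point \<open>w\<close>; if there is none, \<open>g\<close> is a transposition and
  not even.\<close>

lemma full_even:
  assumes "finite B" "full B" "g permutes B" "evenperm g"
  shows "g \<in> H"
  using assms
proof (induction B arbitrary: g rule: finite_induct)
  case empty
  then show ?case using one by (metis permutes_empty)
next
  case (insert x S g)
  have fS: "full S" using insert.prems(1) unfolding full_def by blast
  show ?case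
  proof (cases "g x = x")
    case True
    then have "g permutes S" using insert.prems(2) insert.hyps
      by (metis Diff_insert_absorb permutes_superset insertE Diff_iff)
    then show ?thesis using insert.IH fS insert.prems by blast
  next
    case False
    then have yS: "g x \<in> S" using insert.prems(2) by (metis insertCI insertE permutes_in_image)
    show ?thesis
    proof (cases "\<exists>w\<in>S. w \<noteq> g x")
      case True
      then obtain w where w: "w \<in> S" "w \<noteq> g x" by blast
      have d: "x \<noteq> g x" "g x \<noteq> w" "x \<noteq> w" using False w insert.hyps by auto
      define c where "c = cyc3 x (g x) w"
      have cH: "c \<in> H" using insert.prems(1) yS w d unfolding c_def full_def by blast
      have cp: "c permutes insert x S" unfolding c_def using yS w by (intro cyc3_permutes) auto
      have fin: "finite (insert x S)" using insert.hyps by simp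
      have ip: "inv' c \<circ> g permutes insert x S"
        using cp insert.prems by (intro permutes_compose permutes_inv)
      have "c x = g x" unfolding c_def cyc3_def using d by (simp add: transpose_def)
      then have "(inv' c \<circ> g) x = x" using cp by (metis comp_apply permutes_inverses(2))
      then have pS: "inv' c \<circ> g permutes S" using ip insert.hyps
        by (metis Diff_insert_absorb permutes_superset insertE Diff_iff)
      have perm: "permutation c" "permutation g"
        using cp insert.prems fin unfolding permutation_permutes by blast+
      have "evenperm (inv' c \<circ> g)"
        using evenperm_comp[of "inv' c" g] evenperm_inv[OF perm(1)] permutation_inverse[OF perm(1)]
          perm evenperm_cyc3[of x "g x" w] insert.prems d unfolding c_def by simp
      then have "inv' c \<circ> g \<in> H" using insert.IH fS pS by blast
      then show ?thesis using cH inv_comp_left by blast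
    next
      case False
      then have S: "S = {g x}" using yS by blast
      then have "g permutes {x, g x}" using insert.prems by simp
      then have "g = id \<or> g = transpose x (g x)" by (metis permutes_doubleton_iff)
      then have "g = transpose x (g x)" using \<open>g x \<noteq> x\<close> by auto
      then have "\<not> evenperm g" using \<open>g x \<noteq> x\<close> by (metis evenperm_swap)
      then show ?thesis using insert.prems by simp
    qed
  qed
qed

text \<open>One 3-cycle through the new point suffices, since conjugation by permutations of
  \<open>B\<close> produces the others. Only even permutations of \<open>B\<close> are known to lie
  in the group; an odd one is first composed with the swap of \<open>a\<close> and \<open>b\<close>,
  and the conjugate is then the inverse of the wanted cycle.\<close>

lemma full_insert:
  assumes B: "finite B" "full B" and ab: "a \<in> B" "b \<in> B" "a \<noteq> b" and x: "x \<notin> B"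
    and c: "cyc3 a b x \<in> H"
  shows "full (insert x B)"
proof -
  have main: "cyc3 u v x \<in> H" if uv: "u \<in> B" "v \<in> B" "u \<noteq> v" for u v
  proof -
    \<comment> \<open>\<open>transpose a u\<close> sends \<open>a\<close> to \<open>u\<close> and
      \<open>b\<close> to \<open>transpose a u b\<close>; the outer transposition sends that point
      on to \<open>v\<close> and leaves \<open>u\<close> alone.\<close>
    define p where "p = transpose (transpose a u b) v \<circ> transpose a u"
    have pa: "p a = u" "p b = v" unfolding p_def using uv ab by (auto simp: transpose_def)
    have pB: "p permutes B" unfolding p_def
      using uv ab by (intro permutes_compose permutes_swap_id) (auto simp: transpose_def)
    then have px: "p x = x" using x by (simp add: permutes_not_in)
    have conj: "cyc3 (q a) (q b) (q x) \<in> H" if "q \<in> H" for q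
      using conj_cyc3[OF bij[OF that], of a b x] comp inv_in that c by metis
    show ?thesis
    proof (cases "evenperm p")
      case True
      then have "p \<in> H" using full_even B pB by blast
      then show ?thesis using conj[of p] pa px by simp
    next
      case False
      define q where "q = p \<circ> transpose a b"
      have q: "q a = v" "q b = u" "q x = x" unfolding q_def using pa px ab x
        by (auto simp: transpose_def)
      have qB: "q permutes B" unfolding q_def using pB ab
        by (intro permutes_compose permutes_swap_id)
      have "permutation p" using pB B unfolding permutation_permutes by blast
      then have "evenperm q" unfolding q_def using False ab
        by (simp add: evenperm_comp permutation_swap_id evenperm_swap)
      then have "q \<in> H" using full_even B qB by blast
      then have "cyc3 v u x \<in> H" using conj[of q] q by simp
      moreover have "cyc3 u v x = inv' (cyc3 v u x)" using uv x by (subst inv_cyc3) auto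
      ultimately show ?thesis using inv_in by simp
    qed
  qed
  show ?thesis unfolding full_def
  proof (intro ballI impI)
    fix p q t assume pqt: "p \<in> insert x B" "q \<in> insert x B" "t \<in> insert x B"
      and d: "p \<noteq> q" "q \<noteq> t" "p \<noteq> t"
    consider "p \<in> B \<and> q \<in> B \<and> t \<in> B" | "t = x" | "p = x" | "q = x" using pqt by blast
    then show "cyc3 p q t \<in> H"
    proof cases
      case 1 then show ?thesis using B d unfolding full_def by blast
    next
      case 2 then show ?thesis using pqt d by (intro main[of p q, folded 2]) auto
    next
      case 3
      have "cyc3 q t p \<in> H" unfolding 3 by (rule main) (use pqt d 3 in auto)
      then show ?thesis using cyc3_rotate d by metis
    next
      case 4
      have "cyc3 t p q \<in> H" unfolding 4 by (rule main) (use pqt d 4 in auto)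
      then show ?thesis using cyc3_rotate d by metis
    qed
  qed
qed

text \<open>The rule for spreading fullness along an edge: a 3-cycle is conjugated by
  \<open>g\<close> such that two of its points stay in \<open>B\<close> and only the third one may
  leave it.\<close>

lemma full_move:
  assumes B: "finite B" "full B" and g: "g \<in> H"
    and abc: "a \<in> B" "b \<in> B" "c \<in> B" "a \<noteq> b" "b \<noteq> c" "a \<noteq> c"
    and im: "g a \<in> B" "g b \<in> B"
  shows "full (insert (g c) B)"
proof (cases "g c \<in> B")
  case True
  then show ?thesis using B by (simp add: insert_absorb)
next
  case False
  have "cyc3 (g a) (g b) (g c) \<in> H"
    using conj_cyc3[OF bij[OF g], of a b c] B(2) abc comp inv_in g unfolding full_def by metis
  moreover have "g a \<noteq> g b" using bij[OF g] abc by (simp add: bij_is_inj inj_eq)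
  ultimately show ?thesis using full_insert B im False by blast
qed

end

section \<open>The intersection property\<close>

locale string_involutions =
  fixes s :: "nat \<Rightarrow> 'a \<Rightarrow> 'a" and r :: nat
  assumes invol: "k < r \<Longrightarrow> s k \<circ> s k = id"
    and commute: "i + 2 \<le> j \<Longrightarrow> j < r \<Longrightarrow> s i \<circ> s j = s j \<circ> s i"
begin

abbreviation W :: "nat set \<Rightarrow> ('a \<Rightarrow> 'a) set" where "W \<equiv> words s"

lemma fun_group_words:
  assumes "J \<subseteq> {..<r}" shows "fun_group (W J)"
proof
  have "bij g \<and> inv' g \<in> W J" if "g \<in> W J" for g
    using words_inv[OF that] invol assms by blast
  then show "bij g" "inv' g \<in> W J" if "g \<in> W J" for g using that by blast+
qed (use words_id words_comp in blast)+

text \<open>Letters below \<open>k\<close> and letters above \<open>k\<close> have labels at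
  distance at least 2 and commute, so a word without \<open>k\<close> can be sorted.\<close>

lemma words_split:
  assumes "g \<in> W J" "J \<subseteq> {..<r}" "k \<notin> J"
  obtains g1 g2 where "g1 \<in> W (J \<inter> {..<k})" "g2 \<in> W (J \<inter> {k<..})" "g = g1 \<circ> g2"
proof -
  have comm: "s m \<circ> h = h \<circ> s m" if "h \<in> W (J \<inter> {..<k})" "m \<in> J" "k < m" for h m
    using that(1)
  proof induction
    case words_id
    then show ?case by (metis comp_id id_comp)
  next
    case (words_step i h)
    then have "s i \<circ> s m = s m \<circ> s i" using commute[of i m] assms that by auto
    then show ?case using words_step.IH by (metis comp_assoc)
  qed
  have "\<exists>g1 g2. g1 \<in> W (J \<inter> {..<k}) \<and> g2 \<in> W (J \<inter> {k<..}) \<and> g = g1 \<circ> g2"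
    using assms(1)
  proof induction
    case words_id
    then show ?case by (metis comp_id words.words_id)
  next
    case (words_step m g)
    then obtain g1 g2 where g: "g1 \<in> W (J \<inter> {..<k})" "g2 \<in> W (J \<inter> {k<..})" "g = g1 \<circ> g2"
      by blast
    show ?case
    proof (cases "m < k")
      case True
      then have "s m \<circ> g1 \<in> W (J \<inter> {..<k})" using g words_step by (intro words.words_step) auto
      then show ?thesis using g comp_assoc by metis
    next
      case False
      then have "k < m" using words_step assms by (metis linorder_neqE_nat)
      then have "s m \<circ> g2 \<in> W (J \<inter> {k<..})" "s m \<circ> g1 = g1 \<circ> s m"
        using g words_step comm by (auto intro: words.words_step)
      then show ?thesis using g comp_assoc by metis
    qed
  qed
  then show ?thesis using that by blast
qed

end

locale local_string_C = string_involutions +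
  assumes loc: "a < b \<Longrightarrow> b < r \<Longrightarrow> W {a..<b} \<inter> W {Suc a..<Suc b} \<subseteq> W {Suc a..<b}"
begin

text \<open>Induction on the length of the convex hull. If neither interval contains the other, they
  are enlarged to the hull without its last label and the hull without its first label, which is the
  situation of \<open>loc\<close>. The two intersections still to be taken have shorter
  hulls.\<close>

lemma intersect_intervals:
  assumes "b \<le> r" "d \<le> r" "g \<in> W {a..<b}" "g \<in> W {c..<d}"
  shows "g \<in> W ({a..<b} \<inter> {c..<d})"
  using assms
proof (induction "max b d - min a c" arbitrary: a b c d rule: less_induct)
  case less
  have main: "g \<in> W ({a..<b} \<inter> {c..<d})"
    if "a \<le> c" "b \<le> r" "d \<le> r" "g \<in> W {a..<b}" "g \<in> W {c..<d}"
      "max b d - min a c = N"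
      and IH: "\<And>a b c d. max b d - min a c < N \<Longrightarrow> b \<le> r \<Longrightarrow> d \<le> r \<Longrightarrow>
        g \<in> W {a..<b} \<Longrightarrow> g \<in> W {c..<d} \<Longrightarrow> g \<in> W ({a..<b} \<inter> {c..<d})"
    for a b c d N
  proof -
    consider "{c..<d} \<subseteq> {a..<b}" | "{a..<b} \<subseteq> {c..<d}" | "a < c" "b < d" "Suc a < d"
    proof -
      have "d \<le> b \<or> a = c \<and> b \<le> d \<or> a < c \<and> d \<le> Suc a \<or> a < c \<and> b < d \<and> Suc a < d"
        using \<open>a \<le> c\<close> by linarith
      then show ?thesis using that \<open>a \<le> c\<close> by fastforce
    qed
    then show ?thesis
    proof cases
      case 1 then show ?thesis using that by (metis Int_absorb1)
    next
      case 2 then show ?thesis using that by (metis Int_absorb2)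
    next
      case 3
      have "g \<in> W {a..<d - 1}" "g \<in> W {Suc a..<Suc (d - 1)}"
        by (rule words_mono[OF that(4)], use 3 in force, rule words_mono[OF that(5)], use 3 in force)
      moreover have "a < d - 1" "d - 1 < r" using 3 \<open>d \<le> r\<close> by linarith+
      ultimately have "g \<in> W {Suc a..<d - 1}" using loc[of a "d - 1"] by blast
      then have "g \<in> W ({a..<b} \<inter> {Suc a..<d - 1})"
        using IH[of b "d - 1" a "Suc a"] 3 that by auto
      moreover have "{a..<b} \<inter> {Suc a..<d - 1} = {Suc a..<b}" using 3 by auto
      ultimately have "g \<in> W ({Suc a..<b} \<inter> {c..<d})"
        using IH[of b d "Suc a" c] 3 that by auto
      moreover have "{Suc a..<b} \<inter> {c..<d} = {a..<b} \<inter> {c..<d}" using 3 by auto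
      ultimately show ?thesis by simp
    qed
  qed
  show ?case
  proof (cases "a \<le> c")
    case True
    then show ?thesis using main[of a c b d] less by blast
  next
    case False
    then have "g \<in> W ({c..<d} \<inter> {a..<b})"
      using main[of c a d b] less by (metis max.commute min.commute nle_le)
    then show ?thesis by (simp add: Int_commute)
  qed
qed

text \<open>Choose \<open>k \<notin> J\<close> and \<open>l \<notin> K\<close> at minimal distance, so that everything strictly between them lies in
  \<open>J \<inter> K\<close>; splitting an element at \<open>k\<close> and at \<open>l\<close> then shortens the interval.\<close>

lemma intersect_words_aux:
  assumes "J \<subseteq> {a..<b}" "K \<subseteq> {a..<b}" "b \<le> r" "g \<in> W J" "g \<in> W K"
  shows "g \<in> W (J \<inter> K)"
  using assms
proof (induction "b - a" arbitrary: a b J K g rule: less_induct)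
  case less
  show ?case
  proof (cases "J = {a..<b} \<or> K = {a..<b}")
    case True
    then show ?thesis using less by (metis inf.absorb_iff2 inf_commute)
  next
    case False
    define P where "P = (\<lambda>d. \<exists>k l. k \<in> {a..<b} - J \<and> l \<in> {a..<b} - K \<and> (k - l) + (l - k) = d)"
    have "\<exists>k. k \<in> {a..<b} - J" "\<exists>k. k \<in> {a..<b} - K" using False less by blast+
    then have "\<exists>d. P d" unfolding P_def by blast
    then have "P (LEAST d. P d)" by (metis LeastI)
    then obtain k0 l0 where kl0: "k0 \<in> {a..<b} - J" "l0 \<in> {a..<b} - K"
      "(k0 - l0) + (l0 - k0) = (LEAST d. P d)" unfolding P_def by blast
    have min0: "(k0 - l0) + (l0 - k0) \<le> (k - l) + (l - k)"
      if "k \<in> {a..<b} - J" "l \<in> {a..<b} - K" for k l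
      unfolding kl0(3) by (rule Least_le) (use that P_def in blast)
    have main: "g \<in> W (J \<inter> K)"
      if JK: "J \<subseteq> {a..<b}" "K \<subseteq> {a..<b}" "g \<in> W J" "g \<in> W K" and kl: "k \<le> l"
        "k \<in> {a..<b} - J" "l \<in> {a..<b} - K"
        and min: "\<And>k' l'. k' \<in> {a..<b} - J \<Longrightarrow> l' \<in> {a..<b} - K
          \<Longrightarrow> l - k \<le> (k' - l') + (l' - k')" for J K k l
    proof -
      have J: "J \<subseteq> {..<r}" "k \<notin> J" and K: "K \<subseteq> {..<r}" "l \<notin> K" using less JK kl by force+
      obtain g1 g2 where g: "g1 \<in> W (J \<inter> {..<k})" "g2 \<in> W (J \<inter> {k<..})" "g = g1 \<circ> g2"
        using words_split[OF JK(3) J] by blast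
      obtain h1 h2 where h: "h1 \<in> W (K \<inter> {..<l})" "h2 \<in> W (K \<inter> {l<..})" "g = h1 \<circ> h2"
        using words_split[OF JK(4) K] by blast
      have mid: "x \<in> J" "x \<in> K" if "k < x" "x < l" for x
      proof -
        have x: "x \<in> {a..<b}" using that kl by auto
        show "x \<in> J"
        proof (rule ccontr)
          assume "x \<notin> J"
          then show False using min[of x l] kl that x by auto
        qed
        show "x \<in> K"
        proof (rule ccontr)
          assume "x \<notin> K"
          then show False using min[of k x] kl that x by auto
        qed
      qed
      interpret L: fun_group "W {a..<l}" by (rule fun_group_words) (use less kl in auto)
      interpret U: fun_group "W {Suc k..<b}" by (rule fun_group_words) (use less kl in auto)
      interpret V: fun_group "W (K \<inter> {..<l})" by (rule fun_group_words) (use less K in auto)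
      interpret WJK: fun_group "W (J \<inter> K)" by (rule fun_group_words) (use less K in auto)
      have g1L: "g1 \<in> W {a..<l}" by (rule words_mono[OF g(1)]) (use JK kl in auto)
      have h1L: "h1 \<in> W {a..<l}" by (rule words_mono[OF h(1)]) (use JK kl in auto)
      have g2U: "g2 \<in> W {Suc k..<b}" by (rule words_mono[OF g(2)]) (use JK kl in force)
      have h2U: "h2 \<in> W {Suc k..<b}" by (rule words_mono[OF h(2)]) (use JK kl in force)
      \<comment> \<open>The discrepancy of the two splittings. It equals both
        \<open>inv' h1 \<circ> g1\<close> and \<open>h2 \<circ> inv' g2\<close>, so it uses only
        labels below \<open>l\<close> and also only labels above \<open>k\<close>; by minimality the
        labels in between belong to both index sets.\<close>
      define m where "m = inv' h1 \<circ> g1"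
      have m1: "m \<in> W {a..<l}" unfolding m_def using L.comp L.inv_in g1L h1L by blast
      have g1m: "g1 = h1 \<circ> m" unfolding m_def
        using L.bij[OF h1L] by (metis bij_is_surj comp_assoc id_comp surj_iff)
      have "h2 = m \<circ> g2"
        unfolding m_def using g(3) h(3) L.bij[OF h1L] by (metis bij_is_inj comp_assoc id_comp inj_iff)
      then have mh: "m = h2 \<circ> inv' g2"
        using U.bij[OF g2U] by (metis bij_is_surj comp_assoc comp_id surj_iff)
      then have m2: "m \<in> W {Suc k..<b}" using U.comp U.inv_in g2U h2U by blast
      have "m \<in> W ({a..<l} \<inter> {Suc k..<b})"
        by (rule intersect_intervals[OF _ _ m1 m2]) (use less kl in auto)
      then have m3: "m \<in> W (J \<inter> K \<inter> {k<..<l})"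
        by (rule words_mono) (use mid in auto)
      \<comment> \<open>Since \<open>m\<close> can be absorbed, each factor of \<open>g\<close> is a
        word over \<open>J\<close> and also over \<open>K\<close>, within an interval that ends
        before \<open>l\<close> or starts after \<open>k\<close>. The induction hypothesis applies
        to both factors.\<close>
      have "g1 \<in> W (K \<inter> {..<l})"
        unfolding g1m by (rule V.comp[OF h(1) words_mono[OF m3]]) auto
      with g(1) have "g1 \<in> W ((J \<inter> {..<k}) \<inter> (K \<inter> {..<l}))"
        by (rule less.hyps[of l a, rotated 4]) (use less.prems JK kl in force)+
      then have g1: "g1 \<in> W (J \<inter> K)" by (rule words_mono) auto
      interpret X: fun_group "W (K \<inter> {k<..})" by (rule fun_group_words) (use less K in auto)
      have "m \<in> W (K \<inter> {k<..})" "h2 \<in> W (K \<inter> {k<..})"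
        by (rule words_mono[OF m3], force, rule words_mono[OF h(2)], use kl in force)
      then have "g2 \<in> W (K \<inter> {k<..})" using X.comp_inv_left \<open>h2 = m \<circ> g2\<close> by blast
      with g(2) have "g2 \<in> W ((J \<inter> {k<..}) \<inter> (K \<inter> {k<..}))"
        by (rule less.hyps[of b "Suc k", rotated 4]) (use less.prems JK kl in force)+
      then have g2: "g2 \<in> W (J \<inter> K)" by (rule words_mono) auto
      show ?thesis using WJK.comp g1 g2 g(3) by blast
    qed
    show ?thesis
    proof (cases "k0 \<le> l0")
      case True
      then have "l0 - k0 \<le> (k' - l') + (l' - k')"
        if "k' \<in> {a..<b} - J" "l' \<in> {a..<b} - K" for k' l' using min0[OF that] by simp
      then show ?thesis using main[of J K k0 l0] less True kl0 by blast
    next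
      case False
      then have "k0 - l0 \<le> (k' - l') + (l' - k')"
        if "k' \<in> {a..<b} - K" "l' \<in> {a..<b} - J" for k' l' using min0[OF that(2,1)] by simp
      then have "g \<in> W (K \<inter> J)" using main[of K J l0 k0] less False kl0 by (metis nle_le)
      then show ?thesis by (simp add: Int_commute)
    qed
  qed
qed

lemma intersect_words:
  assumes "J \<subseteq> {..<r}" "K \<subseteq> {..<r}"
  shows "W J \<inter> W K = W (J \<inter> K)"
proof
  show "W J \<inter> W K \<subseteq> W (J \<inter> K)"
    using intersect_words_aux[of J 0 r K] assms by (auto simp: lessThan_atLeast0)
  show "W (J \<inter> K) \<subseteq> W J \<inter> W K" using words_mono by blast
qed

end

section \<open>The labelled graph\<close>

text \<open>A closed form of the generators, with points outside the graph fixed, so that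
  computations never meet the definite description in \<open>label_perm\<close>.\<close>

fun step :: "nat \<Rightarrow> nat \<Rightarrow> nat \<Rightarrow> vtx \<Rightarrow> vtx" where
  "step L r k (P m) =
     (if k = 0 \<and> m = 1 then P 2 else if k = 0 \<and> m = 2 then P 1
      else if k = 1 \<and> m = 2 then P 3 else if k = 1 \<and> m = 3 then P 2
      else if (k = 0 \<or> k = 2) \<and> m = 3 then Q 0 else P m)"
| "step L r k (Q m) =
     (if m = 0 \<and> (k = 0 \<or> k = 2) then P 3
      else if k = 1 then (if even m \<and> m < L then Q (m + 1) else if odd m \<and> m \<le> L then Q (m - 1) else Q m)
      else if k = 0 then (if odd m \<and> m < L then Q (m + 1) else if even m \<and> m \<le> L then Q (m - 1) else Q m)
      else if k = 2 \<and> m = L then Y 3 else Q m)"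
| "step L r k (Y m) =
     (if k = m \<and> 3 \<le> m \<and> m < r then Y (m + 1)
      else if k + 1 = m \<and> 3 \<le> m \<and> m \<le> r then (if m = 3 then Q L else Y (m - 1))
      else if k = r - 3 \<and> (m = r - 1 \<or> m = r) then Z m else Y m)"
| "step L r k (Z m) =
     (if k = m \<and> 3 \<le> m \<and> m < r then Z (m + 1)
      else if k + 1 = m \<and> 4 \<le> m \<and> m \<le> r then Z (m - 1)
      else if k = r - 3 \<and> (m = r - 1 \<or> m = r) then Y m else Z m)"

text \<open>Every edge is given one orientation, which turns membership of an unordered pair in
  \<open>thm48_E\<close> into a case distinction on constructors.\<close>

fun dir_edge :: "nat \<Rightarrow> nat \<Rightarrow> nat \<Rightarrow> vtx \<Rightarrow> vtx \<Rightarrow> bool" where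
  "dir_edge L r k (P a) (P b) \<longleftrightarrow> a = 1 \<and> b = 2 \<and> k = 0 \<or> a = 2 \<and> b = 3 \<and> k = 1"
| "dir_edge L r k (P a) (Q b) \<longleftrightarrow> a = 3 \<and> b = 0 \<and> (k = 0 \<or> k = 2)"
| "dir_edge L r k (Q a) (Q b) \<longleftrightarrow> b = a + 1 \<and> b \<le> L \<and> k = (if odd b then 1 else 0)"
| "dir_edge L r k (Q a) (Y b) \<longleftrightarrow> a = L \<and> b = 3 \<and> k = 2"
| "dir_edge L r k (Y a) (Y b) \<longleftrightarrow> b = a + 1 \<and> k = a \<and> 3 \<le> a \<and> b \<le> r"
| "dir_edge L r k (Z a) (Z b) \<longleftrightarrow> b = a + 1 \<and> k = a \<and> 3 \<le> a \<and> b \<le> r"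
| "dir_edge L r k (Y a) (Z b) \<longleftrightarrow> b = a \<and> k = r - 3 \<and> (a = r - 1 \<or> a = r)"
| "dir_edge L r k _ _ \<longleftrightarrow> False"

locale graph48 =
  fixes n r :: nat
  assumes n_mod: "n mod 4 = 3" and r_odd: "odd r" and r_ge: "7 \<le> r" and n_gt: "2 * r + 1 < n"
begin

definition "L = thm48_L n r"

abbreviation rho :: "nat \<Rightarrow> vtx \<Rightarrow> vtx" where "rho \<equiv> thm48_rho n r"
abbreviation V :: "vtx set" where "V \<equiv> thm48_V n r"

text \<open>Twice an odd number is 2 modulo 4, so n - 2r is 1 modulo 4; the strict bound on
  \<open>r\<close> excludes the value 1 itself.\<close>

lemma L_mod: "L mod 4 = 1" "5 \<le> L" "odd L"
  and L_n: "L + 2 * r = n"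
proof -
  have L: "L = n - 2 * r" by (simp add: L_def thm48_L_def)
  show "L + 2 * r = n" using L n_gt by simp
  obtain j where j: "r = 2 * j + 1" using r_odd by (rule oddE)
  have "n = 4 * (n div 4) + 3" using n_mod by (metis mult_div_mod_eq)
  moreover from this have "j < n div 4" using n_gt j by linarith
  ultimately have "L = 4 * (n div 4 - j) + 1" "1 \<le> n div 4 - j" using L j by linarith+
  then obtain q where "L = 4 * q + 1" "1 \<le> q" by blast
  then show "L mod 4 = 1" "5 \<le> L" "odd L" by simp_all
qed

lemma L_eq: "thm48_L n r = L"
  by (simp only: L_def)

lemma edge_iff:
  "({x, y}, k) \<in> thm48_E n r \<longleftrightarrow> dir_edge L r k x y \<or> dir_edge L r k y x"
proof -
  have E: "({x, y}, k) \<in> thm48_E n r \<longleftrightarrow>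
     (\<exists>a b. {x, y} = {a, b} \<and> dir_edge L r k a b)"
  proof
    have c: "dir_edge L r 0 (P 1) (P 2)" "dir_edge L r 1 (P 2) (P 3)"
      "dir_edge L r 0 (P 3) (Q 0)" "dir_edge L r 2 (P 3) (Q 0)" "dir_edge L r (r - 3) (Y r) (Z r)"
      "dir_edge L r (r - 3) (yv n r (r - 1)) (Z (r - 1))"
      using r_ge by (auto simp: yv_def L_eq)
    have q: "dir_edge L r (if odd s then 1 else 0) (Q (s - 1)) (Q s)" if "1 \<le> s" "s \<le> L" for s
      using that by simp
    have y: "dir_edge L r k (yv n r k) (yv n r (k + 1))" if "2 \<le> k" "k \<le> r - 1" for k
      using that r_ge by (auto simp: yv_def L_eq)
    have z: "dir_edge L r k (Z k) (Z (k + 1))" if "3 \<le> k" "k \<le> r - 1" for k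
      using that r_ge by auto
    assume "({x, y}, k) \<in> thm48_E n r"
    then show "\<exists>a b. {x, y} = {a, b} \<and> dir_edge L r k a b"
      unfolding thm48_E_def Un_iff insert_iff mem_Collect_eq empty_iff prod.inject L_eq
      by (elim disjE exE conjE FalseE) (metis c q y z)+
  next
    assume "\<exists>a b. {x, y} = {a, b} \<and> dir_edge L r k a b"
    then obtain a b where ab: "{x, y} = {a, b}" "dir_edge L r k a b" by blast
    have q: "({Q i, Q (i + 1)}, if odd (i + 1) then 1 else 0) \<in> thm48_E n r" if "i + 1 \<le> L" for i
    proof -
      have "({Q i, Q (i + 1)}, if odd (i + 1) then 1 else 0)
          \<in> {({Q (s - 1), Q s}, if odd s then 1 else 0) | s. 1 \<le> s \<and> s \<le> L}"
        using that by (intro CollectI exI[of _ "i + 1"]) simp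
      then show ?thesis unfolding thm48_E_def L_eq by (rule UnI1[OF UnI1[OF UnI1[OF UnI2]]])
    qed
    have y: "({yv n r i, yv n r (i + 1)}, i) \<in> thm48_E n r" if "2 \<le> i" "i \<le> r - 1" for i
    proof -
      have "({yv n r i, yv n r (i + 1)}, i) \<in> {({yv n r k, yv n r (k + 1)}, k) | k. 2 \<le> k \<and> k \<le> r - 1}"
        using that by (intro CollectI exI[of _ i]) simp
      then show ?thesis unfolding thm48_E_def by (rule UnI1[OF UnI1[OF UnI2]])
    qed
    have z: "({Z i, Z (i + 1)}, i) \<in> thm48_E n r" if "3 \<le> i" "i \<le> r - 1" for i
    proof -
      have "({Z i, Z (i + 1)}, i) \<in> {({Z k, Z (k + 1)}, k) | k. 3 \<le> k \<and> k \<le> r - 1}"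
        using that by (intro CollectI exI[of _ i]) simp
      then show ?thesis unfolding thm48_E_def by (rule UnI1[OF UnI2])
    qed
    have c: "({P 1, P 2}, 0) \<in> thm48_E n r" "({P 2, P 3}, 1) \<in> thm48_E n r"
      "({P 3, Q 0}, 0) \<in> thm48_E n r" "({P 3, Q 0}, 2) \<in> thm48_E n r"
      "({yv n r (r - 1), Z (r - 1)}, r - 3) \<in> thm48_E n r" "({Y r, Z r}, r - 3) \<in> thm48_E n r"
      unfolding thm48_E_def by (simp_all only: Un_iff insert_iff simp_thms)
    have yv: "yv n r 2 = Q L" "\<And>k. k \<ge> 3 \<Longrightarrow> yv n r k = Y k" by (auto simp: yv_def L_eq)
    have "({a, b}, k) \<in> thm48_E n r"
    proof (cases a; cases b)
      fix i j assume e: "a = Y i" "b = Y j"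
      then have "j = i + 1" "k = i" "3 \<le> i" "i \<le> r - 1" using ab(2) by auto
      then show ?thesis using y[of i] e yv by simp
    next
      fix i j assume e: "a = Q i" "b = Q j"
      then have "j = i + 1" "k = (if odd (i + 1) then 1 else 0)" "i + 1 \<le> L" using ab(2) by auto
      then show ?thesis using q[of i] e by simp
    next
      fix i j assume e: "a = Q i" "b = Y j"
      then have "i = L" "j = 3" "k = 2" using ab(2) by auto
      then show ?thesis using y[of 2] e yv r_ge by simp
    next
      fix i j assume e: "a = Z i" "b = Z j"
      then have "j = i + 1" "k = i" "3 \<le> i" "i \<le> r - 1" using ab(2) by auto
      then show ?thesis using z[of i] e by simp
    next
      fix i j assume e: "a = Y i" "b = Z j"
      then have "j = i" "k = r - 3" "i = r - 1 \<or> i = r" using ab(2) by auto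
      then show ?thesis using c(5,6) e yv(2)[of "r - 1"] r_ge by auto
    next
      fix i j assume e: "a = P i" "b = P j"
      then have "i = 1 \<and> j = 2 \<and> k = 0 \<or> i = 2 \<and> j = 3 \<and> k = 1" using ab(2) by auto
      then show ?thesis using c(1,2) e by metis
    next
      fix i j assume e: "a = P i" "b = Q j"
      then have "i = 3" "j = 0" "k = 0 \<or> k = 2" using ab(2) by auto
      then show ?thesis using c(3,4) e by metis
    qed (use ab(2) in \<open>simp_all only: dir_edge.simps\<close>)
    then show "({x, y}, k) \<in> thm48_E n r" using ab by simp
  qed
  show ?thesis unfolding E by (auto simp: doubleton_eq_iff)
qed

end

lemma dir_edge_YY: "dir_edge L (q+7) k (Y a) (Y b) \<or> dir_edge L (q+7) k (Y b) (Y a) \<longleftrightarrow> step L (q+7) k (Y a) = Y b \<and> b \<noteq> a"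
proof -
  consider "b = a + 1" | "a = b + 1" | "b \<noteq> a + 1" "a \<noteq> b + 1" by blast
  then show ?thesis by cases auto
qed
lemma dir_edge_ZZ: "dir_edge L (q+7) k (Z a) (Z b) \<or> dir_edge L (q+7) k (Z b) (Z a) \<longleftrightarrow> step L (q+7) k (Z a) = Z b \<and> b \<noteq> a"
proof -
  consider "b = a + 1" | "a = b + 1" | "b \<noteq> a + 1" "a \<noteq> b + 1" by blast
  then show ?thesis by cases auto
qed
lemma dir_edge_QQ: "odd L \<Longrightarrow> dir_edge L r k (Q a) (Q b) \<or> dir_edge L r k (Q b) (Q a) \<longleftrightarrow> step L r k (Q a) = Q b \<and> b \<noteq> a"
proof -
  assume "odd L"
  consider "b = a + 1" | "a = b + 1" | "b \<noteq> a + 1" "a \<noteq> b + 1" by blast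
  then show ?thesis using \<open>odd L\<close>
  proof cases
    case 1
    then show ?thesis by (cases "k = 0"; cases "k = 1") auto
  next
    case 2
    then show ?thesis by (cases "k = 0"; cases "k = 1") auto
  next
    case 3
    then show ?thesis by (cases "k = 0"; cases "k = 1") auto
  qed
qed

text \<open>As \<open>step\<close> is a function, this also yields that a vertex has at most one
  neighbour along each label, which resolves the \<open>THE\<close> in \<open>label_perm\<close>.
  Writing \<open>r\<close> as \<open>q + 7\<close> removes truncated subtraction from the labels
  near the top.\<close>

lemma dir_edge_step:
  assumes "odd L"
  shows "dir_edge L (q + 7) k x y \<or> dir_edge L (q + 7) k y x \<longleftrightarrow> step L (q + 7) k x = y \<and> y \<noteq> x"
proof -
  have L: "odd L" "1 \<le> L" using assms by (auto intro: Suc_leI odd_pos)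
  have PP: "dir_edge L r k (P a) (P b) \<or> dir_edge L r k (P b) (P a) \<longleftrightarrow> step L r k (P a) = P b \<and> b \<noteq> a" for a b r
    by auto
  have PQ: "dir_edge L r k (P a) (Q b) \<longleftrightarrow> step L r k (P a) = Q b" for a b r
    by auto
  have QP: "dir_edge L r k (P b) (Q a) \<longleftrightarrow> step L r k (Q a) = P b" for a b r
    by auto
  have QY: "dir_edge L r k (Q a) (Y b) \<longleftrightarrow> step L r k (Q a) = Y b" for a b r
    using L by (cases "k = 0"; cases "k = 1") auto
  have YQ: "dir_edge L (q + 7) k (Q b) (Y a) \<longleftrightarrow> step L (q + 7) k (Y a) = Q b" for a b
    by auto
  have YZ: "dir_edge L (q + 7) k (Y a) (Z b) \<longleftrightarrow> step L (q + 7) k (Y a) = Z b" for a b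
    by auto
  have ZY: "dir_edge L (q + 7) k (Y b) (Z a) \<longleftrightarrow> step L (q + 7) k (Z a) = Y b" for a b
    by auto
  note YY = dir_edge_YY[of L q k] and ZZ = dir_edge_ZZ[of L q k] and QQ = dir_edge_QQ[OF L(1), of "q + 7" k]
  show ?thesis
  proof (cases x; cases y)
    fix a b assume [simp]: "x = P a" "y = P b" show ?thesis using PP[of _ a b] by simp
  next
    fix a b assume "x = P a" "y = Q b" then show ?thesis using PQ[of _ a b] by auto
  next
    fix a b assume "x = Q a" "y = P b" then show ?thesis using QP[of _ b a] by auto
  next
    fix a b assume "x = Q a" "y = Y b" then show ?thesis using QY[of _ a b] by auto
  next
    fix a b assume "x = Y a" "y = Q b" then show ?thesis using YQ[of b a] by auto
  next
    fix a b assume "x = Y a" "y = Z b" then show ?thesis using YZ[of a b] by auto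
  next
    fix a b assume "x = Z a" "y = Y b" then show ?thesis using ZY[of b a] by auto
  next
    fix a b assume "x = Y a" "y = Y b" then show ?thesis using YY[of a b] by simp
  next
    fix a b assume "x = Z a" "y = Z b" then show ?thesis using ZZ[of a b] by simp
  next
    fix a b assume "x = Q a" "y = Q b" then show ?thesis using QQ[of a b] by simp
  qed simp_all
qed

context graph48 begin

lemma rho_step: "rho k x = step L r k x"
proof -
  obtain q where q: "r = q + 7" using r_ge by (metis add.commute le_Suc_ex)
  have "({x, y}, k) \<in> thm48_E n r \<and> y \<noteq> x \<longleftrightarrow> step L r k x = y \<and> y \<noteq> x" for y
    unfolding edge_iff using dir_edge_step[OF L_mod(3), of q k x y, folded q] by blast
  then show ?thesis unfolding thm48_rho_def label_perm_def by auto
qed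

end

text \<open>Here \<open>r = q + 7\<close> and \<open>L = 2 * t - 1\<close>. The sequence \<open>u\<close> runs along the path
  \<open>p\<^sub>1, p\<^sub>2, p\<^sub>3, q\<^sub>0, \<dots>, q\<^sub>L\<close>, whose last two points are also called \<open>y\<^sub>1\<close> and \<open>y\<^sub>2\<close>.\<close>

locale action48 =
  fixes q t :: nat and u y z :: "nat \<Rightarrow> 'a" and rho :: "nat \<Rightarrow> 'a \<Rightarrow> 'a" and V :: "'a set"
  assumes t_odd: "odd t" and t_ge: "3 \<le> t"
    and y1: "y 1 = u (2 * t + 1)" and y2: "y 2 = u (2 * t + 2)"
    and inj_u: "inj_on u {..<2 * t + 3}" and inj_y: "inj_on y {1..q + 7}" and inj_z: "inj_on z {3..q + 7}"
    and u_y: "m \<le> 2 * t \<Longrightarrow> 1 \<le> k \<Longrightarrow> k \<le> q + 7 \<Longrightarrow> u m \<noteq> y k"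
    and u_z: "m < 2 * t + 3 \<Longrightarrow> 3 \<le> k \<Longrightarrow> k \<le> q + 7 \<Longrightarrow> u m \<noteq> z k"
    and y_z: "1 \<le> m \<Longrightarrow> m \<le> q + 7 \<Longrightarrow> 3 \<le> k \<Longrightarrow> k \<le> q + 7 \<Longrightarrow> y m \<noteq> z k"
    and V_eq: "V = u ` {..2 * t} \<union> y ` {1..q + 7} \<union> z ` {3..q + 7}"
    and rho_out: "x \<notin> V \<Longrightarrow> rho k x = x"
    and rho0_u: "m < 2 * t + 3 \<Longrightarrow>
      rho 0 (u m) = (if odd m then u (m - 1) else if m = 2 * t + 2 then u m else u (m + 1))"
    and rho1_u: "m < 2 * t + 3 \<Longrightarrow> rho 1 (u m) = (if odd m then u (m + 1) else u (m - 1))"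
    and rho2_u: "m \<le> 2 * t \<Longrightarrow> rho 2 (u m) = (if m = 2 then u 3 else if m = 3 then u 2 else u m)"
    and rho_u: "3 \<le> k \<Longrightarrow> m \<le> 2 * t \<Longrightarrow> rho k (u m) = u m"
    and rho0_y: "3 \<le> m \<Longrightarrow> m \<le> q + 7 \<Longrightarrow> rho 0 (y m) = y m"
    and rho_y: "1 \<le> k \<Longrightarrow> k < q + 7 \<Longrightarrow> 1 \<le> m \<Longrightarrow> m \<le> q + 7 \<Longrightarrow> rho k (y m) =
      (if k = m then y (m + 1) else if k + 1 = m then y k
       else if k = q + 4 \<and> q + 6 \<le> m then z m else y m)"
    and rho_z: "k < q + 7 \<Longrightarrow> 3 \<le> m \<Longrightarrow> m \<le> q + 7 \<Longrightarrow> rho k (z m) =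
      (if k = m then z (m + 1) else if k + 1 = m \<and> 4 \<le> m then z k
       else if k = q + 4 \<and> q + 6 \<le> m then y m else z m)"

text \<open>The offset 3 places q_0 at index 3 and, since L = 2t - 1, places q_L at index 2t +
  2.\<close>

definition left_pt :: "nat \<Rightarrow> vtx" where
  "left_pt m = (if m < 3 then P (m + 1) else Q (m - 3))"

text \<open>The path is prolonged backwards by q_(L-1) and q_L as points 1 and 2. With this
  numbering label \<open>k\<close> joins the points \<open>k\<close> and \<open>k + 1\<close>
  already for \<open>k = 1\<close>, because \<open>L\<close> is odd.\<close>

definition right_pt :: "nat \<Rightarrow> nat \<Rightarrow> vtx" where
  "right_pt L m = (if m \<le> 2 then Q (L + m - 2) else Y m)"

lemma action48_step:
  assumes t: "odd t" "3 \<le> t" and L: "L = 2 * t - 1"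
    and V: "V = {P 1, P 2, P 3} \<union> Q ` {0..L} \<union> Y ` {3..q + 7} \<union> Z ` {3..q + 7}"
  shows "action48 q t left_pt (right_pt L) Z (step L (q + 7)) V"
proof
  obtain s where s: "t = s + 3" using t(2) by (metis add.commute le_Suc_ex)
  have L': "L = 2 * s + 5" using L s by simp
  show "odd t" "3 \<le> t" by fact+
  show "right_pt L 1 = left_pt (2 * t + 1)" "right_pt L 2 = left_pt (2 * t + 2)"
    unfolding L' s by (auto simp: left_pt_def right_pt_def)
  show "inj_on left_pt {..<2 * t + 3}" by (auto simp: inj_on_def left_pt_def)
  show "inj_on (right_pt L) {1..q + 7}" "inj_on Z {3..q + 7}" unfolding L' by (auto simp: inj_on_def right_pt_def)
  show "left_pt m \<noteq> right_pt L k" if "m \<le> 2 * t" "1 \<le> k" for m k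
    using that unfolding L' s by (auto simp: left_pt_def right_pt_def)
  show "left_pt m \<noteq> Z k" "right_pt L m \<noteq> Z k" for m k by (auto simp: left_pt_def right_pt_def)
  have "{P 1, P 2, P 3} = left_pt ` {0, 1, 2}" by (auto simp: left_pt_def numeral_eq_Suc)
  moreover have "Q ` {0..L} = left_pt ` {3..2 * t} \<union> right_pt L ` {1, 2}"
  proof -
    have "Q ` {0..2 * s + 3} = left_pt ` {3..2 * t}"
    proof -
      have "left_pt ` {3..2 * t} = left_pt ` (\<lambda>m. m + 3) ` {0..2 * s + 3}"
        unfolding s by (simp add: image_add_atLeastAtMost' add.commute)
      also have "\<dots> = Q ` {0..2 * s + 3}"
        unfolding image_image by (rule image_cong) (auto simp: left_pt_def)
      finally show ?thesis ..
    qed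
    moreover have "Q ` {2 * s + 4, 2 * s + 5} = right_pt L ` {1, 2}" unfolding L' by (auto simp: right_pt_def)
    moreover have "{0..L} = {0..2 * s + 3} \<union> {2 * s + 4, 2 * s + 5}" unfolding L' by auto
    ultimately show ?thesis by (metis image_Un)
  qed
  moreover have "Y ` {3..q + 7} = right_pt L ` {3..q + 7}" by (rule image_cong) (auto simp: right_pt_def)
  moreover have "{0, 1, 2} \<union> {3..2 * t} = {..2 * t}" unfolding s by auto
  moreover have "{1, 2} \<union> {3..q + 7} = {1..q + 7}" by auto
  ultimately show "V = left_pt ` {..2 * t} \<union> right_pt L ` {1..q + 7} \<union> Z ` {3..q + 7}"
    unfolding V by (metis Un_assoc image_Un)
  show "step L (q + 7) k x = x" if "x \<notin> V" for x k
  proof (cases x)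
    case (P m)
    then have "m \<noteq> 1 \<and> m \<noteq> 2 \<and> m \<noteq> 3" using that unfolding V by auto
    then show ?thesis using P by simp
  next
    case (Q m)
    then have "L < m" using that unfolding V by force
    then show ?thesis using Q by auto
  next
    case (Y m)
    then have "\<not> (3 \<le> m \<and> m \<le> q + 7)" using that unfolding V by force
    then show ?thesis using Y by auto
  next
    case (Z m)
    then have "\<not> (3 \<le> m \<and> m \<le> q + 7)" using that unfolding V by force
    then show ?thesis using Z by auto
  qed
  have cs: "m = 0 \<or> m = 1 \<or> m = 2 \<or> (\<exists>j. m = j + 3)" for m :: nat by presburger
  have par: "j < 2 * s + 5" if "even j" "j < 6 + 2 * s" for j
  proof -
    have "j \<noteq> 2 * s + 5" using that(1) by auto
    then show ?thesis using that(2) by linarith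
  qed
  fix m k
  show "step L (q + 7) 0 (left_pt m) =
      (if odd m then left_pt (m - 1) else if m = 2 * t + 2 then left_pt m else left_pt (m + 1))"
    if "m < 2 * t + 3"
    using cs[of m] that unfolding L' s by (elim disjE exE) (auto simp: left_pt_def par)
  show "step L (q + 7) 1 (left_pt m) = (if odd m then left_pt (m + 1) else left_pt (m - 1))" if "m < 2 * t + 3"
    using cs[of m] that unfolding L' s by (elim disjE exE) (auto simp: left_pt_def par)
  show "step L (q + 7) 2 (left_pt m) = (if m = 2 then left_pt 3 else if m = 3 then left_pt 2 else left_pt m)"
    if "m \<le> 2 * t"
    using cs[of m] that unfolding L' s by (elim disjE exE) (auto simp: left_pt_def)
  show "step L (q + 7) k (left_pt m) = left_pt m" if "3 \<le> k" "m \<le> 2 * t"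
    using cs[of m] that unfolding L' s by (elim disjE exE) (auto simp: left_pt_def)
  show "step L (q + 7) 0 (right_pt L m) = right_pt L m" if "3 \<le> m" "m \<le> q + 7"
    using that by (auto simp: right_pt_def)
  show "step L (q + 7) k (right_pt L m) =
      (if k = m then right_pt L (m + 1) else if k + 1 = m then right_pt L k
       else if k = q + 4 \<and> q + 6 \<le> m then Z m else right_pt L m)"
    if "1 \<le> k" "k < q + 7" "1 \<le> m" "m \<le> q + 7"
  proof -
    consider "m = 1" | "m = 2" | j where "m = j + 3" using cs[of m] \<open>1 \<le> m\<close> by auto
    then show ?thesis
    proof cases
      case 1
      then show ?thesis using that unfolding L' by (auto simp: right_pt_def)
    next
      case 2
      then show ?thesis using that unfolding L' by (auto simp: right_pt_def)
    next
      case 3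
      then show ?thesis using that unfolding L' by (auto simp: right_pt_def)
    qed
  qed
  show "step L (q + 7) k (Z m) =
      (if k = m then Z (m + 1) else if k + 1 = m \<and> 4 \<le> m then Z k
       else if k = q + 4 \<and> q + 6 \<le> m then right_pt L m else Z m)"
    if "k < q + 7" "3 \<le> m" "m \<le> q + 7"
    using that by (auto simp: right_pt_def)
qed

context graph48 begin

lemma action48_rho:
  obtains q t where "r = q + 7" "n = 2 * t + 2 * q + 13" "action48 q t left_pt (right_pt L) Z rho V"
proof -
  obtain q where q: "r = q + 7" using r_ge by (metis add.commute le_Suc_ex)
  obtain s where s: "L = 4 * s + 1" using L_mod(1) by (metis mult_div_mod_eq)
  have V: "V = {P 1, P 2, P 3} \<union> Q ` {0..L} \<union> Y ` {3..q + 7} \<union> Z ` {3..q + 7}"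
    unfolding thm48_V_def L_eq q[symmetric] ..
  \<comment> \<open>L = 2t - 1 and L = 4s + 1 give t = 2s + 1: this is how the residue of
    \<open>L\<close> becomes the oddness of \<open>t\<close>.\<close>
  have "s \<ge> 1" using s L_mod(2) by linarith
  then have "action48 q (2 * s + 1) left_pt (right_pt L) Z (step L (q + 7)) V"
    by (intro action48_step V) (use s in simp_all)
  moreover have "rho = step L (q + 7)" unfolding q[symmetric] by (intro ext rho_step)
  moreover have "n = 2 * (2 * s + 1) + 2 * q + 13"
  proof -
    have "n = (4 * s + 1) + 2 * (q + 7)" using L_n s q by metis
    then show ?thesis by presburger
  qed
  ultimately show ?thesis using that q by metis
qed

end

text \<open>Composing with the swap of the last matched pair leaves a matching with one pair fewer,
  so the parity alternates with the number of pairs.\<close>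

lemma evenperm_matching:
  fixes f :: "nat \<Rightarrow> 'a"
  assumes "inj_on f {..<2 * m}"
    and "\<And>i. i < m \<Longrightarrow> g (f (2 * i)) = f (2 * i + 1)"
    and "\<And>i. i < m \<Longrightarrow> g (f (2 * i + 1)) = f (2 * i)"
    and "\<And>x. x \<notin> f ` {..<2 * m} \<Longrightarrow> g x = x"
  shows "permutation g \<and> (evenperm g \<longleftrightarrow> even m)"
  using assms
proof (induction m arbitrary: g)
  case 0
  then have "g = id" by auto
  then show ?case by (metis evenperm_id even_zero permutation_id)
next
  case (Suc m)
  let ?a = "f (2 * m)" and ?b = "f (2 * m + 1)"
  define h where "h = transpose ?a ?b \<circ> g"
  have inj: "f i = f j \<longleftrightarrow> i = j" if "i < 2 * m + 2" "j < 2 * m + 2" for i j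
    using inj_on_eq_iff[OF Suc.prems(1), of i j] that by auto
  have ab: "?a \<noteq> ?b" using inj[of "2 * m" "2 * m + 1"] by simp
  have "permutation h \<and> (evenperm h \<longleftrightarrow> even m)"
  proof (rule Suc.IH)
    show "inj_on f {..<2 * m}" using Suc.prems(1) by (rule inj_on_subset) auto
    show "h (f (2 * i)) = f (2 * i + 1)" if "i < m" for i
      using that Suc.prems(2)[of i] inj[of "2 * i + 1" "2 * m"] inj[of "2 * i + 1" "2 * m + 1"]
      by (simp add: h_def transpose_def)
    show "h (f (2 * i + 1)) = f (2 * i)" if "i < m" for i
      using that Suc.prems(3)[of i] inj[of "2 * i" "2 * m"] inj[of "2 * i" "2 * m + 1"]
      by (simp add: h_def transpose_def)
    show "h x = x" if "x \<notin> f ` {..<2 * m}" for x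
    proof (cases "x = ?a \<or> x = ?b")
      case True
      then show ?thesis using Suc.prems(2,3)[of m] ab by (auto simp: h_def transpose_def)
    next
      case False
      then have "x \<notin> f ` {..<2 * Suc m}" using that by (auto simp: lessThan_Suc)
      then show ?thesis using Suc.prems(4) False by (simp add: h_def transpose_def)
    qed
  qed
  moreover have "g = transpose ?a ?b \<circ> h" by (simp add: h_def fun_eq_iff)
  ultimately show ?case using ab
    by (metis evenperm_comp evenperm_swap permutation_swap_id permutation_compose even_Suc)
qed

section \<open>Involutions, commutation relations and parity of the generators\<close>

context action48 begin

lemma u_eq: "i < 2 * t + 3 \<Longrightarrow> j < 2 * t + 3 \<Longrightarrow> u i = u j \<longleftrightarrow> i = j"
  using inj_on_eq_iff[OF inj_u, of i j] by simp

lemma y_eq: "1 \<le> i \<Longrightarrow> i \<le> q + 7 \<Longrightarrow> 1 \<le> j \<Longrightarrow> j \<le> q + 7 \<Longrightarrow> y i = y j \<longleftrightarrow> i = j"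
  using inj_on_eq_iff[OF inj_y, of i j] by simp

lemma z_eq: "3 \<le> i \<Longrightarrow> i \<le> q + 7 \<Longrightarrow> 3 \<le> j \<Longrightarrow> j \<le> q + 7 \<Longrightarrow> z i = z j \<longleftrightarrow> i = j"
  using inj_on_eq_iff[OF inj_z, of i j] by simp

lemma V_cases:
  assumes "x \<in> V"
  obtains (u) m where "m \<le> 2 * t" "x = u m" | (y) m where "1 \<le> m" "m \<le> q + 7" "x = y m"
    | (z) m where "3 \<le> m" "m \<le> q + 7" "x = z m"
  using assms unfolding V_eq by auto

lemma in_V: "m \<le> 2 * t \<Longrightarrow> u m \<in> V" "1 \<le> k \<Longrightarrow> k \<le> q + 7 \<Longrightarrow> y k \<in> V" "3 \<le> k \<Longrightarrow> k \<le> q + 7 \<Longrightarrow> z k \<in> V"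
  unfolding V_eq by auto

lemma finite_V: "finite V" unfolding V_eq by simp

lemma rho0_left: "m \<le> 2 * t \<Longrightarrow>
    rho 0 (u m) = (if odd m then u (m - 1) else if m = 2 * t then y 1 else u (m + 1))"
  using rho0_u[of m] y1 by auto

lemma rho1_left: "m \<le> 2 * t \<Longrightarrow> rho 1 (u m) = (if odd m then u (m + 1) else u (m - 1))"
  using rho1_u[of m] by simp

lemma rho0_right: "1 \<le> m \<Longrightarrow> m \<le> q + 7 \<Longrightarrow> rho 0 (y m) = (if m = 1 then u (2 * t) else y m)"
proof -
  assume m: "1 \<le> m" "m \<le> q + 7"
  have "rho 0 (y 1) = u (2 * t)" unfolding y1 using rho0_u[of "2 * t + 1"] by auto
  moreover have "rho 0 (y 2) = y 2" unfolding y2 using rho0_u[of "2 * t + 2"] by auto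
  moreover have "m = 1 \<or> m = 2 \<or> 3 \<le> m" using m by linarith
  ultimately show ?thesis using m rho0_y[of m] by auto
qed

lemma odd_left: "odd m \<Longrightarrow> m \<le> 2 * t \<Longrightarrow> Suc m \<le> 2 * t"
  by (metis dvd_triv_left le_antisym not_less_eq_eq)

lemma rho_rho: "k < q + 7 \<Longrightarrow> rho k (rho k x) = x"
proof (cases "x \<in> V")
  case False
  then show ?thesis by (simp add: rho_out)
next
  case True
  assume k: "k < q + 7"
  from True show ?thesis
  proof (cases rule: V_cases)
    case (u m)
    consider "k = 0" | "k = 1" | "k = 2" | "3 \<le> k" by linarith
    then show ?thesis
    proof cases
      case 1
      then show ?thesis
        using rho0_left[of m] u rho0_left[of "m + 1"] rho0_left[of "m - 1"] rho0_right[of 1] by auto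
    next
      case 2
      then show ?thesis
        using rho1_left[of m] u odd_left[of m] rho1_left[of "m + 1"] rho1_left[of "m - 1"]
        by (cases "m = 0") auto
    next
      case 3
      then show ?thesis using rho2_u[of m] rho2_u[of 2] rho2_u[of 3] u t_ge by auto
    next
      case 4
      then show ?thesis using rho_u u by auto
    qed
  next
    case (y m)
    show ?thesis
    proof (cases "k = 0")
      case True
      then show ?thesis using rho0_right[of m] y rho0_left[of "2 * t"] by auto
    next
      case False
      then show ?thesis using k y by (auto simp: rho_y rho_z)
    qed
  next
    case (z m)
    then show ?thesis using k by (cases "k = q + 4"; cases "q + 6 \<le> m") (auto simp: rho_y rho_z)
  qed
qed

text \<open>Labels at distance at least 2 meet in two places only. One is the double edge between
  \<open>u 2\<close> and \<open>u 3\<close> with labels 0 and 2; the other is the square on the last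
  two pairs, whose opposite sides carry the labels q+6 and q+4.\<close>

lemma rho_commute:
  assumes "i + 2 \<le> j" "j < q + 7"
  shows "rho i (rho j x) = rho j (rho i x)"
proof (cases "x \<in> V")
  case False
  then show ?thesis by (simp add: rho_out)
next
  case True
  then show ?thesis
  proof (cases rule: V_cases)
    case (u m)
    show ?thesis
    proof (cases "j = 2")
      case True
      then have i: "i = 0" using assms by simp
      consider "m = 2" | "m = 3" | "m \<noteq> 2" "m \<noteq> 3" "odd m" | "m \<noteq> 2" "m \<noteq> 3" "even m" by blast
      then show ?thesis
      proof cases
        case 1
        then show ?thesis using rho2_u[of 2] rho0_left[of 2] rho0_left[of 3] rho2_u[of 3] t_ge True i u by auto
      next
        case 2
        then show ?thesis using rho2_u[of 2] rho0_left[of 2] rho0_left[of 3] rho2_u[of 3] t_ge True i u by auto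
      next
        case 3
        then have "m - 1 \<noteq> 2" "m - 1 \<noteq> 3" by presburger+
        then show ?thesis using 3 True i u rho2_u[of m] rho2_u[of "m - 1"] rho0_left[of m] by auto
      next
        case 4
        then have "m + 1 \<noteq> 2" "m + 1 \<noteq> 3" by presburger+
        then show ?thesis using 4 True i u rho2_u[of m] rho2_u[of "m + 1"] rho0_left[of m] rho_y[of 2 1]
          by auto
      qed
    next
      case False
      then have j: "3 \<le> j" using assms by linarith
      consider "i = 0" | "i = 1" | "i = 2" | "3 \<le> i" by linarith
      then show ?thesis
      proof cases
        case 1
        then show ?thesis using j u rho0_left[of m] rho_u assms(2) rho_y[of j 1] by auto
      next
        case 2
        then show ?thesis using j u rho1_left[of m] rho_u odd_left[of m] by auto
      next
        case 3
        then show ?thesis using j u rho2_u[of m] rho_u t_ge by auto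
      next
        case 4
        then show ?thesis using j u rho_u by auto
      qed
    qed
  next
    case (y m)
    show ?thesis
    proof (cases "i = 0")
      case True
      show ?thesis
      proof (cases "m = 1")
        case m: True
        then show ?thesis using True y assms rho0_right[of 1] rho_y[of j 1]
            rho2_u[of "2 * t"] rho_u[of j "2 * t"] t_ge by (cases "j = 2") auto
      next
        case False
        then show ?thesis using True y assms by (auto simp: rho0_right rho_y rho_z)
      qed
    next
      case False
      then show ?thesis using y assms
        by (cases "i = m \<or> i + 1 = m"; cases "j = m \<or> j + 1 = m") (auto simp: rho_y rho_z)
    qed
  next
    case (z m)
    then show ?thesis using assms
      by (cases "i = 0"; cases "i = m \<or> i + 1 = m"; cases "j = m \<or> j + 1 = m") (auto simp: rho_y rho_z rho0_right)
  qed
qed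

sublocale string_involutions rho "q + 7"
proof
  show "rho k \<circ> rho k = id" if "k < q + 7" for k using rho_rho[OF that] by (simp add: fun_eq_iff)
  show "rho i \<circ> rho j = rho j \<circ> rho i" if "i + 2 \<le> j" "j < q + 7" for i j
    using rho_commute[OF that] by (simp add: fun_eq_iff)
qed

lemma rho_permutes: "k < q + 7 \<Longrightarrow> rho k permutes V"
  unfolding permutes_def using rho_out rho_rho by metis

lemma rho_z_0_2: "3 \<le> m \<Longrightarrow> m \<le> q + 7 \<Longrightarrow> k \<le> 2 \<Longrightarrow> rho k (z m) = z m"
  by (auto simp: rho_z)

lemma y_V_cases:
  assumes "x \<in> V"
  obtains (u) m where "m < 2 * t + 3" "x = u m" | (y) m where "3 \<le> m" "m \<le> q + 7" "x = y m"
    | (z) m where "3 \<le> m" "m \<le> q + 7" "x = z m"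
  using assms
proof (cases rule: V_cases)
  case (y m)
  then consider "m = 1" | "m = 2" | "3 \<le> m" by linarith
  then show ?thesis using that(1)[of "2 * t + 1"] that(1)[of "2 * t + 2"] that(2) y y1 y2
    by cases auto
next
  case (u m)
  then show ?thesis using that(1)[of m] by simp
next
  case (z m)
  then show ?thesis using that(3) by blast
qed

text \<open>Label 0 matches u_0, ..., u_(2t+1) in t+1 consecutive pairs, an even number as
  \<open>t\<close> is odd. For label 1 the same matching is shifted by one vertex.\<close>

lemma even_rho0: "evenperm (rho 0)"
proof -
  have "permutation (rho 0) \<and> (evenperm (rho 0) \<longleftrightarrow> even (t + 1))"
  proof (rule evenperm_matching[of u])
    show "inj_on u {..<2 * (t + 1)}" by (rule inj_on_subset[OF inj_u]) auto
    show "rho 0 (u (2 * i)) = u (2 * i + 1)" "rho 0 (u (2 * i + 1)) = u (2 * i)" if "i < t + 1" for i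
      using that by (auto simp: rho0_u)
    show "rho 0 x = x" if "x \<notin> u ` {..<2 * (t + 1)}" for x
    proof (cases "x \<in> V")
      case True
      then show ?thesis
      proof (cases rule: y_V_cases)
        case (u m)
        then have "m = 2 * t + 2" using that by force
        then show ?thesis using u by (simp add: rho0_u)
      qed (auto simp: rho0_y rho_z)
    qed (simp add: rho_out)
  qed
  then show ?thesis using t_odd by simp
qed

lemma even_rho1: "evenperm (rho 1)"
proof -
  have "permutation (rho 1) \<and> (evenperm (rho 1) \<longleftrightarrow> even (t + 1))"
  proof (rule evenperm_matching[of "\<lambda>i. u (i + 1)"])
    show "inj_on (\<lambda>i. u (i + 1)) {..<2 * (t + 1)}" by (auto simp: inj_on_def u_eq)
    show "rho 1 (u (2 * i + 1)) = u (2 * i + 1 + 1)" "rho 1 (u (2 * i + 1 + 1)) = u (2 * i + 1)" if "i < t + 1" for i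
      using that rho1_u[of "2 * i + 1"] rho1_u[of "2 * i + 2"] by auto
    show "rho 1 x = x" if "x \<notin> (\<lambda>i. u (i + 1)) ` {..<2 * (t + 1)}" for x
    proof (cases "x \<in> V")
      case True
      then show ?thesis
      proof (cases rule: y_V_cases)
        case (u m)
        have "m = 0"
        proof (rule ccontr)
          assume "m \<noteq> 0"
          then have "x = u (m - 1 + 1)" "m - 1 < 2 * (t + 1)" using u by auto
          then show False using that by blast
        qed
        then show ?thesis using u rho1_u[of 0] by simp
      qed (auto simp: rho_y rho_z)
    qed (simp add: rho_out)
  qed
  then show ?thesis using t_odd by simp
qed

lemma evenperm_matching_list:
  assumes "distinct xs" "length xs = 2 * m" "even m"
    and "\<And>i. i < m \<Longrightarrow> g (xs ! (2 * i)) = xs ! (2 * i + 1)"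
    and "\<And>i. i < m \<Longrightarrow> g (xs ! (2 * i + 1)) = xs ! (2 * i)"
    and "\<And>x. x \<notin> set xs \<Longrightarrow> g x = x"
  shows "evenperm g"
proof -
  have "set xs = (!) xs ` {..<2 * m}" using assms(2) by (metis list.set_map map_nth set_upt atLeast0LessThan)
  then show ?thesis
    using evenperm_matching[of "(!) xs" m g] assms inj_on_nth[OF assms(1), of "{..<2 * m}"] by auto
qed

lemma all_less_numeral: "(\<forall>i<2. R i) \<longleftrightarrow> R 0 \<and> R (1::nat)" "(\<forall>i<4. R i) \<longleftrightarrow> R 0 \<and> R (1::nat) \<and> R 2 \<and> R 3"
  by (auto simp: numeral_eq_Suc less_Suc_eq)

lemma even_rho2: "evenperm (rho 2)"
proof (rule evenperm_matching_list[of "[u 2, u 3, y 2, y 3]" 2])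
  show "distinct [u 2, u 3, y 2, y 3]" using t_ge by (auto simp: u_eq u_y y_eq)
  have "\<forall>i<2. rho 2 ([u 2, u 3, y 2, y 3] ! (2 * i)) = [u 2, u 3, y 2, y 3] ! (2 * i + 1) \<and>
      rho 2 ([u 2, u 3, y 2, y 3] ! (2 * i + 1)) = [u 2, u 3, y 2, y 3] ! (2 * i)"
    unfolding all_less_numeral using t_ge by (simp add: rho2_u rho_y)
  then show "i < 2 \<Longrightarrow> rho 2 ([u 2, u 3, y 2, y 3] ! (2 * i)) = [u 2, u 3, y 2, y 3] ! (2 * i + 1)"
    "i < 2 \<Longrightarrow> rho 2 ([u 2, u 3, y 2, y 3] ! (2 * i + 1)) = [u 2, u 3, y 2, y 3] ! (2 * i)" for i by blast+
  show "rho 2 x = x" if "x \<notin> set [u 2, u 3, y 2, y 3]" for x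
  proof (cases "x \<in> V")
    case True
    then show ?thesis by (cases rule: V_cases) (use that in \<open>auto simp: rho2_u rho_y rho_z\<close>)
  qed (simp add: rho_out)
qed simp_all

lemma even_rho3:
  assumes "3 \<le> k" "k < q + 7" "k \<noteq> q + 4" shows "evenperm (rho k)"
proof (rule evenperm_matching_list[of "[y k, y (k + 1), z k, z (k + 1)]" 2])
  let ?xs = "[y k, y (k + 1), z k, z (k + 1)]"
  show "distinct ?xs" using assms by (auto simp: y_eq z_eq y_z)
  have "\<forall>i<2. rho k (?xs ! (2 * i)) = ?xs ! (2 * i + 1) \<and> rho k (?xs ! (2 * i + 1)) = ?xs ! (2 * i)"
    unfolding all_less_numeral using assms by (simp add: rho_y rho_z)
  then show "i < 2 \<Longrightarrow> rho k (?xs ! (2 * i)) = ?xs ! (2 * i + 1)"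
    "i < 2 \<Longrightarrow> rho k (?xs ! (2 * i + 1)) = ?xs ! (2 * i)" for i by blast+
  show "rho k x = x" if "x \<notin> set ?xs" for x
  proof (cases "x \<in> V")
    case True
    then show ?thesis by (cases rule: V_cases) (use that assms in \<open>auto simp: rho_u rho_y rho_z\<close>)
  qed (simp add: rho_out)
qed simp_all

text \<open>The label q+4 = r-3 occurs on four edges: one on the y-path, one on the z-path and the
  two rungs at q+6 and q+7.\<close>

lemma even_rho_special: "evenperm (rho (q + 4))"
proof -
  let ?xs = "[y (q + 4), y (q + 5), z (q + 4), z (q + 5), y (q + 6), z (q + 6), y (q + 7), z (q + 7)]"
  show ?thesis
  proof (rule evenperm_matching_list[of ?xs 4])
    show "distinct ?xs" by (auto simp: y_eq z_eq y_z y_z[symmetric])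
    have "\<forall>i<4. rho (q + 4) (?xs ! (2 * i)) = ?xs ! (2 * i + 1) \<and> rho (q + 4) (?xs ! (2 * i + 1)) = ?xs ! (2 * i)"
      unfolding all_less_numeral by (simp add: rho_y rho_z add.commute)
    then show "i < 4 \<Longrightarrow> rho (q + 4) (?xs ! (2 * i)) = ?xs ! (2 * i + 1)"
      "i < 4 \<Longrightarrow> rho (q + 4) (?xs ! (2 * i + 1)) = ?xs ! (2 * i)" for i by blast+
    show "rho (q + 4) x = x" if "x \<notin> set ?xs" for x
    proof (cases "x \<in> V")
      case True
      then show ?thesis
      proof (cases rule: V_cases)
        case (y m)
        then have "m \<noteq> q + 4 \<and> m \<noteq> q + 5 \<and> m \<noteq> q + 6 \<and> m \<noteq> q + 7" using that by auto
        then show ?thesis using y by (auto simp: rho_y)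
      next
        case (z m)
        then have "m \<noteq> q + 4 \<and> m \<noteq> q + 5 \<and> m \<noteq> q + 6 \<and> m \<noteq> q + 7" using that by auto
        then show ?thesis using z by (auto simp: rho_z)
      qed (simp add: rho_u)
    qed (simp add: rho_out)
  qed simp_all
qed

lemma even_rho: "k < q + 7 \<Longrightarrow> evenperm (rho k)"
proof -
  assume k: "k < q + 7"
  consider "k = 0" | "k = 1" | "k = 2" | "k = q + 4" | "3 \<le> k" "k \<noteq> q + 4" by linarith
  then show ?thesis
    using even_rho0 even_rho1 even_rho2 even_rho3 even_rho_special k by cases auto
qed

lemma W_even:
  assumes "g \<in> W J" "J \<subseteq> {..<q + 7}"
  shows "g permutes V \<and> evenperm g"
  using assms(1)
proof induction
  case words_id
  show ?case by (metis evenperm_id permutes_id)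
next
  case (words_step k g)
  then have k: "k < q + 7" using assms(2) by auto
  have "permutation (rho k)" "permutation g"
    using rho_permutes[OF k] words_step finite_V unfolding permutation_permutes by blast+
  then have "evenperm (rho k \<circ> g)" using evenperm_comp even_rho[OF k] words_step by blast
  moreover have "rho k \<circ> g permutes V" using rho_permutes[OF k] words_step permutes_compose by blast
  ultimately show ?case by blast
qed

end

section \<open>Products of consecutive generators and the generated group\<close>

lemma funpow_dvd_fix:
  assumes "(f ^^ d) x = x" "d dvd e" shows "(f ^^ e) x = x"
proof -
  obtain c where "e = d * c" using assms(2) by blast
  moreover have "((f ^^ d) ^^ c) x = x" using assms(1) by (induction c) auto
  ultimately show ?thesis by (simp add: funpow_mult mult.commute)
qed

lemma funpow_small:
  "(f ^^ 2) x = f (f x)" "(f ^^ 3) x = f (f (f x))" "(f ^^ 4) x = f (f (f (f x)))"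
  "(f ^^ 6) x = f (f (f (f (f (f x)))))"
  by (simp_all add: numeral_eq_Suc)

context fun_group begin

lemma funpow_in: "g \<in> H \<Longrightarrow> g ^^ k \<in> H"
  by (induction k) (use one comp in \<open>simp_all only: funpow.simps\<close>)

lemma full_two: "full {a, b}" unfolding full_def by blast

end

context action48 begin

lemma z_y: "1 \<le> m \<Longrightarrow> m \<le> q + 7 \<Longrightarrow> 3 \<le> k \<Longrightarrow> k \<le> q + 7 \<Longrightarrow> z k \<noteq> y m"
  using y_z by metis

lemma y_u: "m \<le> 2 * t \<Longrightarrow> 1 \<le> k \<Longrightarrow> k \<le> q + 7 \<Longrightarrow> y k \<noteq> u m"
  using u_y by metis

lemma prod1_u: "m \<le> 2 * t \<Longrightarrow> rho 1 (rho 2 (u m)) =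
    (if m = 1 then u 2 else if m = 2 then u 4 else if m = 3 then u 1 else if m = 4 then u 3
     else if odd m then u (m + 1) else u (m - 1))"
  using t_ge by (auto simp: rho2_u rho1_left[unfolded One_nat_def] simp flip: numeral_2_eq_2)

lemma prod2_u: "m \<le> 2 * t \<Longrightarrow> rho 2 (rho 3 (u m)) = (if m = 2 then u 3 else if m = 3 then u 2 else u m)"
  by (simp add: rho_u rho2_u)

lemma prod_y:
  assumes "1 \<le> k" "k \<le> q + 2 \<or> k = q + 5" "1 \<le> m" "m \<le> q + 7"
  shows "rho k (rho (k + 1) (y m)) =
    (if m = k then y (k + 1) else if m = k + 1 then y (k + 2) else if m = k + 2 then y k else y m)"
  using assms by (auto simp: rho_y)

lemma prod2_z:
  "3 \<le> m \<Longrightarrow> m \<le> q + 7 \<Longrightarrow> rho 2 (rho 3 (z m)) = (if m = 3 then z 4 else if m = 4 then z 3 else z m)"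
  by (auto simp: rho_z)

lemma prod3_y:
  "1 \<le> m \<Longrightarrow> m \<le> q + 7 \<Longrightarrow> rho (q + 3) (rho (q + 4) (y m)) =
    (if m = q + 3 then y (q + 4) else if m = q + 4 then y (q + 5) else if m = q + 5 then y (q + 3)
     else if q + 6 \<le> m then z m else y m)"
  by (auto simp: rho_y rho_z add.commute)

lemma prod3_z:
  "3 \<le> m \<Longrightarrow> m \<le> q + 7 \<Longrightarrow> rho (q + 3) (rho (q + 4) (z m)) =
    (if m = q + 3 then z (q + 4) else if m = q + 4 then z (q + 5) else if m = q + 5 then z (q + 3)
     else if q + 6 \<le> m then y m else z m)"
  by (auto simp: rho_y rho_z add.commute)

lemma prod4_y:
  "1 \<le> m \<Longrightarrow> m \<le> q + 7 \<Longrightarrow> rho (q + 4) (rho (q + 5) (y m)) =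
    (if m = q + 4 then y (q + 5) else if m = q + 5 then z (q + 6) else if m = q + 6 then y (q + 4)
     else if m = q + 7 then z (q + 7) else y m)"
  by (auto simp: rho_y rho_z add.commute)

lemma prod4_z:
  "3 \<le> m \<Longrightarrow> m \<le> q + 7 \<Longrightarrow> rho (q + 4) (rho (q + 5) (z m)) =
    (if m = q + 4 then z (q + 5) else if m = q + 5 then y (q + 6) else if m = q + 6 then z (q + 4)
     else if m = q + 7 then y (q + 7) else z m)"
  by (auto simp: rho_y rho_z add.commute)

lemma rho_comp_out: "x \<notin> V \<Longrightarrow> ((rho i \<circ> rho j) ^^ e) x = x"
  by (rule funpow_dvd_fix[where d = 1]) (simp_all add: rho_out)

text \<open>The product has the 4-cycle u_1, u_2, u_4, u_3, swaps on the left path beyond u_4, and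
  the 3-cycle y_1, y_2, y_3. The fourth power kills all but the last and leaves that one unchanged,
  as 4 = 1 modulo 3.\<close>

lemma pow4_12: "(rho 1 \<circ> rho 2) ^^ 4 = cyc3 (y 1) (y 2) (y 3)"
proof
  fix x
  define f where "f = rho 1 \<circ> rho 2"
  have fu: "f (u m) = (if m = 1 then u 2 else if m = 2 then u 4 else if m = 3 then u 1
      else if m = 4 then u 3 else if odd m then u (m + 1) else u (m - 1))" if "m \<le> 2 * t" for m
    unfolding f_def using prod1_u[OF that] by (simp only: comp_apply)
  have fy: "f (y 1) = y 2" "f (y 2) = y 3" "f (y 3) = y 1" "\<And>m. 4 \<le> m \<Longrightarrow> m \<le> q + 7 \<Longrightarrow> f (y m) = y m"
    unfolding f_def using prod_y[of 1] by (auto simp: numeral_eq_Suc)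
  have fz: "f (z m) = z m" if "3 \<le> m" "m \<le> q + 7" for m
    unfolding f_def using that by (simp add: rho_z_0_2)
  have c: "cyc3 (y 1) (y 2) (y 3) x = x" if "x \<noteq> y 1" "x \<noteq> y 2" "x \<noteq> y 3" for x
    using that by (auto simp: cyc3_def transpose_def)
  have "(f ^^ 4) x = cyc3 (y 1) (y 2) (y 3) x"
  proof (cases "x \<in> V")
    case False
    then have "x \<noteq> y 1" "x \<noteq> y 2" "x \<noteq> y 3" using in_V(2)[of 1] in_V(2)[of 2] in_V(2)[of 3] by auto
    then show ?thesis unfolding f_def using c rho_comp_out[OF False] by metis
  next
    case True
    then show ?thesis
    proof (cases rule: V_cases)
      case (u m)
      have "(f ^^ 4) x = x"
      proof (cases "m = 1 \<or> m = 2 \<or> m = 3 \<or> m = 4")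
        case True
        then show ?thesis unfolding u(2) funpow_small
          using fu[of 1] fu[of 2] fu[of 3] fu[of 4] t_ge by auto
      next
        case False
        have "f (f x) = x"
        proof (cases "odd m")
          case True
          then have "f (u m) = u (m + 1)" using False u fu[of m] by auto
          moreover have "m + 1 \<le> 2 * t" "m + 1 \<noteq> 2" "m + 1 \<noteq> 4" "m + 1 \<noteq> 3" using odd_left[OF True] True u False by presburger+
          then have "f (u (m + 1)) = u m" using True fu[of "m + 1"] by auto
          ultimately show ?thesis using u by simp
        next
          case even: False
          then have 1: "f (u m) = u (m - 1)" using False u fu[of m] by auto
          show ?thesis
          proof (cases "m = 0")
            case False
            then have "m - 1 \<noteq> 1" "m - 1 \<noteq> 2" "m - 1 \<noteq> 3" "m - 1 \<noteq> 4" "odd (m - 1)"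
              using even \<open>\<not> (m = 1 \<or> m = 2 \<or> m = 3 \<or> m = 4)\<close> by presburger+
            then have "f (u (m - 1)) = u m" using fu[of "m - 1"] u False by auto
            then show ?thesis using 1 u by simp
          qed (use 1 u in simp)
        qed
        then show ?thesis by (simp add: funpow_small)
      qed
      then show ?thesis using c[of x] u u_y[of m] y_u[of m] by auto
    next
      case (y m)
      then consider "m = 1" | "m = 2" | "m = 3" | "4 \<le> m" by linarith
      then show ?thesis
      proof cases
        case 4
        then show ?thesis using fy(4)[of m] y c[of x] y_eq[of m] by (simp add: funpow_small)
      qed (use fy y y_eq[of 1 2] y_eq[of 1 3] y_eq[of 2 3] in \<open>simp_all add: funpow_small cyc3_def transpose_def\<close>)
    next
      case (z m)
      then show ?thesis using fz[of m] c[of x] y_z[of _ m] z_y[of _ m] by (simp add: funpow_small)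
    qed
  qed
  then show "((rho 1 \<circ> rho 2) ^^ 4) x = cyc3 (y 1) (y 2) (y 3) x" unfolding f_def .
qed

text \<open>The same principle: besides the 3-cycle, the product only swaps u_2 with u_3 and z_3
  with z_4.\<close>

lemma pow4_23: "(rho 2 \<circ> rho 3) ^^ 4 = cyc3 (y 2) (y 3) (y 4)"
proof
  fix x
  define f where "f = rho 2 \<circ> rho 3"
  have fu: "f (u m) = (if m = 2 then u 3 else if m = 3 then u 2 else u m)" if "m \<le> 2 * t" for m
    unfolding f_def using prod2_u[OF that] by (simp only: comp_apply)
  have fy: "f (y 2) = y 3" "f (y 3) = y 4" "f (y 4) = y 2"
    "\<And>m. 1 \<le> m \<Longrightarrow> m \<noteq> 2 \<Longrightarrow> m \<noteq> 3 \<Longrightarrow> m \<noteq> 4 \<Longrightarrow> m \<le> q + 7 \<Longrightarrow> f (y m) = y m"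
    unfolding f_def using prod_y[of 2] by (auto simp: numeral_eq_Suc)
  have fz: "f (z m) = (if m = 3 then z 4 else if m = 4 then z 3 else z m)" if "3 \<le> m" "m \<le> q + 7" for m
    unfolding f_def using prod2_z[OF that] by (simp only: comp_apply)
  have c: "cyc3 (y 2) (y 3) (y 4) x = x" if "x \<noteq> y 2" "x \<noteq> y 3" "x \<noteq> y 4" for x
    using that by (auto simp: cyc3_def transpose_def)
  have "(f ^^ 4) x = cyc3 (y 2) (y 3) (y 4) x"
  proof (cases "x \<in> V")
    case False
    then have "x \<noteq> y 2" "x \<noteq> y 3" "x \<noteq> y 4" using in_V(2)[of 2] in_V(2)[of 3] in_V(2)[of 4] by auto
    then show ?thesis unfolding f_def using c rho_comp_out[OF False] by metis
  next
    case True
    then show ?thesis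
    proof (cases rule: V_cases)
      case (u m)
      then have "f (f x) = x" using fu[of m] fu[of 2] fu[of 3] t_ge by auto
      then show ?thesis using c[of x] u u_y[of m] y_u[of m] by (auto simp: funpow_small)
    next
      case (y m)
      then consider "m = 2" | "m = 3" | "m = 4" | "m \<noteq> 2" "m \<noteq> 3" "m \<noteq> 4" by linarith
      then show ?thesis
      proof cases
        case 4
        then show ?thesis using fy(4)[of m] y c[of x] y_eq[of m] by (simp add: funpow_small)
      qed (use fy y y_eq[of 2 3] y_eq[of 2 4] y_eq[of 3 4] in \<open>simp_all add: funpow_small cyc3_def transpose_def\<close>)
    next
      case (z m)
      then have "f (f x) = x" using fz[of m] fz[of 3] fz[of 4] by auto
      then show ?thesis using c[of x] z y_z[of _ m] z_y[of _ m] by (simp add: funpow_small)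
    qed
  qed
  then show "((rho 2 \<circ> rho 3) ^^ 4) x = cyc3 (y 2) (y 3) (y 4) x" unfolding f_def .
qed

definition flip :: "nat \<Rightarrow> 'a \<Rightarrow> 'a" where "flip m = transpose (y m) (z m)"

lemma flip_simps [simp]:
  "flip m (y m) = z m" "flip m (z m) = y m" "x \<noteq> y m \<Longrightarrow> x \<noteq> z m \<Longrightarrow> flip m x = x" "flip m \<circ> flip m = id"
  by (auto simp: flip_def)

lemma flip_y: "3 \<le> i \<Longrightarrow> i \<le> q + 7 \<Longrightarrow> 1 \<le> m \<Longrightarrow> m \<le> q + 7 \<Longrightarrow>
    flip i (y m) = (if m = i then z m else y m)"
  using y_eq[of m i] y_z[of m i] by (cases "m = i") auto

lemma flip_z: "3 \<le> i \<Longrightarrow> i \<le> q + 7 \<Longrightarrow> 3 \<le> m \<Longrightarrow> m \<le> q + 7 \<Longrightarrow>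
    flip i (z m) = (if m = i then y m else z m)"
  using z_eq[of m i] z_y[of i m] by (cases "m = i") auto

lemma flip_u: "3 \<le> i \<Longrightarrow> i \<le> q + 7 \<Longrightarrow> m \<le> 2 * t \<Longrightarrow> flip i (u m) = u m"
  using u_y[of m i] u_z[of m i] by simp

text \<open>On both paths the product is a 3-cycle of the indices q+3, q+4, q+5, while at q+6 and
  q+7 only the rungs act. Cubing retains exactly the two flips.\<close>

lemma pow3_34: "(rho (q + 3) \<circ> rho (q + 4)) ^^ 3 = flip (q + 6) \<circ> flip (q + 7)"
proof
  fix x
  define f where "f = rho (q + 3) \<circ> rho (q + 4)"
  have fy: "f (y m) = (if m = q + 3 then y (q + 4) else if m = q + 4 then y (q + 5)
      else if m = q + 5 then y (q + 3) else if q + 6 \<le> m then z m else y m)" if "1 \<le> m" "m \<le> q + 7" for m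
    unfolding f_def using prod3_y[OF that] by (simp only: comp_apply)
  have fz: "f (z m) = (if m = q + 3 then z (q + 4) else if m = q + 4 then z (q + 5)
      else if m = q + 5 then z (q + 3) else if q + 6 \<le> m then y m else z m)" if "3 \<le> m" "m \<le> q + 7" for m
    unfolding f_def using prod3_z[OF that] by (simp only: comp_apply)
  have fl: "(flip (q + 6) \<circ> flip (q + 7)) x = x"
    if "\<And>m. m = q + 6 \<or> m = q + 7 \<Longrightarrow> x \<noteq> y m \<and> x \<noteq> z m" for x
    using that[of "q + 6"] that[of "q + 7"] by simp
  have "(f ^^ 3) x = (flip (q + 6) \<circ> flip (q + 7)) x"
  proof (cases "x \<in> V")
    case False
    then have "(flip (q + 6) \<circ> flip (q + 7)) x = x" using in_V(2,3) by (intro fl) auto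
    then show ?thesis unfolding f_def using rho_comp_out[OF False] by metis
  next
    case True
    then show ?thesis
    proof (cases rule: V_cases)
      case (u m)
      then have "(flip (q + 6) \<circ> flip (q + 7)) x = x" unfolding u(2) by (intro fl) (auto simp: u_y u_z)
      moreover have "f x = x" unfolding f_def using u by (simp add: rho_u)
      ultimately show ?thesis by (simp add: funpow_small)
    next
      case (y m)
      then consider "m = q + 3 \<or> m = q + 4 \<or> m = q + 5" | "m < q + 3" | "m = q + 6" | "m = q + 7" by linarith
      then show ?thesis
      proof cases
        case 1
        then show ?thesis using y fy[of "q + 3"] fy[of "q + 4"] fy[of "q + 5"] fl[of x] 
          by (auto simp: funpow_small flip_y flip_z)
      next
        case 2
        then show ?thesis using y fy[of m] fl[of x]  by (auto simp: funpow_small flip_y flip_z)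
      qed (use y fy[of m] fz[of m]  in \<open>auto simp: funpow_small flip_y flip_z\<close>)
    next
      case (z m)
      then consider "m = q + 3 \<or> m = q + 4 \<or> m = q + 5" | "m < q + 3" | "m = q + 6" | "m = q + 7" by linarith
      then show ?thesis
      proof cases
        case 1
        then show ?thesis using z fz[of "q + 3"] fz[of "q + 4"] fz[of "q + 5"] fl[of x] 
          by (auto simp: funpow_small flip_y flip_z)
      next
        case 2
        then show ?thesis using z fz[of m] fl[of x]  by (auto simp: funpow_small flip_y flip_z)
      qed (use z fy[of m] fz[of m]  in \<open>auto simp: funpow_small flip_y flip_z\<close>)
    qed
  qed
  then show "((rho (q + 3) \<circ> rho (q + 4)) ^^ 3) x = (flip (q + 6) \<circ> flip (q + 7)) x" unfolding f_def .
qed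

end

section \<open>Sets on which consecutive generators produce all 3-cycles, and products of
  flips\<close>

lemma (in fun_group) full_subset: "full B \<Longrightarrow> A \<subseteq> B \<Longrightarrow> full A"
  unfolding full_def by blast

context action48 begin

abbreviation fullW :: "nat set \<Rightarrow> 'a set \<Rightarrow> bool" where
  "fullW J \<equiv> fun_group.full (W J)"

lemma full_mono: "fullW J B \<Longrightarrow> J \<subseteq> K \<Longrightarrow> K \<subseteq> {..<q + 7} \<Longrightarrow> fullW K B"
  unfolding fun_group.full_def[OF fun_group_words[of K]]
    fun_group.full_def[OF fun_group_words[OF order_trans[of J K]]]
  using words_mono by blast

lemma full_extend:
  assumes J: "J \<subseteq> {..<q + 7}" "k \<in> J" and B: "finite B" "fullW J B"
    and abc: "a \<in> B" "b \<in> B" "c \<in> B" "a \<noteq> b" "b \<noteq> c" "a \<noteq> c" "rho k a \<in> B" "rho k b \<in> B"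
  shows "fullW J (insert (rho k c) B)"
proof -
  interpret H: fun_group "W J" by (rule fun_group_words[OF J(1)])
  show ?thesis by (rule H.full_move[OF B words_gen[OF J(2)] abc])
qed

text \<open>Label \<open>j\<close> carries y_j to y_(j+1) and fixes y_i and y_(i+1) once i + 1 < j.
  Before that there is no 3-cycle to carry; the first one comes from \<open>pow4_12\<close> if
  \<open>i = 1\<close> and from \<open>pow4_23\<close> if \<open>i = 2\<close>.\<close>

lemma full_y:
  assumes "i = 1 \<or> i = 2" "3 \<le> j" "j \<le> q + 7"
  shows "fullW {i..<j} (y ` {i..j})"
  using assms(2,3)
proof (induction j rule: dec_induct)
  case base
  interpret H: fun_group "W {i..<3}" by (rule fun_group_words) auto
  show ?case
  proof (cases "i = 1")
    case True
    have w: "rho 1 \<in> W {i..<3}" "rho 2 \<in> W {i..<3}" using True by (auto intro!: words_gen)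
    then have "cyc3 (y 1) (y 2) (y 3) \<in> W {i..<3}"
      unfolding pow4_12[symmetric] by (intro H.funpow_in H.comp)
    then have "H.full (insert (y 3) {y 1, y 2})"
      by (intro H.full_insert[of _ "y 1" "y 2"] H.full_two) (auto simp: y_eq)
    moreover have "{i..3} = {3, 1, 2}" using True by auto
    ultimately show ?thesis by simp
  next
    case False
    then have "{i..3} = {2, 3}" using assms(1) by auto
    then show ?thesis using H.full_two[of "y 2" "y 3"] by simp
  qed
next
  case (step j)
  have J: "{i..<Suc j} \<subseteq> {..<q + 7}" using step by auto
  interpret H: fun_group "W {i..<Suc j}" by (rule fun_group_words[OF J])
  have IH: "H.full (y ` {i..j})" by (rule full_mono[OF _ _ J, of "{i..<j}"]) (use step in auto)
  have ins: "y ` {i..Suc j} = insert (y (Suc j)) (y ` {i..j})"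
    using step assms(1) by (auto simp: atLeastAtMostSuc_conv)
  have rj: "rho j (y j) = y (Suc j)" using step by (simp add: rho_y)
  show ?case
  proof (cases "i = 1 \<or> 4 \<le> j")
    case True
    then have ij: "Suc i < j" using step assms(1) by auto
    have "H.full (insert (rho j (y j)) (y ` {i..j}))"
      by (rule full_extend[OF J _ _ IH, of j "y i" "y (Suc i)"])
        (use ij step assms(1) in \<open>auto simp: y_eq rho_y\<close>)
    then show ?thesis unfolding ins rj .
  next
    case False
    then have ij: "i = 2" "j = 3" using step assms(1) by auto
    have w: "rho 2 \<in> W {i..<Suc j}" "rho 3 \<in> W {i..<Suc j}" using ij by (auto intro!: words_gen)
    then have "cyc3 (y 2) (y 3) (y 4) \<in> W {i..<Suc j}"
      unfolding pow4_23[symmetric] by (intro H.funpow_in H.comp)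
    then have "H.full (insert (y 4) {y 2, y 3})"
      by (intro H.full_insert[of _ "y 2" "y 3"] H.full_two) (auto simp: y_eq)
    moreover have "{i..Suc j} = {4, 2, 3}" using ij by auto
    ultimately show ?thesis by simp
  qed
qed

text \<open>The rung at q+6 leads from y_(q+6) to z_(q+6), and the labels q+5, q+4, ... then lead
  down the z-path. The label q+5 is also what brings y_(q+6) into the full set in the first
  place.\<close>

lemma full_yz:
  assumes i: "i = 1 \<or> i = 2" and m: "3 \<le> m" "m \<le> q + 6"
  shows "fullW {i..<q + 6} (y ` {i..q + 6} \<union> z ` {m..q + 6})"
proof -
  have J: "{i..<q + 6} \<subseteq> {..<q + 7}" by auto
  show ?thesis using m(2,1)
  proof (induction m rule: inc_induct)
    case base
    have "rho (q + 4) (y (q + 6)) = z (q + 6)" by (simp add: rho_y)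
    moreover have "fullW {i..<q + 6} (insert (rho (q + 4) (y (q + 6))) (y ` {i..q + 6}))"
      by (rule full_extend[OF J _ _ full_y[OF i, of "q + 6"], of "q + 4" "y 2" "y 3"])
        (use i in \<open>auto simp: y_eq rho_y\<close>)
    ultimately show ?case by simp
  next
    case (step m)
    have "rho m (z (Suc m)) = z m" using step by (simp add: rho_z)
    moreover have "fullW {i..<q + 6}
        (insert (rho m (z (Suc m))) (y ` {i..q + 6} \<union> z ` {Suc m..q + 6}))"
      by (rule full_extend[OF J _ _ step.IH, of m "y 2" "y 3"])
        (use step i in \<open>auto simp: y_eq y_z rho_y\<close>)
    moreover have "{m..q + 6} = insert m {Suc m..q + 6}" using step by auto
    ultimately show ?case by simp
  qed
qed

text \<open>Label q+6 adds the ends of both paths. The left path is entered from y_1 along label 0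
  and followed backwards with alternating labels; there y_3 and y_4, fixed by \<open>rho 0\<close>
  and \<open>rho 1\<close>, are the two stationary points of the carried 3-cycle.\<close>

lemma full_V: "fullW {..<q + 7} V"
proof -
  let ?J = "{..<q + 7}" and ?B = "y ` {1..q + 6} \<union> z ` {3..q + 6}"
  have 0: "fullW ?J ?B" by (rule full_mono[OF full_yz[of 1 3]]) auto
  have "fullW ?J (insert (rho (q + 6) (y (q + 6))) ?B)"
    by (rule full_extend[OF _ _ _ 0, of "q + 6" "y 2" "y 3"]) (auto simp: y_eq rho_y)
  then have 1: "fullW ?J (insert (y (q + 7)) ?B)" by (simp add: rho_y add.commute)
  have "fullW ?J (insert (rho (q + 6) (z (q + 6))) (insert (y (q + 7)) ?B))"
    by (rule full_extend[OF _ _ _ 1, of "q + 6" "y 2" "y 3"]) (auto simp: y_eq rho_y y_z)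
  moreover have "rho (q + 6) (z (q + 6)) = z (q + 7)" by (simp add: rho_z add.commute)
  moreover have "insert (z (q + 7)) (insert (y (q + 7)) ?B) = y ` {1..q + 7} \<union> z ` {3..q + 7}" (is "_ = ?C")
  proof -
    have "{1..q + 7} = insert (q + 7) {1..q + 6}" "{3..q + 7} = insert (q + 7) {3..q + 6}" by auto
    then show ?thesis by auto
  qed
  ultimately have 2: "fullW ?J ?C" by simp
  have extend: "fullW ?J (insert (rho k c) B)"
    if "fullW ?J B" "?C \<subseteq> B" "finite B" "c \<in> B" "c \<noteq> y 3" "c \<noteq> y 4" "k = 0 \<or> k = 1" for B c k
  proof (rule full_extend[OF _ _ that(3,1), of k "y 3" "y 4"])
    show "y 3 \<in> B" "y 4 \<in> B" using that(2) by auto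
    then show "rho k (y 3) \<in> B" "rho k (y 4) \<in> B" using that(7) by (auto simp: rho0_right rho_y)
  qed (use that in \<open>auto simp: y_eq\<close>)
  have "fullW ?J (u ` {m..2 * t} \<union> ?C)" if "m \<le> 2 * t" for m
    using that
  proof (induction m rule: inc_induct)
    case base
    have "fullW ?J (insert (rho 0 (y 1)) ?C)" by (rule extend[OF 2]) (auto simp: y_eq)
    then show ?case by (simp add: rho0_right)
  next
    case (step m)
    have "rho (if even m then 0 else 1) (u (Suc m)) = u m"
      using step rho0_left[of "Suc m"] rho1_left[of "Suc m"] by auto
    moreover have "fullW ?J (insert (rho (if even m then 0 else 1) (u (Suc m))) (u ` {Suc m..2 * t} \<union> ?C))"
      by (rule extend[OF step.IH]) (use step in \<open>auto simp: u_y\<close>)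
    moreover have "{m..2 * t} = insert m {Suc m..2 * t}" using step by auto
    ultimately show ?case by simp
  qed
  from this[of 0] show ?thesis unfolding V_eq atLeast0AtMost[symmetric] by (simp add: Un_assoc)
qed

lemma W_all: "W {..<q + 7} = {g. g permutes V \<and> evenperm g}"
proof
  show "W {..<q + 7} \<subseteq> {g. g permutes V \<and> evenperm g}" using W_even by blast
  interpret H: fun_group "W {..<q + 7}" by (rule fun_group_words) auto
  show "{g. g permutes V \<and> evenperm g} \<subseteq> W {..<q + 7}"
    using H.full_even[OF finite_V full_V] by blast
qed

text \<open>Single flips are odd, so the last pair serves as a companion. From
  \<open>pow3_34\<close> on, conjugation by \<open>rho m\<close> turns the flip of the pair m+1 into
  that of the pair m and keeps the flip of the companion.\<close>

lemma flips_in_W: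
  assumes "J \<subseteq> {..<q + 7}" "{m..q + 4} \<union> {q + 3, q + 4} \<subseteq> J" "m \<le> q + 5 \<Longrightarrow> q + 5 \<in> J"
    and m: "3 \<le> m" "m \<le> q + 6"
  shows "flip m \<circ> flip (q + 7) \<in> W J"
  using m(2,1) assms(2,3)
proof (induction m rule: inc_induct)
  case base
  interpret H: fun_group "W J" by (rule fun_group_words[OF assms(1)])
  show ?case unfolding pow3_34[symmetric]
    by (intro H.funpow_in H.comp words_gen) (use base in auto)
next
  case (step m)
  interpret H: fun_group "W J" by (rule fun_group_words[OF assms(1)])
  have mJ: "m \<in> J" using step by (cases "m = q + 5") auto
  have m: "m < q + 7" using step by simp
  have b: "bij (rho m)" and i: "inv' (rho m) = rho m"
    using H.bij[OF words_gen[OF mJ]] invol[OF m] by (auto intro: inv_unique_comp)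
  have "rho m \<circ> (flip (Suc m) \<circ> flip (q + 7)) \<circ> rho m
      = (rho m \<circ> flip (Suc m) \<circ> inv' (rho m)) \<circ> (rho m \<circ> flip (q + 7) \<circ> inv' (rho m))"
    using rho_rho[OF m] unfolding i by (simp add: fun_eq_iff)
  also have "\<dots> = transpose (rho m (y (Suc m))) (rho m (z (Suc m))) \<circ>
      transpose (rho m (y (q + 7))) (rho m (z (q + 7)))"
    unfolding flip_def conj_transpose[OF b] ..
  also have "transpose (rho m (y (Suc m))) (rho m (z (Suc m))) = flip m"
    unfolding flip_def using step by (simp add: rho_y rho_z)
  \<comment> \<open>For \<open>m = q + 4\<close> the rung exchanges the two points of the last pair,
    which does not alter their transposition.\<close>
  also have "transpose (rho m (y (q + 7))) (rho m (z (q + 7))) = flip (q + 7)"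
    unfolding flip_def using step by (cases "m = q + 4") (simp_all add: rho_y rho_z transpose_commute)
  finally have "flip m \<circ> flip (q + 7) = rho m \<circ> (flip (Suc m) \<circ> flip (q + 7)) \<circ> rho m" ..
  moreover have "flip (Suc m) \<circ> flip (q + 7) \<in> W J" by (rule step.IH) (use step in auto)
  ultimately show ?case using H.comp words_gen[OF mJ] by metis
qed

text \<open>With indices relative to \<open>q\<close>, the product has the 6-cycle y_4, y_5, z_6,
  z_4, z_5, y_6 and swaps y_7 with z_7. The partners of a pair are opposite on the 6-cycle, so the
  cube flips all four pairs.\<close>

lemma prod4_cube:
  assumes "1 \<le> m" "m \<le> q + 7"
  shows "((rho (q + 4) \<circ> rho (q + 5)) ^^ 3) (y m) = (if q + 4 \<le> m then z m else y m)"
proof -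
  define f where "f = rho (q + 4) \<circ> rho (q + 5)"
  have fy: "f (y m) = (if m = q + 4 then y (q + 5) else if m = q + 5 then z (q + 6)
      else if m = q + 6 then y (q + 4) else if m = q + 7 then z (q + 7) else y m)"
    if "1 \<le> m" "m \<le> q + 7" for m
    unfolding f_def using prod4_y[OF that] by (simp only: comp_apply)
  have fz: "f (z m) = (if m = q + 4 then z (q + 5) else if m = q + 5 then y (q + 6)
      else if m = q + 6 then z (q + 4) else if m = q + 7 then y (q + 7) else z m)"
    if "3 \<le> m" "m \<le> q + 7" for m
    unfolding f_def using prod4_z[OF that] by (simp only: comp_apply)
  consider "m < q + 4" | "m = q + 4" | "m = q + 5" | "m = q + 6" | "m = q + 7" using assms by linarith
  then have "(f ^^ 3) (y m) = (if q + 4 \<le> m then z m else y m)"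
    by cases (use assms in \<open>auto simp: funpow_small fy fz\<close>)
  then show ?thesis unfolding f_def .
qed

end

section \<open>Intersections of interval subgroups\<close>

text \<open>Adjacent transpositions generate the symmetric group of the index interval, so whatever
  permutation \<open>G\<close> induces on the family \<open>f\<close> is also induced by a word.
  Such a word is used to cancel part of the action of a given group element.\<close>

lemma words_agree:
  fixes f :: "nat \<Rightarrow> 'b"
  assumes f: "inj_on f {lo..hi}" and G: "\<And>m. m \<in> {lo..hi} \<Longrightarrow> G (f m) \<in> f ` {lo..hi}"
    and inj: "inj_on G (f ` {lo..hi})"
    and act: "\<And>k m. k \<in> {lo..<hi} \<Longrightarrow> m \<in> {lo..hi} \<Longrightarrow> act (s k) (f m) = f (transpose k (Suc k) m)"
    and act_id: "\<And>x. act id x = x"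
    and act_comp: "\<And>g h x. act (g \<circ> h) x = act g (act h x)"
  obtains w where "w \<in> words s {lo..<hi}" "\<And>m. m \<in> {lo..hi} \<Longrightarrow> act w (f m) = G (f m)"
proof -
  let ?I = "{lo..hi}"
  define p where "p m = (if m \<in> ?I then inv_into ?I f (G (f m)) else m)" for m
  have pI: "p m \<in> ?I" "f (p m) = G (f m)" if "m \<in> ?I" for m
    using that G[OF that] unfolding p_def by (auto simp: inv_into_into f_inv_into_f simp del: atLeastAtMost_iff)
  have "inj_on p ?I"
  proof (rule inj_onI)
    fix i j assume ij: "i \<in> ?I" "j \<in> ?I" "p i = p j"
    then have "G (f i) = G (f j)" using pI(2) by metis
    then show "i = j" using ij inj f by (meson imageI inj_onD)
  qed
  moreover have "p ` ?I \<subseteq> ?I" using pI(1) by blast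
  ultimately have "bij_betw p ?I ?I" by (simp add: bij_betw_def endo_inj_surj)
  then have "p permutes ?I" by (rule bij_imp_permutes) (simp only: p_def if_False)
  from words_realise[of p lo hi act s f, OF this act act_id act_comp]
  obtain w where "w \<in> words s {lo..<hi}" "\<forall>m \<in> ?I. act w (f m) = f (p m)" by blast
  then show ?thesis using that pI(2) by metis
qed

context action48 begin

lemma W_bij: "g \<in> W J \<Longrightarrow> J \<subseteq> {..<q + 7} \<Longrightarrow> bij g"
  using W_even permutes_bij by blast

lemma W_inj: "g \<in> W J \<Longrightarrow> J \<subseteq> {..<q + 7} \<Longrightarrow> g x = g x' \<longleftrightarrow> x = x'"
  using W_bij by (metis bij_pointE)

lemma rho_y_fix:
  assumes "k < q + 7" "1 \<le> m" "m \<le> q + 7" "k \<noteq> m" "k + 1 \<noteq> m" "k \<noteq> q + 4 \<or> m < q + 6"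
  shows "rho k (y m) = y m"
  using assms by (cases "k = 0") (auto simp: rho0_right rho_y)

lemma W_single:
  assumes "g \<in> W {k}" "k < q + 7" shows "g = id \<or> g = rho k"
  using assms(1)
proof induction
  case (words_step i g)
  then show ?case using invol[OF assms(2)] by (metis comp_id singletonD)
qed simp

text \<open>The bound \<open>hi \<le> q + 5\<close> keeps the rungs out: with labels below q+5, only
  the indices q+6 and q+7 can change between the paths.\<close>

lemma agree_y:
  assumes "g \<in> W J" "J \<subseteq> {..<q + 7}" "1 \<le> lo" "hi \<le> q + 5" "\<And>m. m \<in> {lo..hi} \<Longrightarrow> g (y m) \<in> y ` {lo..hi}"
  obtains w where "w \<in> W {lo..<hi}" "\<And>m. m \<in> {lo..hi} \<Longrightarrow> w (y m) = g (y m)"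
proof (rule words_agree[of y lo hi g "\<lambda>g. g" rho])
  show "inj_on y {lo..hi}" by (rule inj_on_subset[OF inj_y]) (use assms in auto)
  show "inj_on g (y ` {lo..hi})" using W_inj[OF assms(1,2)] by (simp add: inj_on_def)
  show "rho k (y m) = y (transpose k (Suc k) m)" if "k \<in> {lo..<hi}" "m \<in> {lo..hi}" for k m
    using that assms(3,4) by (auto simp: rho_y transpose_def)
qed (use assms(5) that in auto)

lemma agree_z:
  assumes "g \<in> W J" "J \<subseteq> {..<q + 7}" "3 \<le> lo" "hi \<le> q + 5" "\<And>m. m \<in> {lo..hi} \<Longrightarrow> g (z m) \<in> z ` {lo..hi}"
  obtains w where "w \<in> W {lo..<hi}" "\<And>m. m \<in> {lo..hi} \<Longrightarrow> w (z m) = g (z m)"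
proof (rule words_agree[of z lo hi g "\<lambda>g. g" rho])
  show "inj_on z {lo..hi}" by (rule inj_on_subset[OF inj_z]) (use assms in auto)
  show "inj_on g (z ` {lo..hi})" using W_inj[OF assms(1,2)] by (simp add: inj_on_def)
  show "rho k (z m) = z (transpose k (Suc k) m)" if "k \<in> {lo..<hi}" "m \<in> {lo..hi}" for k m
    using that assms(3,4) by (auto simp: rho_z transpose_def)
qed (use assms(5) that in auto)

lemma W_right_z: "g \<in> W {3..<b} \<Longrightarrow> b \<le> q + 7 \<Longrightarrow> m \<le> 2 * t \<Longrightarrow> g (u m) = u m"
  by (erule words_fix) (simp add: rho_u)

lemma W12_left:
  assumes "h \<in> W {k..<3}" "1 \<le> k" "m \<le> 2 * t" shows "h (u m) \<in> u ` {..2 * t}"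
proof (rule words_closed[OF assms(1)])
  fix i x assume i: "i \<in> {k..<3}" and x: "x \<in> u ` {..2 * t}"
  then obtain m where m: "m \<le> 2 * t" "x = u m" by auto
  have "i = 1 \<or> i = 2" using i assms(2) by auto
  then show "rho i x \<in> u ` {..2 * t}"
    using m rho1_left[of m] rho2_u[of m] odd_left[of m] t_ge by auto
qed (use assms in auto)

text \<open>Without label 0 the vertices u_0, ..., u_(2t) are cut off from y_1, and labels from 3 on
  fix them all. Deleting those letters from a word does not change its action there.\<close>

lemma left_part:
  assumes "g \<in> W {k..<b}" "1 \<le> k" "b \<le> q + 7"
  obtains h where "h \<in> W {k..<3}" "\<And>m. m \<le> 2 * t \<Longrightarrow> g (u m) = h (u m)"
proof -
  have "\<exists>h \<in> W {k..<3}. \<forall>m \<le> 2 * t. g (u m) = h (u m)"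
    using assms(1)
  proof induction
    case words_id
    show ?case using words.words_id by blast
  next
    case (words_step i g)
    then obtain h where h: "h \<in> W {k..<3}" "\<And>m. m \<le> 2 * t \<Longrightarrow> g (u m) = h (u m)" by blast
    show ?case
    proof (cases "i < 3")
      case True
      then have "rho i \<circ> h \<in> W {k..<3}" using h words_step by (intro words.words_step) auto
      then show ?thesis using h(2) by (metis comp_apply)
    next
      case False
      have "rho i (h (u m)) = h (u m)" if "m \<le> 2 * t" for m
        using W12_left[OF h(1) assms(2) that] False by (auto simp: rho_u)
      then show ?thesis using h by (metis comp_apply)
    qed
  qed
  then show ?thesis using that by blast
qed

text \<open>Among the labels below q+5 only q+4 touches the last two pairs, and it flips both of
  them.\<close>

lemma tail_cases:
  assumes "g \<in> W {a..<q + 5}"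
  shows "(\<forall>m \<in> {q + 6, q + 7}. g (y m) = y m \<and> g (z m) = z m) \<or>
    (\<forall>m \<in> {q + 6, q + 7}. g (y m) = z m \<and> g (z m) = y m)"
  using assms
proof induction
  case (words_step i g)
  show ?case
  proof (cases "i = q + 4")
    case True
    then have "rho i (y m) = z m \<and> rho i (z m) = y m" if "m \<in> {q + 6, q + 7}" for m
      using that by (auto simp: rho_y rho_z)
    from this[of "q + 6"] this[of "q + 7"] show ?thesis using words_step.IH by auto
  next
    case False
    then have "rho i (y m) = y m \<and> rho i (z m) = z m" if "m \<in> {q + 6, q + 7}" for m
      using that words_step(1) by (cases "i = 0") (auto simp: rho0_right rho_y rho_z)
    from this[of "q + 6"] this[of "q + 7"] show ?thesis using words_step.IH by auto
  qed
qed simp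

lemma last_cases:
  assumes "g \<in> W {a..<q + 6}"
  shows "g (y (q + 7)) = y (q + 7) \<and> g (z (q + 7)) = z (q + 7) \<or>
    g (y (q + 7)) = z (q + 7) \<and> g (z (q + 7)) = y (q + 7)"
  using assms
proof induction
  case (words_step i g)
  have "rho i (y (q + 7)) = (if i = q + 4 then z (q + 7) else y (q + 7))"
    "rho i (z (q + 7)) = (if i = q + 4 then y (q + 7) else z (q + 7))"
    using words_step(1) by (cases "i = 0"; auto simp: rho0_right rho_y rho_z)+
  then show ?case using words_step.IH by auto
qed simp

text \<open>Every element of \<open>W J\<close> is even, so a bound on the support is all that is
  needed to pass to the other group.\<close>

lemma even_support_in_W:
  assumes "g \<in> W J" "J \<subseteq> {..<q + 7}" "K \<subseteq> {..<q + 7}" "fullW K B" "finite B"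
    "\<And>x. x \<in> V \<Longrightarrow> x \<notin> B \<Longrightarrow> g x = x"
  shows "g \<in> W K"
proof -
  interpret K: fun_group "W K" by (rule fun_group_words[OF assms(3)])
  have g: "g permutes V" "evenperm g" using W_even[OF assms(1,2)] by auto
  then have "g permutes V \<inter> B" by (intro permutes_superset[OF g(1)]) (use assms(6) in blast)
  then show ?thesis using K.full_even[of "V \<inter> B" g] K.full_subset[OF assms(4)] g(2) finite_V by blast
qed

section \<open>The local condition with lower index 0 or 1\<close>

lemma local_low:
  assumes k: "k = 1 \<or> k = 2" "Suc a = k" and b: "3 \<le> b" "b \<le> q + 6"
    and g: "g \<in> W {a..<b}" "g \<in> W {k..<Suc b}"
  shows "g \<in> W {k..<b}"
proof -
  interpret A: fun_group "W {a..<b}" by (rule fun_group_words) (use b in auto)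
  interpret B: fun_group "W {k..<Suc b}" by (rule fun_group_words) (use b in auto)
  interpret C: fun_group "W {k..<b}" by (rule fun_group_words) (use b in auto)
  have CA: "h \<in> W {a..<b}" "h \<in> W {k..<Suc b}" if "h \<in> W {k..<b}" for h
    using words_mono[OF that] k by auto
  \<comment> \<open>The target group lies in both groups being intersected, so dividing by one of
    its elements preserves hypotheses and goal. Each use cancels one part of the action of
    \<open>g\<close>.\<close>
  have red: "g \<in> W {k..<b}"
    if "g \<in> W {a..<b}" "g \<in> W {k..<Suc b}" "h \<in> W {k..<b}"
      "inv' h \<circ> g \<in> W {a..<b} \<Longrightarrow> inv' h \<circ> g \<in> W {k..<Suc b} \<Longrightarrow> inv' h \<circ> g \<in> W {k..<b}" for g h
    using that CA[OF that(3)] A.comp A.inv_in B.comp B.inv_in C.inv_comp_left by blast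
  \<comment> \<open>The full set for \<open>k = 2\<close> does not contain y_1; that
    \<open>g\<close> fixes this point comes from its second membership, which lacks the labels 0 and
    1.\<close>
  have y1: "g (y 1) = y 1" if "g \<in> W {k..<Suc b}" "k = 2" for g
    by (rule words_fix[OF that(1)]) (use that(2) b in \<open>auto simp: rho_y\<close>)
  have fixed: "inv' h (g x) = x" if "h x = g x" "h \<in> W {k..<b}" for h g :: "'a \<Rightarrow> 'a" and x
    using that C.bij[OF that(2)] by (metis bij_inv_eq_iff)
  have core: "g \<in> W {k..<b}"
    if g: "g \<in> W {a..<b}" "g \<in> W {k..<Suc b}" and left: "\<And>m. m \<le> 2 * t \<Longrightarrow> g (u m) = u m" for g
  proof -
    have J: "{a..<b} \<subseteq> {..<q + 7}" "{k..<b} \<subseteq> {..<q + 7}" using b by auto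
    \<comment> \<open>The upper end decides how the rung label q+4 matters: it is absent, or it only
      adds a joint flip of the last two pairs, or label q+5 is present too and the z-path up to q+6
      belongs to the full set.\<close>
    consider "b \<le> q + 4" | "b = q + 5" | "b = q + 6" using b by linarith
    then show ?thesis
    proof cases
      case 1
      have "g (z m) \<in> z ` {3..b}" if "m \<in> {3..b}" for m
        by (rule words_closed[OF g(1)]) (use that 1 in \<open>auto simp: rho_z\<close>)
      then obtain w where w: "w \<in> W {3..<b}" "\<And>m. m \<in> {3..b} \<Longrightarrow> w (z m) = g (z m)"
        using agree_z[OF g(1) J(1), of 3 b] 1 by auto
      have wC: "w \<in> W {k..<b}" by (rule words_mono[OF w(1)]) (use k in auto)
      show ?thesis
      proof (rule red[OF g wC])
        let ?g = "inv' w \<circ> g"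
        assume g': "?g \<in> W {a..<b}" "?g \<in> W {k..<Suc b}"
        show "?g \<in> W {k..<b}"
        proof (rule even_support_in_W[OF g'(1) J full_y[OF k(1) b(1)]])
          fix x assume "x \<in> V" "x \<notin> y ` {k..b}"
          then show "?g x = x"
          proof (cases rule: V_cases)
            case (u m)
            then show ?thesis using fixed[of w x g] wC left[of m] W_right_z[OF w(1) _ u(1)] b by simp
          next
            case (y m)
            show ?thesis
            proof (cases "m = 1 \<and> k = 2")
              case True
              then show ?thesis using y1[OF g'(2)] y by simp
            next
              case False
              then have "b < m" using \<open>x \<notin> y ` {k..b}\<close> y k by force
              then show ?thesis unfolding y(3)
                by (intro words_fix[OF g'(1)])
                  (use 1 y in \<open>auto simp: rho_y_fix\<close>)
            qed
          next
            case (z m)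
            show ?thesis
            proof (cases "m \<le> b")
              case True
              then show ?thesis using fixed[of w x g] wC w(2)[of m] z by simp
            next
              case False
              then show ?thesis unfolding z(3)
                by (intro words_fix[OF g'(1)]) (use 1 z in \<open>auto simp: rho_z\<close>)
            qed
          qed
        qed (use b in auto)
      qed
    next
      case 2
      have "g (z m) \<in> z ` {3..b}" if "m \<in> {3..b}" for m
        by (rule words_closed[OF g(1)]) (use that 2 in \<open>auto simp: rho_z\<close>)
      then obtain w where w: "w \<in> W {3..<b}" "\<And>m. m \<in> {3..b} \<Longrightarrow> w (z m) = g (z m)"
        using agree_z[OF g(1) J(1), of 3 b] 2 by auto
      have wC: "w \<in> W {k..<b}" by (rule words_mono[OF w(1)]) (use k in auto)
      have fin: "g \<in> W {k..<b}" if g: "g \<in> W {a..<b}" "g \<in> W {k..<Suc b}"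
        and left: "\<And>m. m \<le> 2 * t \<Longrightarrow> g (u m) = u m" and mid: "\<And>m. m \<in> {3..b} \<Longrightarrow> g (z m) = z m"
        and tail: "\<And>m. m = q + 6 \<or> m = q + 7 \<Longrightarrow> g (y m) = y m \<and> g (z m) = z m" for g
      proof (rule even_support_in_W[OF g(1) J full_y[OF k(1) b(1)]])
        fix x assume "x \<in> V" "x \<notin> y ` {k..b}"
        then show "g x = x"
        proof (cases rule: V_cases)
          case (u m)
          then show ?thesis using left by simp
        next
          case (y m)
          show ?thesis
          proof (cases "m = 1 \<and> k = 2")
            case True
            then show ?thesis using y1[OF g(2)] y by simp
          next
            case False
            then have "b < m" using \<open>x \<notin> y ` {k..b}\<close> y k by force
            then have "m = q + 6 \<or> m = q + 7" using y 2 by linarith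
            then show ?thesis using y tail[of m] by blast
          qed
        next
          case (z m)
          then have "m \<in> {3..b} \<or> m = q + 6 \<or> m = q + 7" using 2 by auto
          then show ?thesis using tail[of m] mid[of m] z by blast
        qed
      qed (use b in auto)
      show ?thesis
      proof (rule red[OF g wC])
        let ?g = "inv' w \<circ> g"
        assume g': "?g \<in> W {a..<b}" "?g \<in> W {k..<Suc b}"
        have left': "?g (u m) = u m" if "m \<le> 2 * t" for m
          using fixed[of w "u m" g] wC left[OF that] W_right_z[OF w(1) _ that] b by simp
        have mid': "?g (z m) = z m" if "m \<in> {3..b}" for m
          using fixed[of w "z m" g] wC w(2)[OF that] by simp
        consider "\<forall>m \<in> {q + 6, q + 7}. ?g (y m) = y m \<and> ?g (z m) = z m"
          | "\<forall>m \<in> {q + 6, q + 7}. ?g (y m) = z m \<and> ?g (z m) = y m"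
          using tail_cases[of ?g a] g'(1) 2 by blast
        then show "?g \<in> W {k..<b}"
        proof cases
          case 1
          show ?thesis by (rule fin[OF g' left' mid']) (use 1 in auto)
        next
          case flip: 2
          \<comment> \<open>The labels q+3 and q+4 both lie in the target interval, so the joint
            flip is available to undo the one in \<open>?g\<close>.\<close>
          let ?e = "flip (q + 6) \<circ> flip (q + 7)"
          have e: "?e \<in> W {k..<b}" using 2 k by (intro flips_in_W) auto
          have "?e \<circ> ?g \<in> W {k..<b}"
          proof (rule fin)
            show "?e \<circ> ?g \<in> W {a..<b}" "?e \<circ> ?g \<in> W {k..<Suc b}"
              using CA[OF e] A.comp B.comp g' by blast+
            show "(?e \<circ> ?g) (u m) = u m" if "m \<le> 2 * t" for m
              using left'[OF that] that by (simp add: flip_u)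
            show "(?e \<circ> ?g) (z m) = z m" if "m \<in> {3..b}" for m
              using mid'[OF that] that 2 by (simp add: flip_z)
            show "(?e \<circ> ?g) (y m) = y m \<and> (?e \<circ> ?g) (z m) = z m" if "m = q + 6 \<or> m = q + 7" for m
              using that flip by (auto simp: flip_y flip_z)
          qed
          then show ?thesis using C.comp_inv_left e by blast
        qed
      qed
    next
      case 3
      have fin: "g \<in> W {k..<b}" if g: "g \<in> W {a..<b}" "g \<in> W {k..<Suc b}"
        and left: "\<And>m. m \<le> 2 * t \<Longrightarrow> g (u m) = u m"
        and tail: "g (y (q + 7)) = y (q + 7)" "g (z (q + 7)) = z (q + 7)" for g
      proof (rule even_support_in_W[OF g(1) J])
        show "fullW {k..<b} (y ` {k..b} \<union> z ` {3..b})" using full_yz[OF k(1), of 3] 3 by simp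
        fix x assume x: "x \<in> V" "x \<notin> y ` {k..b} \<union> z ` {3..b}"
        from x(1) show "g x = x"
        proof (cases rule: V_cases)
          case (u m)
          then show ?thesis using left by simp
        next
          case (y m)
          show ?thesis
          proof (cases "m = 1 \<and> k = 2")
            case True
            then show ?thesis using y1[OF g(2)] y by simp
          next
            case False
            then have "b < m" using x(2) y k by force
            then have "m = q + 7" using y 3 by simp
            then show ?thesis using y tail by simp
          qed
        next
          case (z m)
          then have "b < m" using x(2) by force
          then have "m = q + 7" using z 3 by simp
          then show ?thesis using z tail by simp
        qed
      qed auto
      consider "g (y (q + 7)) = y (q + 7)" "g (z (q + 7)) = z (q + 7)"
        | "g (y (q + 7)) = z (q + 7)" "g (z (q + 7)) = y (q + 7)"
        using last_cases[of g a] g(1) 3 by blast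
      then show ?thesis
      proof cases
        case 1
        then show ?thesis using fin[OF g left] by blast
      next
        case 2
        \<comment> \<open>\<open>rho (q + 4)\<close> restores the last pair; everything else it
          moves lies in the full set, where only evenness counts.\<close>
        have e: "rho (q + 4) \<in> W {k..<b}" using 3 k by (intro words_gen) auto
        have "rho (q + 4) \<circ> g \<in> W {k..<b}"
        proof (rule fin)
          show "rho (q + 4) \<circ> g \<in> W {a..<b}" "rho (q + 4) \<circ> g \<in> W {k..<Suc b}"
            using CA[OF e] A.comp B.comp g by blast+
        qed (use 2 left in \<open>auto simp: rho_u rho_y rho_z\<close>)
        then show ?thesis using C.comp_inv_left e by blast
      qed
    qed
  qed
  obtain h where h: "h \<in> W {k..<3}" "\<And>m. m \<le> 2 * t \<Longrightarrow> g (u m) = h (u m)"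
    by (rule left_part[OF g(2)]) (use k b in auto)
  have hC: "h \<in> W {k..<b}" by (rule words_mono[OF h(1)]) (use b in auto)
  show ?thesis
  proof (rule red[OF g hC])
    assume g': "inv' h \<circ> g \<in> W {a..<b}" "inv' h \<circ> g \<in> W {k..<Suc b}"
    show "inv' h \<circ> g \<in> W {k..<b}" 
    proof (rule core[OF g'])
      show "(inv' h \<circ> g) (u m) = u m" if "m \<le> 2 * t" for m
        unfolding comp_apply by (rule fixed[of h "u m" g, OF h(2)[OF that, symmetric] hC])
    qed
  qed
qed

section \<open>The local condition with lower index at least 2: signed permutations of the
  pairs\<close>

lemma pair_image:
  assumes "g \<in> W {k..<q + 7}" "3 \<le> k" "k \<le> m" "m \<le> q + 7"
  obtains m' where "k \<le> m'" "m' \<le> q + 7"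
    "g (y m) = y m' \<and> g (z m) = z m' \<or> g (y m) = z m' \<and> g (z m) = y m'"
proof -
  have "\<exists>m'. k \<le> m' \<and> m' \<le> q + 7 \<and>
      (g (y m) = y m' \<and> g (z m) = z m' \<or> g (y m) = z m' \<and> g (z m) = y m')"
    using assms(1)
  proof induction
    case words_id
    show ?case using assms by (intro exI[of _ m]) simp
  next
    case (words_step i g)
    then obtain m' where m': "k \<le> m'" "m' \<le> q + 7"
      "g (y m) = y m' \<and> g (z m) = z m' \<or> g (y m) = z m' \<and> g (z m) = y m'" by blast
    have i: "k \<le> i" "i < q + 7" using words_step by auto
    define m2 where "m2 = (if i = m' then m' + 1 else if i + 1 = m' then i else m')"
    have "k \<le> m2" "m2 \<le> q + 7" using i m' by (auto simp: m2_def)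
    moreover have "rho i (y m') = y m2 \<and> rho i (z m') = z m2 \<or> rho i (y m') = z m2 \<and> rho i (z m') = y m2"
      using i m'(1,2) assms(2) by (auto simp: m2_def rho_y rho_z)
    ultimately show ?case using m'(3) by (intro exI[of _ m2]) auto
  qed
  then show ?thesis using that by blast
qed

lemma fixes_low:
  assumes "g \<in> W {k..<q + 7}" "3 \<le> k" "1 \<le> m" "m < k" "m \<le> q + 7"
  shows "g (y m) = y m"
  by (rule words_fix[OF assms(1)], rule rho_y_fix) (use assms in auto)

text \<open>Pairs are mapped to pairs, so fixing every y_m forces every z_m to be fixed; the left
  path is out of reach of labels from 3 on.\<close>

lemma fixes_y_imp_id:
  assumes g: "g \<in> W {k..<q + 7}" "3 \<le> k" and fix_y: "\<And>m. k \<le> m \<Longrightarrow> m \<le> q + 7 \<Longrightarrow> g (y m) = y m"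
  shows "g = id"
proof
  have g3: "g \<in> W {3..<q + 7}" by (rule words_mono[OF g(1)]) (use g(2) in auto)
  have y: "g (y m) = y m" if "1 \<le> m" "m \<le> q + 7" for m
    using fixes_low[OF g] fix_y that by (cases "k \<le> m") auto
  fix x show "g x = id x"
  proof (cases "x \<in> V")
    case False
    have "g permutes V" using W_even[OF g3] by force
    then show ?thesis using False by (simp add: permutes_not_in)
  next
    case True
    then show ?thesis
    proof (cases rule: V_cases)
      case (u m)
      then show ?thesis using W_right_z[OF g3] by simp
    next
      case (y m)
      then show ?thesis using \<open>\<And>m. 1 \<le> m \<Longrightarrow> m \<le> q + 7 \<Longrightarrow> g (y m) = y m\<close> by simp
    next
      case (z m)
      obtain m' where m': "3 \<le> m'" "m' \<le> q + 7"
        "g (y m) = y m' \<and> g (z m) = z m' \<or> g (y m) = z m' \<and> g (z m) = y m'"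
        by (rule pair_image[OF g3 _ z(1,2)]) auto
      have "g (y m) = y m" using y z by simp
      then have "m' = m" "g (y m) = y m'" using m' z y_eq[of m m'] y_z[of m m'] by auto
      then show ?thesis using m' z y_z[of m m] by auto
    qed
  qed
qed

text \<open>A single flip of a pair is a transposition, hence odd.\<close>

lemma last_not_flipped:
  assumes g: "g \<in> W {k..<q + 7}" "3 \<le> k" "k \<le> q + 7"
    and fix_y: "\<And>m. k \<le> m \<Longrightarrow> m < q + 7 \<Longrightarrow> g (y m) = y m"
    and last: "g (y (q + 7)) = y (q + 7) \<or> g (y (q + 7)) = z (q + 7)"
  shows "g (y (q + 7)) = y (q + 7)"
proof (rule ccontr)
  assume "g (y (q + 7)) \<noteq> y (q + 7)"
  then have 7: "g (y (q + 7)) = z (q + 7)" using last by blast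
  have g3: "g \<in> W {3..<q + 7}" by (rule words_mono[OF g(1)]) (use g(2) in auto)
  have gy: "g (y m) = y m" if "1 \<le> m" "m < q + 7" for m
    using fixes_low[OF g(1,2)] fix_y that by (cases "k \<le> m") auto
  have perm: "g permutes V" "evenperm g" using W_even[OF g3] by force+
  have "g = flip (q + 7)"
  proof
    fix x show "g x = flip (q + 7) x"
    proof (cases "x \<in> V")
      case False
      then have "x \<noteq> y (q + 7)" "x \<noteq> z (q + 7)" using in_V by auto
      then show ?thesis using perm(1) False by (simp add: permutes_not_in)
    next
      case True
      then show ?thesis
      proof (cases rule: V_cases)
        case (u m)
        then show ?thesis using W_right_z[OF g3] by (simp add: flip_u)
      next
        case (y m)
        then show ?thesis using gy[of m] 7 by (cases "m = q + 7") (simp_all add: flip_y)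
      next
        case (z m)
        obtain m' where m': "3 \<le> m'" "m' \<le> q + 7"
          "g (y m) = y m' \<and> g (z m) = z m' \<or> g (y m) = z m' \<and> g (z m) = y m'"
          by (rule pair_image[OF g3 _ z(1,2)]) auto
        show ?thesis
        proof (cases "m = q + 7")
          case True
          have "y m' \<noteq> z (q + 7)" "z m' = z (q + 7) \<longleftrightarrow> m' = q + 7"
            using m'(1,2) z_eq[of m' "q + 7"] y_z[of m' "q + 7"] by simp_all
          then have "m' = q + 7" "g (z m) = y m'" using 7 m'(3) True by metis+
          then show ?thesis using True z by simp
        next
          case False
          then have "g (y m) = y m" using gy[of m] z by simp
          then have "m' = m" "g (z m) = z m'" using m' z y_eq[of m m'] y_z[of m m'] by auto
          then show ?thesis using False z by (simp add: flip_z)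
        qed
      qed
    qed
  qed
  then have "\<not> evenperm g" using y_z[of "q + 7" "q + 7"] by (simp add: flip_def evenperm_swap)
  then show False using perm(2) by blast
qed

text \<open>Each set takes one point from each of the last four pairs, with the sign reversed at
  q+4. Then \<open>rho (q + 4)\<close> exchanges \<open>X\<close> and \<open>X'\<close>, and the two
  later generators preserve both. This ties the signs of the four pairs together.\<close>

lemma block_cases:
  assumes "g \<in> W {q + 4..<q + 7}"
  defines "X \<equiv> {z (q + 4), y (q + 5), y (q + 6), y (q + 7)}"
    and "X' \<equiv> {y (q + 4), z (q + 5), z (q + 6), z (q + 7)}"
  shows "g ` X \<subseteq> X \<and> g ` X' \<subseteq> X' \<or> g ` X \<subseteq> X' \<and> g ` X' \<subseteq> X"
  using assms(1)
proof induction
  case (words_step i g)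
  have "i = q + 4 \<or> i = q + 5 \<or> i = q + 6" using words_step(1) by auto
  then have "rho i ` X \<subseteq> X \<and> rho i ` X' \<subseteq> X' \<or> rho i ` X \<subseteq> X' \<and> rho i ` X' \<subseteq> X"
    unfolding X_def X'_def
    by (elim disjE) (simp_all add: rho_y rho_z add.commute)
  then show ?case using words_step.IH unfolding image_subset_iff comp_apply by blast
qed simp

text \<open>Every pair has one point in each block, so flipping one pair and fixing another would
  tear a block apart.\<close>

lemma flip_all_or_none:
  assumes g: "g \<in> W {q + 4..<q + 7}"
    and pairs: "\<And>m. q + 4 \<le> m \<Longrightarrow> m \<le> q + 7 \<Longrightarrow> g (y m) = y m \<or> g (y m) = z m"
  shows "(\<forall>m. q + 4 \<le> m \<longrightarrow> m \<le> q + 7 \<longrightarrow> g (y m) = y m) \<or>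
    (\<forall>m. q + 4 \<le> m \<longrightarrow> m \<le> q + 7 \<longrightarrow> g (y m) = z m)"
proof -
  define X X' where "X = {z (q + 4), y (q + 5), y (q + 6), y (q + 7)}"
    and "X' = {y (q + 4), z (q + 5), z (q + 6), z (q + 7)}"
  have disj: "x \<notin> X'" if "x \<in> X" for x
    using that unfolding X_def X'_def by (auto simp: y_eq y_z z_y z_eq)
  have mem: "y m \<in> X \<and> z m \<in> X' \<or> y m \<in> X' \<and> z m \<in> X" if "q + 4 \<le> m" "m \<le> q + 7" for m
  proof -
    have "m = q + 4 \<or> m = q + 5 \<or> m = q + 6 \<or> m = q + 7" using that by auto
    then show ?thesis unfolding X_def X'_def by blast
  qed
  from block_cases[OF g, folded X_def X'_def] show ?thesis
  proof
    assume a: "g ` X \<subseteq> X \<and> g ` X' \<subseteq> X'"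
    have "g (y m) = y m" if "q + 4 \<le> m" "m \<le> q + 7" for m
      using pairs[OF that] mem[OF that] a disj by (metis image_subset_iff)
    then show ?thesis by blast
  next
    assume a: "g ` X \<subseteq> X' \<and> g ` X' \<subseteq> X"
    have "g (y m) = z m" if "q + 4 \<le> m" "m \<le> q + 7" for m
      using pairs[OF that] mem[OF that] a disj by (metis image_subset_iff)
    then show ?thesis by blast
  qed
qed

lemma local_high:
  assumes k: "3 \<le> k" "Suc a = k" and b: "a < b" "b \<le> q + 6"
    and g: "g \<in> W {a..<b}" "g \<in> W {k..<Suc b}"
  shows "g \<in> W {k..<b}"
proof -
  interpret A: fun_group "W {a..<b}" by (rule fun_group_words) (use b in auto)
  interpret B: fun_group "W {k..<Suc b}" by (rule fun_group_words) (use b in auto)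
  interpret C: fun_group "W {k..<b}" by (rule fun_group_words) (use b in auto)
  have CA: "h \<in> W {a..<b}" "h \<in> W {k..<Suc b}" if "h \<in> W {k..<b}" for h
    using words_mono[OF that] k by auto
  have red: "g \<in> W {k..<b}"
    if "g \<in> W {a..<b}" "g \<in> W {k..<Suc b}" "h \<in> W {k..<b}"
      "inv' h \<circ> g \<in> W {a..<b} \<Longrightarrow> inv' h \<circ> g \<in> W {k..<Suc b} \<Longrightarrow> inv' h \<circ> g \<in> W {k..<b}" for g h
    using that CA[OF that(3)] A.comp A.inv_in B.comp B.inv_in C.inv_comp_left by blast
  have fixed: "inv' h (g x) = x" if "h x = g x" "h \<in> W {k..<b}" for h g :: "'a \<Rightarrow> 'a" and x
    using that C.bij[OF that(2)] by (metis bij_inv_eq_iff)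
  have B7: "g \<in> W {k..<q + 7}" if "g \<in> W {k..<Suc b}" for g
    by (rule words_mono[OF that]) (use b in auto)
  have JA: "{a..<b} \<subseteq> {..<q + 7}" and JC: "{k..<b} \<subseteq> {..<q + 7}" using b by auto
  have id_C: "g \<in> W {k..<b}" if "g \<in> W {k..<Suc b}" "\<And>m. k \<le> m \<Longrightarrow> m \<le> q + 7 \<Longrightarrow> g (y m) = y m" for g
    using fixes_y_imp_id[OF B7[OF that(1)] k(1) that(2)] C.one by simp
  consider "b \<le> q + 5" | "b = q + 6" using b by linarith
  then show ?thesis
  proof cases
    case 1
    \<comment> \<open>Labels below \<open>b\<close> keep y_a, ..., y_b together, and labels from
      \<open>k\<close> on fix y_a; hence y_k, ..., y_b are permuted among themselves.\<close>
    have "g (y m) \<in> y ` {k..b}" if m: "m \<in> {k..b}" for m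
    proof -
      have "g (y m) \<in> y ` {a..b}"
        by (rule words_closed[OF g(1)]) (use m k 1 in \<open>auto simp: rho_y\<close>)
      moreover have "g (y a) = y a" by (rule fixes_low[OF B7[OF g(2)] k(1)]) (use k b 1 in auto)
      then have "g (y m) \<noteq> y a"
        using W_inj[OF g(1) JA, of "y m" "y a"] y_eq[of m a] m k 1 by auto
      moreover have "{a..b} = insert a {k..b}" using k b by auto
      ultimately show ?thesis by auto
    qed
    then obtain w where w: "w \<in> W {k..<b}" "\<And>m. m \<in> {k..b} \<Longrightarrow> w (y m) = g (y m)"
      using agree_y[OF g(1) JA, of k b] k 1 by auto
    show ?thesis
    proof (rule red[OF g w(1)])
      let ?g = "inv' w \<circ> g"
      assume g': "?g \<in> W {a..<b}" "?g \<in> W {k..<Suc b}"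
      have mid: "?g (y m) = y m" if "m \<in> {k..b}" for m
        using fixed[of w "y m" g] w that by simp
      show "?g \<in> W {k..<b}"
      proof (cases "b = q + 5")
        case False
        show ?thesis
        proof (rule id_C[OF g'(2)])
          fix m assume m: "k \<le> m" "m \<le> q + 7"
          show "?g (y m) = y m"
          proof (cases "m \<le> b")
            case True
            then show ?thesis using mid m by simp
          next
            case mb: False
            show ?thesis
              by (rule words_fix[OF g'(1)], rule rho_y_fix) (use mb m 1 False k in auto)
          qed
        qed
      next
        case True
        consider "\<forall>m \<in> {q + 6, q + 7}. ?g (y m) = y m \<and> ?g (z m) = z m"
          | "\<forall>m \<in> {q + 6, q + 7}. ?g (y m) = z m \<and> ?g (z m) = y m"
          using tail_cases[of ?g a] g'(1) True by blast
        then show ?thesis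
        proof cases
          case tail: 1
          show ?thesis
          proof (rule id_C[OF g'(2)])
            fix m assume m: "k \<le> m" "m \<le> q + 7"
            then have "m \<in> {k..b} \<or> m \<in> {q + 6, q + 7}" using True by auto
            then show "?g (y m) = y m" using mid tail by blast
          qed
        next
          case tail: 2
          show ?thesis
          proof (cases "k \<le> q + 3")
            case kq: True
            let ?e = "flip (q + 6) \<circ> flip (q + 7)"
            have e: "?e \<in> W {k..<b}" using True kq by (intro flips_in_W) auto
            have "?e \<circ> ?g \<in> W {k..<b}"
            proof (rule id_C)
              show "?e \<circ> ?g \<in> W {k..<Suc b}" using CA[OF e] B.comp g' by blast
              fix m assume m: "k \<le> m" "m \<le> q + 7"
              then consider "m \<in> {k..b}" | "m = q + 6" | "m = q + 7" using True by force
              then show "(?e \<circ> ?g) (y m) = y m"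
              proof cases
                case 1
                then show ?thesis using mid[OF 1] True k by (simp add: flip_y)
              qed (use tail in \<open>auto simp: flip_z flip_y\<close>)
            qed
            then show ?thesis using C.comp_inv_left e by blast
          next
            case kq: False
            have "?g \<in> W {q + 4..<q + 7}" by (rule words_mono[OF g'(2)]) (use kq True in auto)
            note block = block_cases[OF this]
            have "?g (y (q + 5)) = y (q + 5)" "?g (y (q + 6)) = z (q + 6)"
              using mid[of "q + 5"] tail True k b by auto
            then have False using block by (auto simp: y_eq y_z z_y z_eq)
            then show ?thesis ..
          qed
        qed
      qed
    qed
  next
    case 2
    let ?I = "{k..q + 6}"
    \<comment> \<open>Label q+5 now lets single vertices cross between the paths, so
      \<open>g\<close> is matched on unordered pairs first. The last pair stays apart because q+6 is
      not below \<open>b\<close>.\<close>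
    define pr where "pr m = {y m, z m}" for m
    have last: "x = y (q + 7) \<or> x = z (q + 7)" if "g \<in> W {a..<b}" "g x = y (q + 7) \<or> g x = z (q + 7)" for g x
    proof -
      have "g (y (q + 7)) = g x \<or> g (z (q + 7)) = g x"
        using last_cases[of g a] that 2 by metis
      then show ?thesis using W_inj[OF that(1) JA] by metis
    qed
    have pr_eq: "pr i = pr j \<longleftrightarrow> i = j" if "3 \<le> i" "i \<le> q + 7" "3 \<le> j" "j \<le> q + 7" for i j
      using that y_eq[of i j] y_z[of i j] by (auto simp: pr_def doubleton_eq_iff)
    have pr_g: "\<exists>m' \<in> ?I. g ` pr m = pr m'" if h: "g \<in> W {a..<b}" "g \<in> W {k..<Suc b}" "m \<in> ?I" for g m
    proof -
      obtain m' where m': "k \<le> m'" "m' \<le> q + 7"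
        "g (y m) = y m' \<and> g (z m) = z m' \<or> g (y m) = z m' \<and> g (z m) = y m'"
        by (rule pair_image[OF B7[OF h(2)] k(1), of m]) (use h in auto)
      have "m' \<noteq> q + 7"
      proof
        assume "m' = q + 7"
        then have "y m = y (q + 7) \<or> y m = z (q + 7)" using last[OF h(1)] m'(3) by blast
        then show False using y_eq[of m "q + 7"] y_z[of m "q + 7"] h(3) k by auto
      qed
      then show ?thesis using m' by (intro bexI[of _ m']) (auto simp: pr_def)
    qed
    obtain w where w: "w \<in> W {k..<q + 6}" "\<And>m. m \<in> ?I \<Longrightarrow> w ` pr m = g ` pr m"
    proof (rule words_agree[of pr k "q + 6" "\<lambda>S. g ` S" "\<lambda>g S. g ` S" rho])
      show "inj_on pr ?I" using pr_eq k by (auto simp: inj_on_def)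
      show "g ` pr m \<in> pr ` ?I" if "m \<in> ?I" for m using pr_g[OF g that] by blast
      show "inj_on ((`) g) (pr ` ?I)"
        using A.bij[OF g(1)] by (metis bij_is_inj inj_image_eq_iff inj_onI)
      show "rho i ` pr m = pr (transpose i (Suc i) m)" if "i \<in> {k..<q + 6}" "m \<in> ?I" for i m
      proof -
        have "rho i (y m) = y (transpose i (Suc i) m) \<and> rho i (z m) = z (transpose i (Suc i) m) \<or>
            i = q + 4 \<and> m = q + 6 \<and> rho i (y m) = z m \<and> rho i (z m) = y m"
          using that k by (auto simp: rho_y rho_z transpose_def)
        then show ?thesis by (auto simp: pr_def)
      qed
    qed (auto simp: image_comp)
    have wC: "w \<in> W {k..<b}" using w(1) 2 by simp
    show ?thesis
    proof (rule red[OF g wC])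
      let ?g = "inv' w \<circ> g"
      assume g': "?g \<in> W {a..<b}" "?g \<in> W {k..<Suc b}"
      have pairs: "?g (y m) = y m \<and> ?g (z m) = z m \<or> ?g (y m) = z m \<and> ?g (z m) = y m"
        if "k \<le> m" "m \<le> q + 7" for m
      proof (cases "m = q + 7")
        case True
        then show ?thesis using last_cases[of ?g a] g'(1) 2 by blast
      next
        case False
        then have mI: "m \<in> ?I" using that by auto
        have "?g ` pr m = inv' w ` w ` pr m" using w(2)[OF mI] by (simp add: image_comp)
        then have "?g ` pr m = pr m" using C.bij[OF wC] by (simp add: bij_is_inj)
        moreover have "?g (y m) \<noteq> ?g (z m)"
          using W_inj[OF g'(1) JA] y_z[of m m] that k by simp
        ultimately show ?thesis unfolding pr_def by (auto simp: doubleton_eq_iff)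
      qed
      \<comment> \<open>Only flips are left. The lower end decides which ones the target group
        offers for cancelling: products of two flips, the simultaneous flip of four pairs, or
        none.\<close>
      consider "k \<le> q + 3" | "k = q + 4" | "q + 5 \<le> k" by linarith
      then show "?g \<in> W {k..<b}"
      proof cases
        case kq: 1
        \<comment> \<open>All pairs before \<open>M\<close> are already cleared. A flip found at
          \<open>M\<close> is cancelled at the expense of the last pair, and at the end a lone flip
          of the last pair is excluded by parity.\<close>
        have "h \<in> W {k..<b}"
          if "k \<le> M" "M \<le> q + 7" "h \<in> W {k..<Suc b}"
            "\<And>m. k \<le> m \<Longrightarrow> m \<le> q + 7 \<Longrightarrow> h (y m) = y m \<or> h (y m) = z m"
            "\<And>m. k \<le> m \<Longrightarrow> m < M \<Longrightarrow> h (y m) = y m" for M h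
          using that(2,1,3-)
        proof (induction M arbitrary: h rule: inc_induct)
          case base
          show ?case
          proof (cases "h (y (q + 7)) = y (q + 7)")
            case True
            show ?thesis
            proof (rule id_C[OF base(2)])
              fix m assume "k \<le> m" "m \<le> q + 7"
              then show "h (y m) = y m" using True base(4)[of m] by (cases "m = q + 7") auto
            qed
          next
            case False
            then have last: "h (y (q + 7)) = z (q + 7)" using base(1,3) by blast
            have "h (y (q + 7)) = y (q + 7)"
              by (rule last_not_flipped[OF B7[OF base(2)] k(1)]) (use kq base last in auto)
            then show ?thesis using False by blast
          qed
        next
          case (step M)
          show ?case
          proof (cases "h (y M) = y M")
            case True
            show ?thesis
            proof (rule step.IH)
              show "h (y m) = y m" if "k \<le> m" "m < Suc M" for m
                using True step.prems(4)[of m] that by (cases "m = M") auto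
            qed (use step.prems in auto)
          next
            case False
            let ?e = "flip M \<circ> flip (q + 7)"
            have M: "k \<le> M" "M < q + 7" using step by auto
            have e: "?e \<in> W {k..<b}" unfolding 2
              by (rule flips_in_W) (use M kq k in auto)
            have "?e \<circ> h \<in> W {k..<b}"
            proof (rule step.IH)
              show "?e \<circ> h \<in> W {k..<Suc b}" using CA[OF e] B.comp step.prems(2) by blast
              show "(?e \<circ> h) (y m) = y m \<or> (?e \<circ> h) (y m) = z m" if "k \<le> m" "m \<le> q + 7" for m
                using step.prems(3)[OF that] M that k by (auto simp: flip_y flip_z)
              show "(?e \<circ> h) (y m) = y m" if "k \<le> m" "m < Suc M" for m
              proof (cases "m = M")
                case True
                then show ?thesis using False step.prems(3)[of M] M k by (auto simp: flip_z)
              next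
                case mM: False
                then show ?thesis using step.prems(4)[of m] that M k by (auto simp: flip_y)
              qed
            qed (use M in auto)
            then show ?thesis using C.comp_inv_left e by blast
          qed
        qed
        from this[of k ?g] show ?thesis using kq g' pairs by auto
      next
        case kq: 2
        have "?g \<in> W {q + 4..<q + 7}" using B7[OF g'(2)] kq by simp
        from flip_all_or_none[OF this] pairs kq
        consider "\<And>m. q + 4 \<le> m \<Longrightarrow> m \<le> q + 7 \<Longrightarrow> ?g (y m) = y m"
          | "\<And>m. q + 4 \<le> m \<Longrightarrow> m \<le> q + 7 \<Longrightarrow> ?g (y m) = z m" by blast
        then show ?thesis
        proof cases
          case 1
          then show ?thesis using id_C[OF g'(2)] kq by blast
        next
          case flipped: 2
          let ?e = "(rho (q + 4) \<circ> rho (q + 5)) ^^ 3"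
          have e: "?e \<in> W {k..<b}" using kq 2 by (intro C.funpow_in C.comp words_gen) auto
          show ?thesis
          proof (rule red[OF g' e], rule id_C)
            fix m assume m: "k \<le> m" "m \<le> q + 7"
            have "?e (y m) = z m" using prod4_cube[of m] m kq by simp
            then show "(inv' ?e \<circ> ?g) (y m) = y m"
              using fixed[of ?e "y m" ?g] e flipped[of m] m kq by simp
          qed
        qed
      next
        case kq: 3
        show ?thesis
        proof (rule id_C[OF g'(2)])
          fix m assume m: "k \<le> m" "m \<le> q + 7"
          \<comment> \<open>Labels from q+5 on contain no rung, so the y-path is preserved and no
            flip can occur.\<close>
          have "?g (y m) \<in> y ` {k..q + 7}"
            by (rule words_closed[OF g'(2)]) (use m k kq 2 in \<open>auto simp: rho_y\<close>)
          then show "?g (y m) = y m" using pairs[OF m] y_z[of _ m] m k by (smt (verit) atLeastAtMost_iff image_iff le_trans one_le_numeral)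
        qed
      qed
    qed
  qed
qed

section \<open>The dihedral group generated by \<open>rho 0\<close> and \<open>rho 1\<close>\<close>

definition rot :: "'a \<Rightarrow> 'a" where "rot = rho 0 \<circ> rho 1"

text \<open>A single cycle through the whole path: after u_0 the odd indices ascend to 2t+1, then
  the even ones descend from 2t+2. Its length 2t+3 = L+4 is the first entry n - 2(r-2) of the
  type.\<close>

lemma rot_u:
  assumes "m < 2 * t + 3"
  shows "rot (u m) = (if m = 0 then u 1 else if odd m then (if m = 2 * t + 1 then u (2 * t + 2) else u (m + 2))
    else u (m - 2))"
proof -
  have l: "m + 1 < 2 * t + 3" "m + 1 = 2 * t + 2 \<longleftrightarrow> m = 2 * t + 1" if "odd m"
  proof -
    have "m \<noteq> 2 * t + 2" using that by auto
    then show "m + 1 < 2 * t + 3" using assms by linarith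
  qed simp
  show ?thesis
  proof (cases "odd m")
    case True
    then show ?thesis using assms l rho1_u[of m] rho0_u[of "m + 1"] unfolding rot_def by auto
  next
    case False
    show ?thesis
    proof (cases "m = 0")
      case True
      then show ?thesis using rho1_u[of 0] rho0_u[of 0] unfolding rot_def by simp
    next
      case m0: False
      obtain i where "m = 2 * i" using False by (metis evenE)
      then obtain j where j: "m = 2 * j + 2" using m0 by (cases i) auto
      then have "rho 1 (u m) = u (2 * j + 1)" "rho 0 (u (2 * j + 1)) = u (2 * j)"
        using rho1_u[of m] rho0_u[of "2 * j + 1"] assms by simp_all
      then show ?thesis using j unfolding rot_def by simp
    qed
  qed
qed

lemma rot_up: "j \<le> t \<Longrightarrow> (rot ^^ (j + 1)) (u 0) = u (2 * j + 1)"
proof (induction j)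
  case 0
  then show ?case using rot_u[of 0] by simp
next
  case (Suc j)
  then show ?case using rot_u[of "2 * j + 1"] by simp
qed

lemma rot_down: "j \<le> t + 1 \<Longrightarrow> (rot ^^ (t + 2 + j)) (u 0) = u (2 * (t + 1 - j))"
proof (induction j)
  case 0
  have "(rot ^^ Suc (t + 1)) (u 0) = u (2 * t + 2)"
    unfolding funpow.simps comp_apply rot_up[OF order_refl] using rot_u[of "2 * t + 1"] by simp
  then show ?case by simp
next
  case (Suc j)
  then have "2 * (t + 1 - j) - 2 = 2 * (t + 1 - Suc j)" by simp
  then show ?case using Suc rot_u[of "2 * (t + 1 - j)"] by simp
qed

lemma rot_orbit:
  assumes "m < 2 * t + 3" obtains e where "u m = (rot ^^ e) (u 0)"
proof (cases "odd m")
  case True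
  then obtain j where j: "m = 2 * j + 1" by (rule oddE)
  then have "j \<le> t" using assms by linarith
  then show ?thesis using that rot_up[of j] j by metis
next
  case False
  then obtain j where j: "m = 2 * j" by (metis evenE)
  then have "j \<le> t + 1" using assms by simp
  then show ?thesis using that rot_down[of "t + 1 - j"] j by (metis diff_diff_cancel diff_le_self)
qed

lemma rot_outside:
  "3 \<le> m \<Longrightarrow> m \<le> q + 7 \<Longrightarrow> rot (y m) = y m" "3 \<le> m \<Longrightarrow> m \<le> q + 7 \<Longrightarrow> rot (z m) = z m"
  "x \<notin> V \<Longrightarrow> rot x = x"
  unfolding rot_def by (simp_all add: rho_z_0_2 rho_out rho_y_fix)

lemma rot_pow: "rot ^^ (2 * t + 3) = id"
proof
  fix x
  show "(rot ^^ (2 * t + 3)) x = id x"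
  proof (cases "x \<in> V")
    case False
    then show ?thesis using rot_outside(3) by (simp add: funpow_dvd_fix[where d = 1])
  next
    case True
    then show ?thesis
    proof (cases rule: y_V_cases)
      case (u m)
      then obtain e where e: "x = (rot ^^ e) (u 0)" using rot_orbit by metis
      have "(rot ^^ (2 * t + 3)) (u 0) = u 0"
        using rot_down[of "t + 1"] by (simp add: numeral_eq_Suc add.commute mult_2)
      then show ?thesis unfolding e by (metis funpow_add comp_apply add.commute id_apply)
    qed (use rot_outside in \<open>simp_all add: funpow_dvd_fix[where d = 1]\<close>)
  qed
qed

lemma rot_pow_neq: "0 < e \<Longrightarrow> e < 2 * t + 3 \<Longrightarrow> rot ^^ e \<noteq> id"
proof
  assume e: "0 < e" "e < 2 * t + 3" and eq: "rot ^^ e = id"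
  show False
  proof (cases "e \<le> t + 1")
    case True
    then obtain j where "e = j + 1" "j \<le> t" using e by (metis Suc_eq_plus1 Suc_le_mono gr0_implies_Suc)
    then have "u (2 * j + 1) = u 0" using rot_up[of j] eq by (metis id_apply)
    then show ?thesis using u_eq[of "2 * j + 1" 0] \<open>j \<le> t\<close> by simp
  next
    case False
    then obtain j where j: "e = t + 2 + j" using le_Suc_ex[of "t + 2" e] by auto
    then have "j \<le> t + 1" using e by linarith
    then have "u (2 * (t + 1 - j)) = u 0" using rot_down[of j] eq j by (metis id_apply)
    moreover have "2 * (t + 1 - j) < 2 * t + 3" "2 * (t + 1 - j) \<noteq> 0" using e j by linarith+
    ultimately show ?thesis using u_eq[of "2 * (t + 1 - j)" 0] by simp
  qed
qed

text \<open>An element of the dihedral group commutes with \<open>rot\<close> or conjugates it to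
  its inverse. If it commutes and fixes u_0, it fixes the orbit of u_0; otherwise composing with
  \<open>rho 1\<close>, which also fixes u_0, reduces to that case.\<close>

lemma dihedral_stabilizer:
  assumes g: "g \<in> W {0..<2}" and g0: "g (u 0) = u 0"
  shows "g = id \<or> g = rho 1"
proof -
  have rr: "rho 0 \<circ> rho 0 = id" "rho 1 \<circ> rho 1 = id" using invol by auto
  define tor where "tor = rho 1 \<circ> rho 0"
  have c: "rho 0 \<circ> rot = tor \<circ> rho 0" "rho 1 \<circ> rot = tor \<circ> rho 1"
    "rho 0 \<circ> tor = rot \<circ> rho 0" "rho 1 \<circ> tor = rot \<circ> rho 1"
    unfolding rot_def tor_def using rr by (simp_all add: fun_eq_iff)
  have conj: "g \<circ> rot = rot \<circ> g \<or> g \<circ> rot = tor \<circ> g"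
    using g
  proof induction
    case words_id
    show ?case by simp
  next
    case (words_step i g)
    then have "i = 0 \<or> i = 1" by auto
    then have "rho i \<circ> rot = tor \<circ> rho i" "rho i \<circ> tor = rot \<circ> rho i" using c by auto
    then show ?case using words_step.IH by (metis comp_assoc)
  qed
  have id: "h = id" if h: "h \<in> W {0..<2}" "h (u 0) = u 0" "h \<circ> rot = rot \<circ> h" for h
  proof
    have pw: "h ((rot ^^ e) x) = (rot ^^ e) (h x)" for e x
      using h(3) by (induction e) (simp_all add: fun_eq_iff)
    fix x show "h x = id x"
    proof (cases "x \<in> V")
      case False
      show ?thesis unfolding id_apply by (rule words_fix[OF h(1)]) (use False in \<open>simp add: rho_out\<close>)
    next
      case True
      then show ?thesis
      proof (cases rule: y_V_cases)
        case (u m)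
        then show ?thesis using rot_orbit[OF u(1)] pw h(2) by (metis id_apply)
      next
        case (y m)
        show ?thesis unfolding id_apply y(3)
          by (rule words_fix[OF h(1)], rule rho_y_fix) (use y in auto)
      next
        case (z m)
        show ?thesis unfolding id_apply z(3)
          by (rule words_fix[OF h(1)]) (use z in \<open>simp add: rho_z_0_2\<close>)
      qed
    qed
  qed
  show ?thesis
  proof (cases "g \<circ> rot = rot \<circ> g")
    case True
    then show ?thesis using id g g0 by blast
  next
    case False
    then have "(rho 1 \<circ> g) \<circ> rot = rot \<circ> (rho 1 \<circ> g)" using conj c by (metis comp_assoc)
    moreover have "rho 1 \<circ> g \<in> W {0..<2}" using g by (intro words_step) auto
    moreover have "(rho 1 \<circ> g) (u 0) = u 0" using g0 rho1_u[of 0] by simp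
    ultimately have "rho 1 \<circ> g = id" using id by blast
    then have "g = rho 1" using rr by (metis comp_assoc comp_id id_comp)
    then show ?thesis ..
  qed
qed

lemma local_condition:
  assumes "a < b" "b < q + 7"
  shows "W {a..<b} \<inter> W {Suc a..<Suc b} \<subseteq> W {Suc a..<b}"
proof
  fix g assume "g \<in> W {a..<b} \<inter> W {Suc a..<Suc b}"
  then have g: "g \<in> W {a..<b}" "g \<in> W {Suc a..<Suc b}" by auto
  have single: "{k..<Suc k} = {k}" for k by auto
  consider "b = Suc a" "a < 2" | "a = 0" "b = 2" | "a < 2" "3 \<le> b" | "2 \<le> a" using assms by linarith
  then show "g \<in> W {Suc a..<b}"
  proof cases
    case 1
    \<comment> \<open>The two groups have order 2, and u_a separates them: it is moved by
      \<open>rho a\<close> and fixed by \<open>rho (Suc a)\<close>.\<close>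
    have v: "rho 1 (u 0) = u 0" "rho 2 (u 1) = u 1" "rho 0 (u 0) = u 1" "rho 1 (u 1) = u 2"
      "u 1 \<noteq> u 0" "u 2 \<noteq> u 1"
      using rho1_u[of 0] rho2_u[of 1] rho0_u[of 0] rho1_u[of 1] t_ge u_eq[of 1 0] u_eq[of 2 1]
      by (simp_all flip: numeral_2_eq_2)
    have "a = 0 \<and> Suc a = 1 \<or> a = 1 \<and> Suc a = 2" using 1 by linarith
    then have x: "rho (Suc a) (u a) = u a" "rho a (u a) \<noteq> u a" using v by metis+
    have "g \<in> W {Suc a}" using g(2) 1 single by simp
    then have "g (u a) = u a" by (rule words_fix) (use x in simp)
    moreover have "g = id \<or> g = rho a" using W_single[of g a] g(1) 1 single by simp
    ultimately have "g = id" using x by auto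
    then show ?thesis using words_id by metis
  next
    case 2
    have "g (u 0) = u 0"
    proof (rule words_fix[OF g(2)])
      fix k assume "k \<in> {Suc a..<Suc b}"
      then have "k = 1 \<or> k = 2" using 2 by auto
      then show "rho k (u 0) = u 0" using rho1_u[of 0] rho2_u[of 0] by auto
    qed
    then have "g = id \<or> g = rho 1" using dihedral_stabilizer g(1) 2 by simp
    then show ?thesis using 2 words_id words_gen[of 1 "{Suc a..<b}" rho] by auto
  next
    case 3
    then have "a = 0 \<or> a = Suc 0" by linarith
    then show ?thesis using local_low[of "Suc a" a b g] g assms 3 by auto
  next
    case 4
    then show ?thesis using local_high[of "Suc a" a b g] g assms by auto
  qed
qed

sublocale local_string_C rho "q + 7"
  by unfold_locales (rule local_condition)

end

section \<open>Orders, type and isomorphism\<close>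

context action48 begin

text \<open>The exponents 6 and 4 are 12 divided by its prime factors: the 4-cycle through u_1
  refutes the first, the 3-cycle of \<open>pow4_12\<close> the second.\<close>

lemma order_12:
  "(rho 1 \<circ> rho 2) ^^ 12 = id" "(rho 1 \<circ> rho 2) ^^ 6 \<noteq> id" "(rho 1 \<circ> rho 2) ^^ 4 \<noteq> id"
proof -
  let ?f = "rho 1 \<circ> rho 2" and ?c = "cyc3 (y 1) (y 2) (y 3)"
  have d: "y 1 \<noteq> y 2" "y 2 \<noteq> y 3" "y 1 \<noteq> y 3" by (simp_all add: y_eq)
  have c: "?c ^^ 3 = id" "?c (y 1) = y 2"
    using d by (auto simp: cyc3_def fun_eq_iff funpow_small transpose_def)
  have "?f ^^ 12 = (?f ^^ 4) ^^ 3" by (simp add: funpow_mult)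
  then show "?f ^^ 12 = id" unfolding pow4_12 c(1) .
  show "?f ^^ 4 \<noteq> id" unfolding pow4_12 using c(2) d(1) by auto
  have "?f (u 1) = u 2" "?f (u 2) = u 4" "?f (u 4) = u 3" "?f (u 3) = u 1" "u 4 \<noteq> u 1"
    using prod1_u[of 1] prod1_u[of 2] prod1_u[of 4] prod1_u[of 3] t_ge by (simp_all add: u_eq)
  then have "(?f ^^ 6) (u 1) \<noteq> u 1" unfolding funpow_small by metis
  then show "?f ^^ 6 \<noteq> id" by auto
qed

lemma order_23:
  "(rho 2 \<circ> rho 3) ^^ 6 = id" "(rho 2 \<circ> rho 3) ^^ 3 \<noteq> id" "(rho 2 \<circ> rho 3) ^^ 2 \<noteq> id"
proof -
  let ?f = "rho 2 \<circ> rho 3"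
  define f where "f = ?f"
  have fu: "f (u m) = (if m = 2 then u 3 else if m = 3 then u 2 else u m)" if "m \<le> 2 * t" for m
    unfolding f_def using prod2_u[OF that] by (simp only: comp_apply)
  have fy: "f (y 2) = y 3" "f (y 3) = y 4" "f (y 4) = y 2"
    "\<And>m. 1 \<le> m \<Longrightarrow> m \<noteq> 2 \<Longrightarrow> m \<noteq> 3 \<Longrightarrow> m \<noteq> 4 \<Longrightarrow> m \<le> q + 7 \<Longrightarrow> f (y m) = y m"
    unfolding f_def using prod_y[of 2] by (auto simp: numeral_eq_Suc)
  have fz: "f (z m) = (if m = 3 then z 4 else if m = 4 then z 3 else z m)" if "3 \<le> m" "m \<le> q + 7" for m
    unfolding f_def using prod2_z[OF that] by (simp only: comp_apply)
  show "?f ^^ 6 = id"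
  proof
    fix x
    have "(f ^^ 6) x = x"
    proof (cases "x \<in> V")
      case False
      then show ?thesis unfolding f_def by (rule rho_comp_out)
    next
      case True
      then show ?thesis
      proof (cases rule: V_cases)
        case (u m)
        then have "(f ^^ 2) x = x" using fu[of m] fu[of 2] fu[of 3] t_ge by (auto simp: funpow_small)
        then show ?thesis by (rule funpow_dvd_fix) simp
      next
        case (y m)
        then consider "m = 2" | "m = 3" | "m = 4" | "m \<noteq> 2" "m \<noteq> 3" "m \<noteq> 4" by linarith
        then have "(f ^^ 3) x = x"
        proof cases
          case 4
          then show ?thesis using fy(4)[of m] y by (simp add: funpow_small)
        qed (use fy y in \<open>simp_all add: funpow_small\<close>)
        then show ?thesis by (rule funpow_dvd_fix) simp
      next
        case (z m)
        then have "(f ^^ 2) x = x" using fz[of m] fz[of 3] fz[of 4] by (auto simp: funpow_small)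
        then show ?thesis by (rule funpow_dvd_fix) simp
      qed
    qed
    then show "(?f ^^ 6) x = id x" unfolding f_def by simp
  qed
  have "(f ^^ 3) (u 2) = u 3" using fu[of 2] fu[of 3] t_ge by (simp add: funpow_small)
  then show "?f ^^ 3 \<noteq> id" using u_eq[of 3 2] t_ge unfolding f_def by auto
  have "(f ^^ 2) (y 2) = y 4" using fy by (simp add: funpow_small)
  then show "?f ^^ 2 \<noteq> id" using y_eq[of 4 2] unfolding f_def by auto
qed

text \<open>The cube is checked on the y-path only; \<open>fixes_y_imp_id\<close> takes care of all
  other vertices.\<close>

lemma order_3:
  assumes "3 \<le> k" "k \<le> q + 2 \<or> k = q + 5"
  shows "(rho k \<circ> rho (k + 1)) ^^ 3 = id" "rho k \<circ> rho (k + 1) \<noteq> id"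
proof -
  define f where "f = rho k \<circ> rho (k + 1)"
  have fy: "f (y m) = (if m = k then y (k + 1) else if m = k + 1 then y (k + 2)
      else if m = k + 2 then y k else y m)" if "1 \<le> m" "m \<le> q + 7" for m
    unfolding f_def using prod_y[of k m] assms that by (simp only: comp_apply)
  interpret H: fun_group "W {3..<q + 7}" by (rule fun_group_words) auto
  have "f ^^ 3 \<in> W {3..<q + 7}"
    unfolding f_def using assms by (intro H.funpow_in H.comp words_gen) auto
  moreover have "(f ^^ 3) (y m) = y m" if "3 \<le> m" "m \<le> q + 7" for m
  proof -
    have "m = k \<or> m = k + 1 \<or> m = k + 2 \<or> m \<noteq> k \<and> m \<noteq> k + 1 \<and> m \<noteq> k + 2" by blast
    then show ?thesis using that assms by (elim disjE) (auto simp: funpow_small fy)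
  qed
  ultimately show "(rho k \<circ> rho (k + 1)) ^^ 3 = id"
    unfolding f_def by (intro fixes_y_imp_id[of _ 3]) auto
  have "f (y k) = y (k + 1)" using fy[of k] assms by auto
  moreover have "y (k + 1) \<noteq> y k" using y_eq[of "k + 1" k] assms by auto
  ultimately show "rho k \<circ> rho (k + 1) \<noteq> id" unfolding f_def by (metis id_apply)
qed

lemma order_34:
  "(rho (q + 3) \<circ> rho (q + 4)) ^^ 6 = id" "(rho (q + 3) \<circ> rho (q + 4)) ^^ 3 \<noteq> id"
  "(rho (q + 3) \<circ> rho (q + 4)) ^^ 2 \<noteq> id"
proof -
  let ?f = "rho (q + 3) \<circ> rho (q + 4)"
  have y7: "(?f ^^ 3) (y (q + 7)) = z (q + 7)" unfolding pow3_34 by (simp add: flip_z)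
  then show "?f ^^ 3 \<noteq> id" using y_z[of "q + 7" "q + 7"] by auto
  interpret H: fun_group "W {3..<q + 7}" by (rule fun_group_words) auto
  show "?f ^^ 6 = id"
  proof (rule fixes_y_imp_id[of _ 3])
    show "?f ^^ 6 \<in> W {3..<q + 7}" by (intro H.funpow_in H.comp words_gen) auto
    fix m assume m: "3 \<le> m" "m \<le> q + 7"
    have "?f ^^ 6 = (?f ^^ 3) \<circ> (?f ^^ 3)" by (simp flip: funpow_add)
    then show "(?f ^^ 6) (y m) = y m" unfolding pow3_34 using m by (auto simp: flip_y flip_z)
  qed simp
  have "(?f ^^ 2) (y (q + 3)) = y (q + 5)"
    using prod3_y[of "q + 3"] prod3_y[of "q + 4"] by (simp add: funpow_small)
  then show "?f ^^ 2 \<noteq> id" using y_eq[of "q + 5" "q + 3"] by auto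
qed

lemma order_45:
  "(rho (q + 4) \<circ> rho (q + 5)) ^^ 6 = id" "(rho (q + 4) \<circ> rho (q + 5)) ^^ 3 \<noteq> id"
  "(rho (q + 4) \<circ> rho (q + 5)) ^^ 2 \<noteq> id"
proof -
  let ?f = "rho (q + 4) \<circ> rho (q + 5)"
  have y7: "(?f ^^ 3) (y (q + 7)) = z (q + 7)" using prod4_cube[of "q + 7"] by simp
  then show "?f ^^ 3 \<noteq> id" using y_z[of "q + 7" "q + 7"] by auto
  interpret H: fun_group "W {q + 4..<q + 7}" by (rule fun_group_words) auto
  have f3: "?f ^^ 3 \<in> W {q + 4..<q + 7}" by (intro H.funpow_in H.comp words_gen) auto
  show "?f ^^ 6 = id"
  proof (rule fixes_y_imp_id[of _ "q + 4"])
    show "?f ^^ 6 \<in> W {q + 4..<q + 7}" by (intro H.funpow_in H.comp words_gen) auto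
    fix m assume m: "q + 4 \<le> m" "m \<le> q + 7"
    obtain m' where m': "q + 4 \<le> m'" "m' \<le> q + 7"
      "(?f ^^ 3) (y m) = y m' \<and> (?f ^^ 3) (z m) = z m' \<or> (?f ^^ 3) (y m) = z m' \<and> (?f ^^ 3) (z m) = y m'"
      by (rule pair_image[OF f3 _ m]) auto
    have ym: "(?f ^^ 3) (y m) = z m" using prod4_cube[of m] m by simp
    have "y m' \<noteq> z m" "z m' = z m \<longleftrightarrow> m' = m"
      using m m'(1,2) y_z[of m' m] z_eq[of m' m] by simp_all
    then have "(?f ^^ 3) (z m) = y m" using ym m'(3) by metis
    moreover have "?f ^^ 6 = (?f ^^ 3) \<circ> (?f ^^ 3)" by (simp flip: funpow_add)
    ultimately show "(?f ^^ 6) (y m) = y m" using ym by simp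
  qed simp
  have "(?f ^^ 2) (y (q + 4)) = z (q + 6)"
    using prod4_y[of "q + 4"] prod4_y[of "q + 5"] by (simp add: funpow_small)
  then show "?f ^^ 2 \<noteq> id" using y_z[of "q + 4" "q + 6"] by auto
qed

lemma card_V: "card V = 2 * t + 2 * q + 13"
proof -
  have "inj_on u {..2 * t}" by (rule inj_on_subset[OF inj_u]) auto
  then have c: "card (u ` {..2 * t}) = 2 * t + 1" "card (y ` {1..q + 7}) = q + 7" "card (z ` {3..q + 7}) = q + 5"
    using inj_y inj_z by (simp_all add: card_image)
  have "u ` {..2 * t} \<inter> y ` {1..q + 7} = {}" using u_y by auto
  moreover have "(u ` {..2 * t} \<union> y ` {1..q + 7}) \<inter> z ` {3..q + 7} = {}"
  proof -
    have "u ` {..2 * t} \<inter> z ` {3..q + 7} = {}" using u_z by auto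
    moreover have "y ` {1..q + 7} \<inter> z ` {3..q + 7} = {}" using y_z by auto
    ultimately show ?thesis by (simp add: Int_Un_distrib2)
  qed
  ultimately show ?thesis unfolding V_eq using c by (simp add: card_Un_disjoint)
qed

lemma rho_neq_id: "k < q + 7 \<Longrightarrow> rho k \<noteq> id"
proof
  assume k: "k < q + 7" and eq: "rho k = id"
  show False
  proof (cases "k = 0")
    case True
    then show ?thesis using eq rho0_right[of 1] u_y[of "2 * t" 1] by auto
  next
    case False
    then show ?thesis using eq k rho_y[of k k] y_eq[of "k + 1" k] by auto
  qed
qed

end

section \<open>Transfer to abstract groups and identification with the alternating group\<close>

lemma group_sym_on: "group (sym_on A)"
proof (rule groupI)
  fix g assume "g \<in> carrier (sym_on A)"
  then have "inv' g permutes A" "inv' g \<circ> g = id"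
    by (simp_all add: sym_on_def permutes_inv permutes_inv_o)
  then show "\<exists>h\<in>carrier (sym_on A). h \<otimes>\<^bsub>sym_on A\<^esub> g = \<one>\<^bsub>sym_on A\<^esub>"
    by (intro bexI[of _ "inv' g"]) (simp_all add: sym_on_def)
qed (simp_all add: sym_on_def permutes_compose permutes_id comp_assoc)

text \<open>Each letter is its own inverse, so the inverse case of \<open>generate\<close> adds
  nothing to the words.\<close>

lemma generate_eq_words:
  assumes G: "group G" "mult G = (\<circ>)" "one G = id"
    and s: "\<And>k. k \<in> J \<Longrightarrow> s k \<in> carrier G" "\<And>k. k \<in> J \<Longrightarrow> s k \<circ> s k = id"
  shows "generate G (s ` J) = words s J"
proof (rule equalityI; rule subsetI)
  fix g assume "g \<in> generate G (s ` J)"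
  then show "g \<in> words s J"
  proof induction
    case one
    then show ?case using words_id G(3) by metis
  next
    case (incl h)
    then show ?case using words_gen by blast
  next
    case (inv h)
    then have "inv\<^bsub>G\<^esub> h = h" using s by (intro group.inv_equality[OF G(1)]) (auto simp: G)
    then show ?case using inv words_gen by fastforce
  next
    case (eng h1 h2)
    then show ?case using words_comp G(2) by metis
  qed
next
  fix g assume "g \<in> words s J"
  then show "g \<in> generate G (s ` J)"
  proof induction
    case words_id
    then show ?case using generate.one[of G] G(3) by metis
  next
    case (words_step k g)
    then show ?case using generate.eng[OF generate.incl, of "s k" "s ` J" g G] G(2) by (metis imageI)
  qed
qed

text \<open>Relabelling turns transpositions into transpositions, so a factorisation keeps its
  length.\<close>

lemma evenperm_map_permutation:
  assumes "p permutes A" "finite A" "inj_on f A"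
  shows "evenperm (map_permutation A f p) = evenperm p"
  using assms(1,2)
proof (induction p rule: permutes_induct)
  case id
  then show ?case by (metis assms(3) evenperm_id map_permutation_id')
next
  case (swap a b p)
  have p: "permutation p" "permutation (map_permutation A f p)"
    using swap assms bij_betw_imageI[OF assms(3) refl]
    by (auto simp: permutation_permutes intro!: exI[of _ "f ` A"] map_permutation_permutes)
  have "map_permutation A f (transpose a b \<circ> p) = transpose (f a) (f b) \<circ> map_permutation A f p"
    using swap assms(3) by (simp add: map_permutation_compose' map_permutation_transpose)
  moreover have "f a \<noteq> f b" using swap assms(3) by (auto simp: inj_on_eq_iff)
  ultimately show ?case using swap.hyps swap.IH p
    by (simp only: evenperm_comp permutation_swap_id evenperm_swap)
qed

lemma even_permutations_iso_alt_group:
  assumes A: "finite A" and G: "carrier G = {g. g permutes A \<and> evenperm g}" "mult G = (\<circ>)"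
  shows "G \<cong> alt_group (card A)"
proof -
  let ?B = "{1..card A}"
  obtain f where f: "bij_betw f A ?B" using finite_same_card_bij[OF A, of ?B] by auto
  then have inj: "inj_on f A" and img: "f ` A = ?B" by (auto simp: bij_betw_def)
  let ?g = "inv_into A f"
  have g: "bij_betw ?g ?B A" using f by (rule bij_betw_inv_into)
  have "map_permutation A f \<in> iso G (alt_group (card A))"
  proof (rule isoI)
    show "map_permutation A f \<in> hom G (alt_group (card A))"
      using f inj A by (auto simp: hom_def G alt_group_carrier alt_group_mult map_permutation_permutes
          evenperm_map_permutation map_permutation_compose')
    show "bij_betw (map_permutation A f) (carrier G) (carrier (alt_group (card A)))"
    proof (rule bij_betw_byWitness[where f' = "map_permutation ?B ?g"])
      show "\<forall>p\<in>carrier G. map_permutation ?B ?g (map_permutation A f p) = p"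
        using f inj by (auto simp: G intro!: map_permutation_compose_inv)
      show "\<forall>p\<in>carrier (alt_group (card A)). map_permutation A f (map_permutation ?B ?g p) = p"
        using g img by (auto simp: alt_group_carrier f_inv_into_f intro!: map_permutation_compose_inv)
      show "map_permutation A f ` carrier G \<subseteq> carrier (alt_group (card A))"
        using f inj A by (auto simp: G alt_group_carrier map_permutation_permutes evenperm_map_permutation)
      show "map_permutation ?B ?g ` carrier (alt_group (card A)) \<subseteq> carrier G"
        using g by (auto simp: G alt_group_carrier map_permutation_permutes evenperm_map_permutation bij_betw_def)
    qed
  qed
  then show ?thesis by (rule is_isoI)
qed

text \<open>A divisor of \<open>e\<close> that divides no quotient of \<open>e\<close> by a prime is
  \<open>e\<close> itself; this fixes an order from one trivial power and a few nontrivial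
  ones.\<close>

lemma nat_eq_by_divisors:
  fixes d :: nat
  shows "d dvd 12 \<Longrightarrow> \<not> d dvd 6 \<Longrightarrow> \<not> d dvd 4 \<Longrightarrow> d = 12"
    and "d dvd 6 \<Longrightarrow> \<not> d dvd 3 \<Longrightarrow> \<not> d dvd 2 \<Longrightarrow> d = 6"
    and "d dvd 3 \<Longrightarrow> d \<noteq> 1 \<Longrightarrow> d = 3"
proof -
  have pos: "0 < d" if "d dvd m" "0 < m" for m :: nat
    using that by (metis dvd_0_left neq0_conv)
  show "d = 12" if d: "d dvd 12" "\<not> d dvd 6" "\<not> d dvd 4"
  proof -
    have "d \<le> 12" "0 < d" using dvd_imp_le[OF d(1)] pos[OF d(1)] by simp_all
    then have "d = 1 \<or> d = 2 \<or> d = 3 \<or> d = 4 \<or> d = 5 \<or> d = 6 \<or> d = 7 \<or> d = 8 \<or> d = 9 \<or> d = 10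
        \<or> d = 11 \<or> d = 12" by presburger
    then show ?thesis using d by (elim disjE) simp_all
  qed
  show "d = 6" if d: "d dvd 6" "\<not> d dvd 3" "\<not> d dvd 2"
  proof -
    have "d \<le> 6" "0 < d" using dvd_imp_le[OF d(1)] pos[OF d(1)] by simp_all
    then have "d = 1 \<or> d = 2 \<or> d = 3 \<or> d = 4 \<or> d = 5 \<or> d = 6" by presburger
    then show ?thesis using d by (elim disjE) simp_all
  qed
  show "d = 3" if d: "d dvd 3" "d \<noteq> 1"
  proof -
    have "d \<le> 3" "0 < d" using dvd_imp_le[OF d(1)] pos[OF d(1)] by simp_all
    then have "d = 1 \<or> d = 2 \<or> d = 3" by presburger
    then show ?thesis using d by (elim disjE) simp_all
  qed
qed

context action48 begin

definition G where "G = subgroup_generated (sym_on V) (rho ` {..<q + 7})"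

lemma G_simps [simp]: "mult G = (\<circ>)" "one G = id"
  unfolding G_def by (simp_all add: sym_on_def)

lemma group_G: "group G"
  unfolding G_def by (rule group.group_subgroup_generated[OF group_sym_on])

lemma carrier_G: "carrier G = W {..<q + 7}"
proof -
  have sub: "rho ` {..<q + 7} \<subseteq> carrier (sym_on V)" using rho_permutes by (auto simp: sym_on_def)
  have "generate (sym_on V) (rho ` {..<q + 7}) = W {..<q + 7}"
    by (rule generate_eq_words[OF group_sym_on]) (use rho_permutes invol in \<open>auto simp: sym_on_def\<close>)
  then show ?thesis unfolding G_def carrier_subgroup_generated using sub by (simp add: Int_absorb1)
qed

lemma generate_G:
  assumes "J \<subseteq> {..<q + 7}" shows "generate G (rho ` J) = W J"
proof (rule generate_eq_words[OF group_G G_simps])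
  show "rho k \<in> carrier G" if "k \<in> J" for k
    unfolding carrier_G by (rule words_gen) (use that assms in auto)
  show "rho k \<circ> rho k = id" if "k \<in> J" for k using that assms invol by auto
qed

lemma pow_G: "f [^]\<^bsub>G\<^esub> (e::nat) = f ^^ e"
proof (induction e)
  case 0
  show ?case by (simp add: nat_pow_def)
next
  case (Suc e)
  have "f [^]\<^bsub>G\<^esub> Suc e = (f [^]\<^bsub>G\<^esub> e) \<otimes>\<^bsub>G\<^esub> f" by (simp add: nat_pow_def)
  then show ?case using Suc by (simp only: G_simps funpow_Suc_right)
qed

lemma G_iso_alt: "G \<cong> alt_group (2 * t + 2 * q + 13)"
  using even_permutations_iso_alt_group[OF finite_V, of G] carrier_G W_all card_V by simp

lemma rho_in_G: "k < q + 7 \<Longrightarrow> rho k \<in> carrier G"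
  unfolding carrier_G by (rule words_gen) auto

lemma string_C_group_G: "string_C_group G (q + 7) rho"
proof -
  have "(rho i \<otimes>\<^bsub>G\<^esub> rho j) [^]\<^bsub>G\<^esub> (2::nat) = \<one>\<^bsub>G\<^esub>"
    if ij: "i < q + 7" "j < q + 7" "i + 2 \<le> j \<or> j + 2 \<le> i" for i j
  proof -
    have "rho i (rho j x) = rho j (rho i x)" for x using rho_commute ij by metis
    then have "((rho i \<circ> rho j) ^^ 2) x = x" for x using rho_rho ij by (simp add: funpow_small)
    then show ?thesis unfolding pow_G by (simp add: fun_eq_iff)
  qed
  moreover have "rho i \<otimes>\<^bsub>G\<^esub> rho i = \<one>\<^bsub>G\<^esub>" if "i < q + 7" for i using invol[OF that] by simp
  ultimately have "sggi G (q + 7) rho"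
    unfolding sggi_def using group_G rho_in_G rho_neq_id generate_G[OF order_refl] carrier_G by auto
  moreover have "intersection_property G (q + 7) rho"
    unfolding intersection_property_def
  proof (intro allI impI)
    fix J K assume JK: "J \<subseteq> {..<q + 7}" "K \<subseteq> {..<q + 7}"
    then have "J \<inter> K \<subseteq> {..<q + 7}" by auto
    then show "generate G (rho ` J) \<inter> generate G (rho ` K) = generate G (rho ` (J \<inter> K))"
      using JK by (simp only: generate_G intersect_words)
  qed
  ultimately show ?thesis unfolding string_C_group_def by blast
qed

lemma ord_G:
  assumes "f \<in> carrier G" shows "f ^^ e = id \<longleftrightarrow> group.ord G f dvd e"
  using group.pow_eq_id[OF group_G assms, of e] by (simp add: pow_G)

lemma ord_prod:
  assumes "k < q + 6"
  shows "group.ord G (rho k \<circ> rho (k + 1)) =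
    (if k = 0 then 2 * t + 3 else if k = 1 then 12 else if k = 2 \<or> k = q + 3 \<or> k = q + 4 then 6 else 3)"
proof -
  let ?f = "rho k \<circ> rho (k + 1)" and ?d = "group.ord G (rho k \<circ> rho (k + 1))"
  have "?f \<in> carrier G"
    unfolding carrier_G by (intro words_comp words_gen) (use assms in auto)
  note ord = ord_G[OF this]
  consider "k = 0" | "k = 1" | "k = 2" | "k = q + 3" | "k = q + 4" | "3 \<le> k" "k \<le> q + 2 \<or> k = q + 5"
    using assms by linarith
  then show ?thesis
  proof cases
    case 1
    then have f: "?f = rot" by (simp add: rot_def)
    have d: "?d dvd 2 * t + 3" using rot_pow ord[of "2 * t + 3"] f by simp
    then have "?d \<le> 2 * t + 3" "0 < ?d" using dvd_imp_le[OF d] dvd_pos_nat[OF _ d] by simp_all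
    moreover have "rot ^^ ?d = id" using ord[of ?d] f by simp
    ultimately have "?d = 2 * t + 3" using rot_pow_neq[of ?d] by linarith
    then show ?thesis using 1 by simp
  next
    case 2
    have "?f = rho 1 \<circ> rho 2" using 2 by (simp add: numeral_2_eq_2)
    then have "?d = 12" using order_12 ord by (intro nat_eq_by_divisors(1)) metis+
    then show ?thesis using 2 by simp
  next
    case 3
    have "?f = rho 2 \<circ> rho 3" using 3 by (simp add: numeral_eq_Suc)
    then have "?d = 6" using order_23 ord by (intro nat_eq_by_divisors(2)) metis+
    then show ?thesis using 3 by simp
  next
    case 4
    have "?f = rho (q + 3) \<circ> rho (q + 4)" using 4 by (simp add: numeral_eq_Suc)
    then have "?d = 6" using order_34 ord by (intro nat_eq_by_divisors(2)) metis+
    then show ?thesis using 4 by simp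
  next
    case 5
    have "?f = rho (q + 4) \<circ> rho (q + 5)" using 5 by (simp add: numeral_eq_Suc)
    then have "?d = 6" using order_45 ord by (intro nat_eq_by_divisors(2)) metis+
    then show ?thesis using 5 by simp
  next
    case 6
    have "?f \<noteq> id" "?f ^^ 3 = id" using order_3[OF 6] by blast+
    then have "?d dvd 3" "?d \<noteq> 1" using ord[of 3] ord[of 1] by auto
    then have "?d = 3" by (rule nat_eq_by_divisors(3))
    then show ?thesis using 6 by auto
  qed
qed

lemma schlafli_type_G:
  "schlafli_type G (q + 7) rho = [2 * t + 3, 12, 6] @ replicate q 3 @ [6, 6, 3]"
proof (rule nth_equalityI)
  show "length (schlafli_type G (q + 7) rho) = length ([2 * t + 3, 12, 6] @ replicate q 3 @ [6, 6, 3])"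
    by (simp add: schlafli_type_def)
  fix k assume "k < length (schlafli_type G (q + 7) rho)"
  then have k: "k < q + 6" by (simp add: schlafli_type_def)
  then have "schlafli_type G (q + 7) rho ! k = group.ord G (rho k \<circ> rho (k + 1))"
    by (simp add: schlafli_type_def)
  moreover consider "k = 0" | "k = 1" | "k = 2" | j where "k = j + 3" "j < q"
    | "k = q + 3" | "k = q + 4" | "k = q + 5"
  proof -
    have "k = 0 \<or> k = 1 \<or> k = 2 \<or> k = k - 3 + 3 \<and> k - 3 < q \<or> k = q + 3 \<or> k = q + 4 \<or> k = q + 5"
      using k by linarith
    then show ?thesis using that by blast
  qed
  then have "(if k = 0 then 2 * t + 3 else if k = 1 then 12 else if k = 2 \<or> k = q + 3 \<or> k = q + 4 then 6 else 3)
      = ([2 * t + 3, 12, 6] @ replicate q 3 @ [6, 6, 3]) ! k"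
    by cases (simp_all add: nth_append)
  ultimately show "schlafli_type G (q + 7) rho ! k = ([2 * t + 3, 12, 6] @ replicate q 3 @ [6, 6, 3]) ! k"
    using ord_prod[OF k] by simp
qed

end

theorem theorem4p8:
  fixes n r :: nat
  assumes "n \<ge> 15" and "n mod 4 = 3"
    and "odd r" and "7 \<le> r" and "real r < (real n - 1) / 2"
  shows "thm48_G n r \<cong> alt_group n
     \<and> string_C_group (thm48_G n r) r (thm48_rho n r)
     \<and> schlafli_type (thm48_G n r) r (thm48_rho n r)
         = [n - 2 * (r - 2), 12, 6] @ replicate (r - 7) 3 @ [6, 6, 3]"
proof -
  have "2 * r + 1 < n" using assms(5) by (simp add: field_simps)
  then interpret graph48 n r using assms by unfold_locales
  obtain q t where qt: "r = q + 7" "n = 2 * t + 2 * q + 13"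
    and act: "action48 q t left_pt (right_pt L) Z (thm48_rho n r) (thm48_V n r)"
    by (rule action48_rho)
  have "thm48_G n r = subgroup_generated (sym_on (thm48_V n r)) (thm48_rho n r ` {..<q + 7})"
    unfolding thm48_G_def graph_group_def qt(1)[symmetric] by (simp add: thm48_rho_def[abs_def])
  then have G: "thm48_G n r = action48.G q (thm48_rho n r) (thm48_V n r)"
    unfolding action48.G_def[OF act] .
  have "n - 2 * (r - 2) = 2 * t + 3" "r - 7 = q" using qt by simp_all
  then show ?thesis
    using action48.G_iso_alt[OF act, folded G qt(2)] action48.string_C_group_G[OF act, folded G qt(1)]
      action48.schlafli_type_G[OF act, folded G qt(1)] by simp
qed

end
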